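(* Let $C_n$ be a cycle of length $n\ge 3$ and let $1\le k\le \nu(C_n)$. Then $I(C_n)^{[k]}$ has a linear resolution if and only if $k=\nu(C_n)$ in case $n$ is odd, and $k\in\{\nu(C_n),\nu(C_n)-1\}$ in case $n$ is even.
   Context: All graphs are finite and simple. Fix a field $\mathbb{K}$. For a graph $G$ with vertex set $V(G)$ (vertices are identified with indeterminates), $R=\mathbb{K}[x\mid x\in V(G)]$ and $I(G)=\langle xy\mid \{x,y\}\in E(G)\rangle\subseteq R$ is the edge ideal. A $k$-matching of $G$ is a set of $k$ pairwise disjoint edges; $\nu(G)$ is the maximum cardinality of a matching (so $\nu(C_n)=\lfloor n/2\rfloor$). The $k$-th square-free power $I(G)^{[k]}$ is the ideal of $R$ generated by the square-free monomials of $I(G)^k$; equivalently it is generated by the products $\prod_{x\in \bigcup_{e\in M}e}x$ over all $k$-matchings $M$ of $G$; for $1\le k\le\nu(G)$ it is nonzero and generated in degree $2k$. For a nonzero graded ideal $J\subseteq R$ with graded Betti numbers $\beta_{i,j}(J)$, $\operatorname{reg}(J)=\max\{j-i\mid \beta_{i,j}(J)\ne 0\}$. A graded ideal $J$ whose minimal generators all have the same degree $d$ has a linear resolution if $\operatorname{reg}(J)=d$. The cycle $C_n$ has vertices $x_1,\dots,x_n$ and edges $\{x_i,x_{i+1}\}$ for $1\le i\le n-1$ and $\{x_1,x_n\}$. *)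

theory Defs
  imports "HOL-Library.Poly_Mapping" "HOL-Algebra.Ideal_Product"
begin

section \<open>Polynomial rings\<close>

text \<open>
  Exponent vectors are finitely supported functions from indeterminates to \<open>nat\<close>, and polynomials
  are finitely supported functions from exponent vectors to coefficients; the type class operations
  of \<^theory>\<open>HOL-Library.Poly_Mapping\<close> are the usual polynomial operations.  The ring
  \<open>K[x | x \<in> V]\<close> consists of the polynomials in which no indeterminate outside \<open>V\<close> occurs.
\<close>

type_synonym ('v, 'k) mpoly = "('v \<Rightarrow>\<^sub>0 nat) \<Rightarrow>\<^sub>0 'k"

definition mpoly_ring :: "'v set \<Rightarrow> ('v, 'k::field) mpoly ring" where
  "mpoly_ring V =
     \<lparr>carrier = {p. \<forall>m \<in> Poly_Mapping.keys p. Poly_Mapping.keys m \<subseteq> V},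
      mult = (*), one = 1, zero = 0, add = (+)\<rparr>"

definition monom_of :: "('v \<Rightarrow>\<^sub>0 nat) \<Rightarrow> ('v, 'k::field) mpoly" where
  "monom_of m = Poly_Mapping.single m 1"

definition indet :: "'v \<Rightarrow> ('v, 'k::field) mpoly" where
  "indet x = monom_of (Poly_Mapping.single x 1)"

definition mdeg :: "('v \<Rightarrow>\<^sub>0 nat) \<Rightarrow> nat" where
  "mdeg m = (\<Sum>x \<in> Poly_Mapping.keys m. Poly_Mapping.lookup m x)"

definition homogeneous :: "nat \<Rightarrow> ('v, 'k::field) mpoly \<Rightarrow> bool" where
  "homogeneous d p \<longleftrightarrow> (\<forall>m \<in> Poly_Mapping.keys p. mdeg m = d)"

lemma mpoly_ring_simps [simp]:
  "p \<in> carrier (mpoly_ring V) \<longleftrightarrow> (\<forall>m \<in> Poly_Mapping.keys p. Poly_Mapping.keys m \<subseteq> V)"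
  "p \<otimes>\<^bsub>mpoly_ring V\<^esub> q = p * q" "\<one>\<^bsub>mpoly_ring V\<^esub> = 1"
  "p \<oplus>\<^bsub>mpoly_ring V\<^esub> q = p + q" "\<zero>\<^bsub>mpoly_ring V\<^esub> = 0"
  by (simp_all add: mpoly_ring_def)

lemma cring_mpoly_ring: "cring (mpoly_ring V :: ('v, 'k::field) mpoly ring)"
proof (rule cringI)
  show "abelian_group (mpoly_ring V :: ('v, 'k) mpoly ring)"
  proof (rule abelian_groupI)
    fix p q :: "('v, 'k) mpoly"
    assume "p \<in> carrier (mpoly_ring V)" "q \<in> carrier (mpoly_ring V)"
    then show "p \<oplus>\<^bsub>mpoly_ring V\<^esub> q \<in> carrier (mpoly_ring V)"
      using Poly_Mapping.keys_add[of p q] unfolding mpoly_ring_simps by blast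
  next
    fix p :: "('v, 'k) mpoly" assume "p \<in> carrier (mpoly_ring V)"
    then have "- p \<in> carrier (mpoly_ring V)" by simp
    moreover have "- p \<oplus>\<^bsub>mpoly_ring V\<^esub> p = \<zero>\<^bsub>mpoly_ring V\<^esub>" by simp
    ultimately show "\<exists>q\<in>carrier (mpoly_ring V). q \<oplus>\<^bsub>mpoly_ring V\<^esub> p = \<zero>\<^bsub>mpoly_ring V\<^esub>"
      by blast
  qed (simp_all add: add_ac)
next
  show "Group.comm_monoid (mpoly_ring V :: ('v, 'k) mpoly ring)"
  proof (rule comm_monoidI)
    fix p q :: "('v, 'k) mpoly"
    assume pq: "p \<in> carrier (mpoly_ring V)" "q \<in> carrier (mpoly_ring V)"
    have "Poly_Mapping.keys m \<subseteq> V" if m: "m \<in> Poly_Mapping.keys (p * q)" for m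
    proof -
      from m Poly_Mapping.keys_mult[of p q] obtain a b where
        ab: "a \<in> Poly_Mapping.keys p" "b \<in> Poly_Mapping.keys q" "m = a + b" by blast
      then have "Poly_Mapping.keys a \<subseteq> V" "Poly_Mapping.keys b \<subseteq> V"
        using pq by simp_all
      then show ?thesis using Poly_Mapping.keys_add[of a b] ab by blast
    qed
    then show "p \<otimes>\<^bsub>mpoly_ring V\<^esub> q \<in> carrier (mpoly_ring V)" by simp
  qed (simp_all add: mult_ac)
qed (simp add: distrib_right)


section \<open>Graphs and square-free powers of edge ideals\<close>

text \<open>
  A graph is given by its vertex set \<open>V\<close> and its set \<open>E\<close> of two-element subsets of \<open>V\<close>.
\<close>

definition finite_simple_graph :: "'v set \<Rightarrow> 'v set set \<Rightarrow> bool" where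
  "finite_simple_graph V E \<longleftrightarrow> finite V \<and> (\<forall>e \<in> E. e \<subseteq> V \<and> card e = 2)"

definition matching :: "'v set set \<Rightarrow> 'v set set \<Rightarrow> bool" where
  "matching E M \<longleftrightarrow> M \<subseteq> E \<and> pairwise disjnt M"

definition matching_number :: "'v set set \<Rightarrow> nat" where
  "matching_number E = Max {card M |M. matching E M}"

definition edge_ideal :: "'v set \<Rightarrow> 'v set set \<Rightarrow> ('v, 'k::field) mpoly set" where
  "edge_ideal V E = Idl\<^bsub>mpoly_ring V\<^esub> {indet x * indet y |x y. {x, y} \<in> E}"

definition squarefree_monomials :: "'v set \<Rightarrow> ('v, 'k::field) mpoly set" where
  "squarefree_monomials V =
     {monom_of m |m. Poly_Mapping.keys m \<subseteq> V \<and> (\<forall>x. Poly_Mapping.lookup m x \<le> 1)}"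

text \<open>
  The ordinary power \<open>I\<^sup>k\<close> is the power of \<open>I\<close> in the multiplicative monoid of ideals of the ring.
\<close>

definition squarefree_power :: "'v set \<Rightarrow> ('v, 'k::field) mpoly set \<Rightarrow> nat \<Rightarrow> ('v, 'k) mpoly set"
  where "squarefree_power V I k =
    Idl\<^bsub>mpoly_ring V\<^esub> (squarefree_monomials V \<inter> (I [^]\<^bsub>ideals_set (mpoly_ring V)\<^esub> k))"

definition cycle_vertices :: "nat \<Rightarrow> nat set" where
  "cycle_vertices n = {1..n}"

definition cycle_edges :: "nat \<Rightarrow> nat set set" where
  "cycle_edges n = {{i, i + 1} |i. 1 \<le> i \<and> i \<le> n - 1} \<union> {{1, n}}"

lemma finite_simple_graph_cycle:
  assumes "n \<ge> 3"
  shows "finite_simple_graph (cycle_vertices n) (cycle_edges n)"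
  unfolding finite_simple_graph_def
proof (intro conjI ballI)
  fix e assume "e \<in> cycle_edges n"
  then consider i where "1 \<le> i" "i \<le> n - 1" "e = {i, i + 1}" | "e = {1, n}"
    unfolding cycle_edges_def by blast
  then show "e \<subseteq> cycle_vertices n" and "card e = 2"
    using assms by (cases; force simp: cycle_vertices_def)+
qed (simp add: cycle_vertices_def)


section \<open>Minimal graded free resolutions, Betti numbers and regularity\<close>

text \<open>
  A graded free resolution \<open>\<dots> \<rightarrow> F\<^sub>2 \<rightarrow> F\<^sub>1 \<rightarrow> F\<^sub>0 \<rightarrow> J \<rightarrow> 0\<close> of an ideal \<open>J\<close> of \<open>R = K[x | x \<in> V]\<close> is
  recorded by matrices.  The module \<open>F\<^sub>i\<close> is free with basis \<open>e\<^sub>0, \<dots>, e\<^bsub>r-1\<^esub>\<close> where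
  \<open>r = res_rank F i\<close>, and \<open>e\<^sub>q\<close> has degree \<open>res_shift F i q\<close>; that is,
  \<open>F\<^sub>i\<close> is the direct sum of the \<open>R(- res_shift F i q)\<close> for \<open>q < r\<close>.
  The augmentation \<open>F\<^sub>0 \<rightarrow> J\<close> maps \<open>e\<^sub>q\<close> to \<open>res_aug F q\<close>, and \<open>res_diff F i p q\<close> is the entry
  in row \<open>p\<close> and column \<open>q\<close> of the matrix of the differential
  \<open>F\<^bsub>i+1\<^esub> \<rightarrow> F\<^sub>i\<close>.  Shifts can be taken in \<open>nat\<close>, since an ideal of \<open>R\<close> lives in degrees
  \<open>\<ge> 0\<close>, and hence so do the basis elements of its minimal graded free resolution.
\<close>

record 'a free_res =
  res_rank :: "nat \<Rightarrow> nat"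
  res_shift :: "nat \<Rightarrow> nat \<Rightarrow> nat"
  res_aug :: "nat \<Rightarrow> 'a"
  res_diff :: "nat \<Rightarrow> nat \<Rightarrow> nat \<Rightarrow> 'a"

text \<open>Elements of \<open>R\<^sup>r\<close> are functions on \<open>nat\<close> that vanish outside \<open>{..<r}\<close>.\<close>

definition free_mod :: "'v set \<Rightarrow> nat \<Rightarrow> (nat \<Rightarrow> ('v, 'k::field) mpoly) set" where
  "free_mod V r = {v. (\<forall>q < r. v q \<in> carrier (mpoly_ring V)) \<and> (\<forall>q \<ge> r. v q = 0)}"

definition aug_map :: "('v, 'k::field) mpoly free_res \<Rightarrow> (nat \<Rightarrow> ('v, 'k) mpoly) \<Rightarrow> ('v, 'k) mpoly" where
  "aug_map F v = (\<Sum>q < res_rank F 0. res_aug F q * v q)"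

definition diff_map ::
    "('v, 'k::field) mpoly free_res \<Rightarrow> nat \<Rightarrow> (nat \<Rightarrow> ('v, 'k) mpoly) \<Rightarrow> nat \<Rightarrow> ('v, 'k) mpoly" where
  "diff_map F i v =
     (\<lambda>p. if p < res_rank F i then \<Sum>q < res_rank F (i + 1). res_diff F i p q * v q else 0)"

definition graded_free_resolution ::
    "'v set \<Rightarrow> ('v, 'k::field) mpoly set \<Rightarrow> ('v, 'k) mpoly free_res \<Rightarrow> bool" where
  "graded_free_resolution V J F \<longleftrightarrow>
     (\<forall>q < res_rank F 0.
        res_aug F q \<in> carrier (mpoly_ring V) \<and> homogeneous (res_shift F 0 q) (res_aug F q)) \<and>
     (\<forall>i. \<forall>p < res_rank F i. \<forall>q < res_rank F (i + 1).
        res_diff F i p q \<in> carrier (mpoly_ring V) \<and>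
        (\<forall>m \<in> Poly_Mapping.keys (res_diff F i p q).
           mdeg m + res_shift F i p = res_shift F (i + 1) q)) \<and>
     aug_map F ` free_mod V (res_rank F 0) = J \<and>
     {v \<in> free_mod V (res_rank F 0). aug_map F v = 0}
       = diff_map F 0 ` free_mod V (res_rank F 1) \<and>
     (\<forall>i. {v \<in> free_mod V (res_rank F (i + 1)). diff_map F i v = (\<lambda>p. 0)}
       = diff_map F (i + 1) ` free_mod V (res_rank F (i + 2)))"

text \<open>
  Minimality means that every differential maps into the maximal homogeneous ideal times the
  target, i.e. that no matrix entry has a constant term.
\<close>

definition minimal_graded_free_resolution ::
    "'v set \<Rightarrow> ('v, 'k::field) mpoly set \<Rightarrow> ('v, 'k) mpoly free_res \<Rightarrow> bool" where
  "minimal_graded_free_resolution V J F \<longleftrightarrow>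
     graded_free_resolution V J F \<and>
     (\<forall>i. \<forall>p < res_rank F i. \<forall>q < res_rank F (i + 1).
        Poly_Mapping.lookup (res_diff F i p q) 0 = 0)"

text \<open>
  For finite \<open>V\<close> a graded ideal has a minimal graded free resolution, and it is unique up to
  isomorphism, so the Betti numbers do not depend on the resolution chosen here.
\<close>

definition graded_betti :: "'v set \<Rightarrow> ('v, 'k::field) mpoly set \<Rightarrow> nat \<Rightarrow> nat \<Rightarrow> nat" where
  "graded_betti V J i j =
     (let F = (SOME F. minimal_graded_free_resolution V J F)
      in card {q. q < res_rank F i \<and> res_shift F i q = j})"

definition regularity :: "'v set \<Rightarrow> ('v, 'k::field) mpoly set \<Rightarrow> int" where
  "regularity V J = Max {int j - int i |i j. graded_betti V J i j \<noteq> 0}"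

definition minimal_homogeneous_generators ::
    "'v set \<Rightarrow> ('v, 'k::field) mpoly set \<Rightarrow> ('v, 'k) mpoly set \<Rightarrow> bool" where
  "minimal_homogeneous_generators V J S \<longleftrightarrow>
     S \<subseteq> carrier (mpoly_ring V) \<and> (\<forall>s \<in> S. \<exists>d. homogeneous d s) \<and>
     Idl\<^bsub>mpoly_ring V\<^esub> S = J \<and> (\<forall>T. T \<subset> S \<longrightarrow> Idl\<^bsub>mpoly_ring V\<^esub> T \<noteq> J)"

text \<open>
  The degrees of the elements of a minimal homogeneous generating set do not depend on the set.
\<close>

definition has_linear_resolution :: "'v set \<Rightarrow> ('v, 'k::field) mpoly set \<Rightarrow> bool" where
  "has_linear_resolution V J \<longleftrightarrow>
     (\<exists>d S. minimal_homogeneous_generators V J S \<and> (\<forall>s \<in> S. homogeneous d s) \<and>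
            regularity V J = int d)"

end

theory Submission
  imports Defs "HOL.Vector_Spaces" "HOL-Library.Function_Algebras"
begin

text \<open>
  The Koszul complex computes \<open>Tor\<^sub>i(K, J)\<close>, so whatever minimal graded free resolution of \<open>J\<close> is
  chosen, \<open>\<beta>\<^sub>i\<^sub>,\<^sub>j(J) \<noteq> 0\<close> iff the \<open>i\<close>-th Koszul homology of \<open>J\<close> is nonzero in degree \<open>j\<close>.  For a
  squarefree monomial ideal this homology lives in squarefree multidegrees \<open>B\<close>, where it is the
  reduced homology of the complex of all \<open>\<sigma> \<subseteq> B\<close> whose complement in \<open>B\<close> still supports a generator.

  For \<open>n \<le> 2k + 2\<close> the only groups that could spoil linearity are \<open>H\<^sub>-\<^sub>1\<close> and, when \<open>n = 2k + 2\<close>, \<open>H\<^sub>0\<close>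
  in multidegree \<open>V(C\<^sub>n)\<close>; the latter complex is complete bipartite between odd and even vertices, hence
  connected.  For \<open>n \<ge> 2k + 4\<close> an edge together with a path on \<open>2k\<close> vertices far from it gives a
  disconnected complex, hence a nonlinear first syzygy.  For \<open>n = 2k + 3\<close> the complex in multidegree
  \<open>V(C\<^sub>n)\<close> has nonzero \<open>H\<^sub>1\<close>.  In both cases this is detected by pairing an explicit cocycle with the
  boundary of a missing face.
\<close>

text \<open>Betti numbers are read off from a resolution picked by \<open>SOME\<close>, so a minimal
  graded free resolution must first be constructed. Its finite ranks do not come from a basis
  theorem: if Koszul homology vanishes above some degree, generators are needed only up to that
  degree, and dimension shifting hands a bound of the same kind on to the syzygies. For a squarefree
  monomial ideal the bound is combinatorial.

  Only the vanishing of homology is recorded, never its dimension; regularity needs no more. In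
  \<open>koszul_exact V X M p d\<close> the number \<open>d\<close> is the degree of the
  coefficients, so the homology sits in internal degree \<open>p + d\<close>, and \<open>d\<close>
  is the difference \<open>j - i\<close> whose maximum is the regularity.

  The case \<open>n = 2 * k + 3\<close> stands apart because an edge and a path on
  \<open>2 * k\<close> vertices, with a missing vertex on either side, occupy
  \<open>2 * k + 4\<close> vertices of the cycle. In both obstructions the pairing has value 1 or
  -1, so the characteristic of the field does not enter.\<close>

abbreviation keys :: "('a \<Rightarrow>\<^sub>0 'b::zero) \<Rightarrow> 'a set" where "keys \<equiv> Poly_Mapping.keys"
abbreviation lookup :: "('a \<Rightarrow>\<^sub>0 'b::zero) \<Rightarrow> 'a \<Rightarrow> 'b" where "lookup \<equiv> Poly_Mapping.lookup"
abbreviation single :: "'a \<Rightarrow> 'b \<Rightarrow> 'a \<Rightarrow>\<^sub>0 'b::zero" where "single \<equiv> Poly_Mapping.single"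

section \<open>The Koszul complex\<close>

text \<open>The sign that sorts \<open>v\<close> into the exterior monomial of
  \<open>\<tau>\<close>. It acts by negation, so coefficients may lie in any abelian group:
  polynomials, tuples of polynomials or field elements.\<close>

definition sgn_ins :: "'v::linorder \<Rightarrow> 'v set \<Rightarrow> 'a::ab_group_add \<Rightarrow> 'a" where
  "sgn_ins v \<tau> a = (if even (card {u \<in> \<tau>. u < v}) then a else - a)"

text \<open>A chain assigns to \<open>\<sigma>\<close> the coefficient of the exterior monomial of
  \<open>\<sigma>\<close>, and the differential is given coefficientwise. With \<open>X v\<close>
  the multiplication by the variable \<open>v\<close> this is the Koszul differential; with
  \<open>X v\<close> the identity it is the augmented simplicial boundary.\<close>

definition koszul_bd ::
    "'v::linorder set \<Rightarrow> ('v \<Rightarrow> 'a \<Rightarrow> 'a::ab_group_add) \<Rightarrow> ('v set \<Rightarrow> 'a) \<Rightarrow> 'v set \<Rightarrow> 'a" where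
  "koszul_bd V X c \<tau> = (\<Sum>v\<in>V - \<tau>. sgn_ins v \<tau> (X v (c (insert v \<tau>))))"

definition koszul_chains :: "'v set \<Rightarrow> nat \<Rightarrow> 'a::zero set \<Rightarrow> ('v set \<Rightarrow> 'a) set" where
  "koszul_chains V p M = {c. \<forall>\<sigma>. c \<sigma> \<in> M \<and> (c \<sigma> \<noteq> 0 \<longrightarrow> \<sigma> \<subseteq> V \<and> card \<sigma> = p)}"

text \<open>The degree \<open>d\<close> is an integer so that \<open>d - 1\<close> never
  truncates.\<close>

definition koszul_exact ::
    "'v::linorder set \<Rightarrow> ('v \<Rightarrow> 'a \<Rightarrow> 'a::ab_group_add) \<Rightarrow> (int \<Rightarrow> 'a set) \<Rightarrow> nat \<Rightarrow> int \<Rightarrow> bool" where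
  "koszul_exact V X M p d \<longleftrightarrow>
     (\<forall>c \<in> koszul_chains V p (M d). koszul_bd V X c = 0 \<longrightarrow>
        (\<exists>b \<in> koszul_chains V (Suc p) (M (d - 1)). koszul_bd V X b = c))"

definition graded_pieces :: "'v set \<Rightarrow> ('v \<Rightarrow> 'a \<Rightarrow> 'a::ab_group_add) \<Rightarrow> (int \<Rightarrow> 'a set) \<Rightarrow> bool" where
  "graded_pieces V X M \<longleftrightarrow>
     (\<forall>d. 0 \<in> M d \<and> (\<forall>a\<in>M d. \<forall>b\<in>M d. a - b \<in> M d)) \<and>
     (\<forall>v\<in>V. \<forall>d. \<forall>a\<in>M d. X v a \<in> M (d + 1))"

definition commuting_actions :: "('v \<Rightarrow> 'a \<Rightarrow> 'a::ab_group_add) \<Rightarrow> bool" where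
  "commuting_actions X \<longleftrightarrow> (\<forall>v. additive (X v)) \<and> (\<forall>v w a. X v (X w a) = X w (X v a))"

section \<open>Signs and the boundary operator\<close>

lemma sgn_ins_zero [simp]: "sgn_ins v \<tau> 0 = 0"
  by (simp add: sgn_ins_def)

lemma sgn_ins_eq_0_iff [simp]: "sgn_ins v \<tau> a = 0 \<longleftrightarrow> a = 0"
  by (simp add: sgn_ins_def)

lemma additive_sgn_ins: "additive (sgn_ins v \<tau>)"
  by (simp add: additive_def sgn_ins_def)

lemma additive_comp_sgn_ins: "additive f \<Longrightarrow> f (sgn_ins v \<tau> a) = sgn_ins v \<tau> (f a)"
  by (simp add: sgn_ins_def additive.minus)

lemma sgn_ins_sgn_ins [simp]: "sgn_ins v \<tau> (sgn_ins v \<tau> a) = a"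
  by (simp add: sgn_ins_def)

lemma card_less_insert:
  fixes v w :: "'v::linorder"
  assumes "finite \<tau>" "w \<notin> \<tau>"
  shows "card {u \<in> insert w \<tau>. u < v} = card {u \<in> \<tau>. u < v} + (if w < v then 1 else 0)"
proof -
  have "{u \<in> insert w \<tau>. u < v} = (if w < v then insert w {u \<in> \<tau>. u < v} else {u \<in> \<tau>. u < v})"
    by auto
  then show ?thesis using assms by auto
qed

text \<open>Two orders of insertion differ by one transposition. The first equation serves the
  vanishing of the double boundary, the second the contraction of cones.\<close>

lemma sgn_ins_swap:
  fixes v w :: "'v::linorder"
  assumes "finite \<tau>" "v \<notin> \<tau>" "w \<notin> \<tau>" "v \<noteq> w"
  shows "sgn_ins v \<tau> (sgn_ins w (insert v \<tau>) a) = - sgn_ins w \<tau> (sgn_ins v (insert w \<tau>) a)"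
    and "sgn_ins w (insert v \<tau>) (sgn_ins v (insert w \<tau>) a) = - sgn_ins v \<tau> (sgn_ins w \<tau> a)"
proof -
  note c = card_less_insert[OF assms(1,3), of v] card_less_insert[OF assms(1,2), of w]
  show "sgn_ins v \<tau> (sgn_ins w (insert v \<tau>) a) = - sgn_ins w \<tau> (sgn_ins v (insert w \<tau>) a)"
    and "sgn_ins w (insert v \<tau>) (sgn_ins v (insert w \<tau>) a) = - sgn_ins v \<tau> (sgn_ins w \<tau> a)"
    using assms(4)
    by (cases v w rule: linorder_cases; auto simp: sgn_ins_def c simp del: insert_iff dest: order.asym)+
qed

lemma additive_koszul_bd:
  assumes "commuting_actions X"
  shows "koszul_bd V X (b + c) = koszul_bd V X b + koszul_bd V X c"
    and "koszul_bd V X (b - c) = koszul_bd V X b - koszul_bd V X c"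
proof -
  have X: "additive (X v)" for v using assms by (simp add: commuting_actions_def)
  show "koszul_bd V X (b + c) = koszul_bd V X b + koszul_bd V X c"
    by (rule ext) (simp add: koszul_bd_def additive.add[OF X] additive.add[OF additive_sgn_ins] sum.distrib)
  show "koszul_bd V X (b - c) = koszul_bd V X b - koszul_bd V X c"
    by (rule ext) (simp add: koszul_bd_def additive.diff[OF X] additive.diff[OF additive_sgn_ins] sum_subtractf)
qed

lemma koszul_bd_comp:
  assumes "additive \<phi>" "\<And>v a. \<phi> (X v a) = Y v (\<phi> a)"
  shows "koszul_bd V Y (\<lambda>\<sigma>. \<phi> (c \<sigma>)) = (\<lambda>\<tau>. \<phi> (koszul_bd V X c \<tau>))"
  by (rule ext) (simp add: koszul_bd_def additive.sum[OF assms(1)] additive_comp_sgn_ins[OF assms(1)] assms(2))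

text \<open>The double boundary is a sum over ordered pairs of distinct new vertices, and the two
  orders of each pair cancel.\<close>

lemma koszul_bd_koszul_bd:
  assumes "finite V" "commuting_actions X" "c \<in> koszul_chains V p M"
  shows "koszul_bd V X (koszul_bd V X c) = 0"
proof
  fix \<tau>
  have X: "additive (X v)" and XX: "X v (X w a) = X w (X v a)" for v w a
    using assms by (simp_all add: commuting_actions_def)
  define t where "t = (\<lambda>(v, w). sgn_ins v \<tau> (sgn_ins w (insert v \<tau>) (X v (X w (c (insert w (insert v \<tau>)))))))"
  show "koszul_bd V X (koszul_bd V X c) \<tau> = 0 \<tau>"
  proof (cases "\<tau> \<subseteq> V")
    case False
    then have "c (insert w (insert v \<tau>)) = 0" for v w
      using assms(3) unfolding koszul_chains_def by blast
    then show ?thesis by (simp add: koszul_bd_def additive.zero[OF X])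
  next
    case True
    then have fin: "finite \<tau>" using assms(1) finite_subset by blast
    let ?L = "{(v, w). v \<in> V - \<tau> \<and> w \<in> V - \<tau> \<and> v < w}"
    let ?G = "{(v, w). v \<in> V - \<tau> \<and> w \<in> V - \<tau> \<and> w < v}"
    have finL: "finite ?L" "finite ?G"
      using assms(1) by (auto intro: finite_subset[of _ "V \<times> V"])
    have "koszul_bd V X (koszul_bd V X c) \<tau> = (\<Sum>v\<in>V - \<tau>. \<Sum>w\<in>V - insert v \<tau>. t (v, w))"
      by (simp add: koszul_bd_def additive.sum[OF X] additive.sum[OF additive_sgn_ins]
            additive_comp_sgn_ins[OF X] t_def)
    also have "\<dots> = sum t (SIGMA v:V - \<tau>. V - insert v \<tau>)"
      using assms(1) by (subst sum.Sigma) auto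
    also have "(SIGMA v:V - \<tau>. V - insert v \<tau>) = ?L \<union> ?G" by auto
    also have "sum t (?L \<union> ?G) = sum t ?L + sum t ?G"
      using finL by (intro sum.union_disjoint) auto
    also have "sum t ?G = (\<Sum>(v, w)\<in>?L. t (w, v))"
      by (rule sum.reindex_bij_witness[of _ prod.swap prod.swap]) auto
    also have "\<dots> = (\<Sum>x\<in>?L. - t x)"
    proof (rule sum.cong[OF refl])
      fix x assume "x \<in> ?L"
      then obtain v w where "x = (v, w)" "v \<notin> \<tau>" "w \<notin> \<tau>" "v \<noteq> w" by auto
      then show "(case x of (v, w) \<Rightarrow> t (w, v)) = - t x"
        using fin by (simp add: t_def XX[of w v] insert_commute[of w v] sgn_ins_swap(1)[of \<tau> w v])
    qed
    finally show ?thesis by (simp add: sum_negf)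
  qed
qed

section \<open>Chains with values in graded modules\<close>

lemma graded_piecesD:
  assumes "graded_pieces V X M"
  shows "0 \<in> M d" "a \<in> M d \<Longrightarrow> b \<in> M d \<Longrightarrow> a - b \<in> M d" "a \<in> M d \<Longrightarrow> - a \<in> M d"
    "a \<in> M d \<Longrightarrow> b \<in> M d \<Longrightarrow> a + b \<in> M d" "v \<in> V \<Longrightarrow> a \<in> M d \<Longrightarrow> X v a \<in> M (d + 1)"
    "a \<in> M d \<Longrightarrow> sgn_ins w \<tau> a \<in> M d"
    "(\<And>i. i \<in> I \<Longrightarrow> f i \<in> M d) \<Longrightarrow> sum f I \<in> M d"
proof -
  show 0: "0 \<in> M d" and D: "a \<in> M d \<Longrightarrow> b \<in> M d \<Longrightarrow> a - b \<in> M d" for a b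
    using assms unfolding graded_pieces_def by blast+
  show N: "a \<in> M d \<Longrightarrow> - a \<in> M d" for a using D[of 0 a] 0 by simp
  show A: "a \<in> M d \<Longrightarrow> b \<in> M d \<Longrightarrow> a + b \<in> M d" for a b using D[of a "- b"] N by simp
  show "v \<in> V \<Longrightarrow> a \<in> M d \<Longrightarrow> X v a \<in> M (d + 1)"
    using assms unfolding graded_pieces_def by blast
  show "a \<in> M d \<Longrightarrow> sgn_ins w \<tau> a \<in> M d" using N by (simp add: sgn_ins_def)
  show "(\<And>i. i \<in> I \<Longrightarrow> f i \<in> M d) \<Longrightarrow> sum f I \<in> M d"
    by (induction I rule: infinite_finite_induct) (auto intro: 0 A)
qed

lemma koszul_bd_in_chains:
  assumes "finite V" "commuting_actions X" "graded_pieces V X M" "c \<in> koszul_chains V (Suc p) (M d)"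
  shows "koszul_bd V X c \<in> koszul_chains V p (M (d + 1))"
proof -
  have X: "additive (X v)" for v using assms by (simp add: commuting_actions_def)
  have "koszul_bd V X c \<tau> \<in> M (d + 1)" for \<tau>
    unfolding koszul_bd_def using assms(4)
    by (intro graded_piecesD[OF assms(3)]) (auto simp: koszul_chains_def)
  moreover have "\<tau> \<subseteq> V \<and> card \<tau> = p" if nz: "koszul_bd V X c \<tau> \<noteq> 0" for \<tau>
  proof -
    obtain v where "v \<in> V - \<tau>" "sgn_ins v \<tau> (X v (c (insert v \<tau>))) \<noteq> 0"
      using nz unfolding koszul_bd_def by (rule sum.not_neutral_contains_not_neutral)
    then have "v \<in> V - \<tau>" "c (insert v \<tau>) \<noteq> 0"
      using additive.zero[OF X] by auto
    then have *: "insert v \<tau> \<subseteq> V" "card (insert v \<tau>) = Suc p" "v \<notin> \<tau>"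
      using assms(4) by (auto simp: koszul_chains_def)
    then have "finite \<tau>" using assms(1) finite_subset[of \<tau> V] by simp
    with * show ?thesis by simp
  qed
  ultimately show ?thesis by (simp add: koszul_chains_def)
qed

lemma koszul_bd_0_chain:
  assumes V: "finite V" and X: "commuting_actions X" and c: "c \<in> koszul_chains V 0 M"
  shows "koszul_bd V X c = 0"
proof
  fix \<tau>
  have "c (insert v \<tau>) = 0" for v
  proof (rule ccontr)
    assume "c (insert v \<tau>) \<noteq> 0"
    then have "insert v \<tau> \<subseteq> V" "card (insert v \<tau>) = 0" using c by (auto simp: koszul_chains_def)
    then show False using V finite_subset[of "insert v \<tau>" V] by simp
  qed
  moreover have "X v 0 = 0" for v using X by (simp add: commuting_actions_def additive.zero)
  ultimately show "koszul_bd V X c \<tau> = 0 \<tau>" by (simp add: koszul_bd_def)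
qed

lemma koszul_exactE:
  assumes "koszul_exact V X M p d" "c \<in> koszul_chains V p (M d)" "koszul_bd V X c = 0"
  obtains b where "b \<in> koszul_chains V (Suc p) (M (d - 1))" "koszul_bd V X b = c"
  using assms unfolding koszul_exact_def by meson

lemma koszul_chains_diff:
  assumes "graded_pieces V X M" "b \<in> koszul_chains V p (M d)" "c \<in> koszul_chains V p (M d)"
  shows "b - c \<in> koszul_chains V p (M d)"
  using assms(2,3) graded_piecesD(2)[OF assms(1)] unfolding koszul_chains_def
  by simp (metis diff_self)

text \<open>Zero is lifted to zero, so that the lift keeps the support condition of a chain.\<close>

lemma koszul_chains_lift:
  assumes "N = \<phi> ` M" "0 \<in> M" "\<phi> 0 = 0" "c \<in> koszul_chains V p N"
  obtains b where "b \<in> koszul_chains V p M" "(\<lambda>\<sigma>. \<phi> (b \<sigma>)) = c"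
proof -
  have "\<exists>a\<in>M. \<phi> a = c \<sigma> \<and> (c \<sigma> = 0 \<longrightarrow> a = 0)" for \<sigma>
  proof (cases "c \<sigma> = 0")
    case False
    have "c \<sigma> \<in> \<phi> ` M" using assms(1,4) by (simp add: koszul_chains_def)
    with False show ?thesis by auto
  qed (use assms(2,3) in auto)
  then obtain b where "\<And>\<sigma>. b \<sigma> \<in> M \<and> \<phi> (b \<sigma>) = c \<sigma> \<and> (c \<sigma> = 0 \<longrightarrow> b \<sigma> = 0)" by metis
  then have "b \<in> koszul_chains V p M" "(\<lambda>\<sigma>. \<phi> (b \<sigma>)) = c"
    using assms(4) unfolding koszul_chains_def by auto
  then show thesis by (rule that)
qed

text \<open>The connecting isomorphism of the long exact Koszul homology sequence of
  \<open>0 \<rightarrow> Z \<rightarrow> M \<rightarrow> N \<rightarrow> 0\<close>, as far as vanishing is concerned.\<close>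

lemma koszul_exact_kernel:
  fixes X :: "'v::linorder \<Rightarrow> 'a::ab_group_add \<Rightarrow> 'a" and Y :: "'v \<Rightarrow> 'b::ab_group_add \<Rightarrow> 'b"
  assumes V: "finite V" and X: "commuting_actions X" and Y: "commuting_actions Y"
    and \<phi>: "additive \<phi>" "\<And>v a. \<phi> (X v a) = Y v (\<phi> a)"
    and M: "graded_pieces V X M" and N: "\<And>d. N d = \<phi> ` M d"
    and Z: "\<And>d. Z d = {a \<in> M d. \<phi> a = 0}"
    and acyclic: "\<And>c p d. c \<in> koszul_chains V p (M d) \<Longrightarrow> koszul_bd V X c = 0 \<Longrightarrow>
       (p = 0 \<Longrightarrow> c {} \<in> Z d) \<Longrightarrow> \<exists>b \<in> koszul_chains V (Suc p) (M (d - 1)). koszul_bd V X b = c"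
  shows "koszul_exact V Y N (Suc p) d \<longleftrightarrow> koszul_exact V X Z p (d + 1)"
proof
  have \<phi>0: "\<phi> 0 = 0" using \<phi>(1) by (rule additive.zero)
  have M0: "0 \<in> M d" for d by (rule graded_piecesD(1)[OF M])
  note comp = koszul_bd_comp[where X = X and Y = Y and \<phi> = \<phi>, OF \<phi>]
  have push: "(\<lambda>\<sigma>. \<phi> (c \<sigma>)) \<in> koszul_chains V q (N e)" if "c \<in> koszul_chains V q (M e)" for c q e
    using that \<phi>0 by (force simp: koszul_chains_def N)
  have ZM: "c \<in> koszul_chains V q (M e)" "(\<lambda>\<sigma>. \<phi> (c \<sigma>)) = 0" if "c \<in> koszul_chains V q (Z e)" for c q e
    using that by (auto simp: koszul_chains_def Z)
  have MZ: "c \<in> koszul_chains V q (Z e)" if "c \<in> koszul_chains V q (M e)" "(\<lambda>\<sigma>. \<phi> (c \<sigma>)) = 0" for c q e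
    using that fun_cong[OF that(2)] by (auto simp: koszul_chains_def Z)
  {
    assume L: "koszul_exact V Y N (Suc p) d"
    show "koszul_exact V X Z p (d + 1)"
      unfolding koszul_exact_def
    proof (intro ballI impI)
      fix c assume c: "c \<in> koszul_chains V p (Z (d + 1))" and c0: "koszul_bd V X c = 0"
      \<comment> \<open>In homological degree 0 the complex of \<open>M\<close> is not acyclic.
        There \<open>acyclic\<close> only bounds chains with value in the kernel; for a minimal
        cover this is available because the kernel has no constant terms.\<close>
      have "c {} \<in> Z (d + 1)" using c by (auto simp: koszul_chains_def)
      then have "\<exists>b\<in>koszul_chains V (Suc p) (M (d + 1 - 1)). koszul_bd V X b = c"
        by (intro acyclic[OF ZM(1)[OF c] c0])
      then obtain b where b: "b \<in> koszul_chains V (Suc p) (M d)" "koszul_bd V X b = c"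
        by auto
      have b0: "koszul_bd V Y (\<lambda>\<sigma>. \<phi> (b \<sigma>)) = 0"
        by (simp only: comp b(2) ZM(2)[OF c])
      \<comment> \<open>The bounding chain \<open>b\<close> may leave \<open>Z\<close>, but its
        image in \<open>N\<close> is a cycle. Subtracting the boundary of a lift of \<open>e\<close>
        moves \<open>b\<close> into \<open>Z\<close> without changing its own boundary.\<close>
      obtain e where
        e: "e \<in> koszul_chains V (Suc (Suc p)) (N (d - 1))" "koszul_bd V Y e = (\<lambda>\<sigma>. \<phi> (b \<sigma>))"
        by (rule koszul_exactE[OF L push[OF b(1)] b0])
      obtain e' where e': "e' \<in> koszul_chains V (Suc (Suc p)) (M (d - 1))" "(\<lambda>\<sigma>. \<phi> (e' \<sigma>)) = e"
        using koszul_chains_lift[OF N M0 \<phi>0 e(1)] by blast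
      have de': "koszul_bd V X e' \<in> koszul_chains V (Suc p) (M d)"
        using koszul_bd_in_chains[OF V X M e'(1)] by simp
      have "b - koszul_bd V X e' \<in> koszul_chains V (Suc p) (M d)"
        by (rule koszul_chains_diff[OF M b(1) de'])
      moreover have "(\<lambda>\<sigma>. \<phi> ((b - koszul_bd V X e') \<sigma>)) = 0"
      proof -
        have "(\<lambda>\<sigma>. \<phi> (koszul_bd V X e' \<sigma>)) = (\<lambda>\<sigma>. \<phi> (b \<sigma>))"
          using e(2) e'(2) comp[of V e'] by simp
        then show ?thesis by (auto simp: additive.diff[OF \<phi>(1)] fun_eq_iff)
      qed
      ultimately have "b - koszul_bd V X e' \<in> koszul_chains V (Suc p) (Z (d + 1 - 1))"
        using MZ by simp
      moreover have "koszul_bd V X (b - koszul_bd V X e') = c"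
        by (simp add: additive_koszul_bd(2)[OF X] koszul_bd_koszul_bd[OF V X e'(1)] b(2))
      ultimately show "\<exists>b\<in>koszul_chains V (Suc p) (Z (d + 1 - 1)). koszul_bd V X b = c" by blast
    qed
  }
  {
    assume R: "koszul_exact V X Z p (d + 1)"
    show "koszul_exact V Y N (Suc p) d"
      unfolding koszul_exact_def
    proof (intro ballI impI)
      fix c assume c: "c \<in> koszul_chains V (Suc p) (N d)" and c0: "koszul_bd V Y c = 0"
      obtain b where b: "b \<in> koszul_chains V (Suc p) (M d)" "(\<lambda>\<sigma>. \<phi> (b \<sigma>)) = c"
        using koszul_chains_lift[OF N M0 \<phi>0 c] by blast
      have "koszul_bd V X b \<in> koszul_chains V p (Z (d + 1))"
        by (rule MZ[OF koszul_bd_in_chains[OF V X M b(1)]])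
          (simp only: comp[symmetric] b(2) c0)
      \<comment> \<open>The lift \<open>b\<close> of the cycle \<open>c\<close> need not be a cycle,
        but its boundary lies in \<open>Z\<close>. Bounding that inside \<open>Z\<close> makes
        \<open>b - z\<close> a cycle of \<open>M\<close> with the same image as
        \<open>b\<close>.\<close>
      then obtain z where z: "z \<in> koszul_chains V (Suc p) (Z d)" "koszul_bd V X z = koszul_bd V X b"
        by (rule koszul_exactE[OF R _ koszul_bd_koszul_bd[OF V X b(1)]]) simp
      have "b - z \<in> koszul_chains V (Suc p) (M d)"
        using koszul_chains_diff[OF M b(1) ZM(1)[OF z(1)]] .
      moreover have "koszul_bd V X (b - z) = 0"
        by (simp add: additive_koszul_bd(2)[OF X] z(2))
      ultimately obtain e where
        e: "e \<in> koszul_chains V (Suc (Suc p)) (M (d - 1))" "koszul_bd V X e = b - z"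
        using acyclic by blast
      have "koszul_bd V Y (\<lambda>\<sigma>. \<phi> (e \<sigma>)) = (\<lambda>\<sigma>. \<phi> ((b - z) \<sigma>))"
        by (simp only: comp e(2))
      also have "\<dots> = c"
        using b(2) fun_cong[OF ZM(2)[OF z(1)]] by (auto simp: additive.diff[OF \<phi>(1)])
      finally show "\<exists>b\<in>koszul_chains V (Suc (Suc p)) (N (d - 1)). koszul_bd V Y b = c"
        using push[OF e(1)] by blast
    qed
  }
qed

section \<open>Multidegree strands of monomial ideals\<close>

lemma poly_mapping_sum_single:
  fixes p :: "'a \<Rightarrow>\<^sub>0 'b::comm_monoid_add"
  shows "p = (\<Sum>m\<in>keys p. single m (lookup p m))"
proof (rule poly_mapping_eqI)
  fix k
  show "lookup p k =
      lookup (\<Sum>m\<in>keys p. single m (lookup p m)) k"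
    by (simp add: lookup_sum lookup_single when_def in_keys_iff)
qed

lemma lookup_indet_mult:
  fixes p :: "('v, 'k::field) mpoly"
  shows "lookup (indet v * p) m =
    (if v \<in> keys m then lookup p (m - single v 1) else 0)"
proof -
  have eq: "single v 1 + k = m \<longleftrightarrow> v \<in> keys m \<and> k = m - single v 1"
    for k :: "'v \<Rightarrow>\<^sub>0 nat"
  proof
    assume "single v 1 + k = m"
    then show "v \<in> keys m \<and> k = m - single v 1"
      by (auto simp: in_keys_iff lookup_add)
  next
    assume "v \<in> keys m \<and> k = m - single v 1"
    then show "single v 1 + k = m"
      by (intro poly_mapping_eqI)
        (auto simp: in_keys_iff lookup_add lookup_minus lookup_single when_def)
  qed
  have "indet v * p = (\<Sum>k\<in>keys p. indet v * single k (lookup p k))"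
    by (subst poly_mapping_sum_single[of p]) (rule sum_distrib_left)
  then have "lookup (indet v * p) m =
      (\<Sum>k\<in>keys p. lookup p k when single v 1 + k = m)"
    by (simp add: lookup_sum indet_def monom_of_def mult_single lookup_single)
  also have "\<dots> = (\<Sum>k\<in>keys p.
      if k = m - single v 1 then (if v \<in> keys m then lookup p k else 0) else 0)"
    by (intro sum.cong refl) (auto simp: when_def eq simp del: One_nat_def)
  finally show ?thesis by (simp add: in_keys_iff)
qed

abbreviation mul_indet :: "'v \<Rightarrow> ('v, 'k::field) mpoly \<Rightarrow> ('v, 'k) mpoly" where
  "mul_indet v p \<equiv> indet v * p"

lemma commuting_actions_mul_indet: "commuting_actions mul_indet"
  by (simp add: commuting_actions_def additive_def distrib_left mult.left_commute)

lemma mdeg_superset: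
  assumes "finite S" "keys m \<subseteq> S"
  shows "mdeg m = (\<Sum>x\<in>S. lookup m x)"
  unfolding mdeg_def using assms
  by (intro sum.mono_neutral_left) (auto simp: in_keys_iff)

lemma mdeg_add: "mdeg (a + b) = mdeg a + mdeg b"
proof -
  let ?S = "keys a \<union> keys b"
  have "mdeg (a + b) = (\<Sum>x\<in>?S. lookup (a + b) x)"
    using Poly_Mapping.keys_add[of a b] by (intro mdeg_superset) auto
  also have "\<dots> = mdeg a + mdeg b"
    by (simp add: lookup_add sum.distrib mdeg_superset[of ?S])
  finally show ?thesis .
qed

lemma mdeg_single [simp]: "mdeg (single v n) = n"
  by (simp add: mdeg_def)

lemma mdeg_zero [simp]: "mdeg 0 = 0"
  by (simp add: mdeg_def)

lemma mdeg_eq_0_iff: "mdeg m = 0 \<longleftrightarrow> m = 0"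
  by (auto simp: mdeg_def in_keys_iff intro: poly_mapping_eqI)

definition ind :: "'v set \<Rightarrow> 'v \<Rightarrow>\<^sub>0 nat" where
  "ind \<sigma> = (\<Sum>v\<in>\<sigma>. single v 1)"

lemma lookup_ind: "finite \<sigma> \<Longrightarrow> lookup (ind \<sigma>) x = (if x \<in> \<sigma> then 1 else 0)"
  by (simp add: ind_def lookup_sum lookup_single when_def)

lemma keys_ind [simp]: "finite \<sigma> \<Longrightarrow> keys (ind \<sigma>) = \<sigma>"
  by (auto simp: in_keys_iff lookup_ind split: if_splits)

lemma mdeg_ind [simp]: "finite \<sigma> \<Longrightarrow> mdeg (ind \<sigma>) = card \<sigma>"
  by (simp add: mdeg_def lookup_ind)

lemma ind_insert: "finite \<sigma> \<Longrightarrow> v \<notin> \<sigma> \<Longrightarrow> ind (insert v \<sigma>) = ind \<sigma> + single v 1"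
  by (simp add: ind_def add.commute)

text \<open>Subtraction of exponent vectors truncates at 0; the containment in the support makes it
  reversible.\<close>

lemma minus_ind_add_ind:
  assumes "\<sigma> \<subseteq> keys b"
  shows "b - ind \<sigma> + ind \<sigma> = b"
proof (rule poly_mapping_eqI)
  fix x
  have "finite \<sigma>" using assms by (rule finite_subset) simp
  then show "lookup (b - ind \<sigma> + ind \<sigma>) x = lookup b x"
    using assms by (auto simp: lookup_add lookup_minus lookup_ind in_keys_iff Suc_leI)
qed

lemma mdeg_minus_ind:
  assumes "\<sigma> \<subseteq> keys b"
  shows "mdeg (b - ind \<sigma>) + card \<sigma> = mdeg b"
proof -
  have "finite \<sigma>" using assms by (rule finite_subset) simp
  then show ?thesis using mdeg_add[of "b - ind \<sigma>" "ind \<sigma>"] minus_ind_add_ind[OF assms] by simp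
qed

lemma finite_monomials:
  assumes "finite V"
  shows "finite {m. keys m \<subseteq> V \<and> mdeg m = n}"
proof -
  let ?F = "{f. \<forall>x. (x \<in> V \<longrightarrow> f x \<in> {0..n}) \<and> (x \<notin> V \<longrightarrow> f x = 0)}"
  have "lookup ` {m. keys m \<subseteq> V \<and> mdeg m = n} \<subseteq> ?F"
  proof (clarify, intro conjI impI)
    fix m :: "'a \<Rightarrow>\<^sub>0 nat" and x
    assume m: "keys m \<subseteq> V"
    show "lookup m x \<in> {0..mdeg m}"
      using mdeg_superset[of "insert x V" m] member_le_sum[of x "insert x V" "lookup m"] assms m
      by (simp add: subset_insertI2)
    show "x \<notin> V \<Longrightarrow> lookup m x = 0"
      using m by (auto simp: in_keys_iff)
  qed
  then have "finite (lookup ` {m. keys m \<subseteq> V \<and> mdeg m = n})"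
    by (rule finite_subset) (intro finite_set_of_finite_funs assms finite_atLeastAtMost)
  then show ?thesis
    by (rule finite_imageD) (auto simp: inj_on_def poly_mapping.lookup_inject)
qed

section \<open>Splitting of the Koszul complex by multidegree\<close>

definition mono_piece :: "('v \<Rightarrow>\<^sub>0 nat) set \<Rightarrow> int \<Rightarrow> ('v, 'k::field) mpoly set" where
  "mono_piece A d = {p. \<forall>m \<in> keys p. m \<in> A \<and> int (mdeg m) = d}"

lemma graded_pieces_mono_piece:
  assumes "\<And>m v. m \<in> A \<Longrightarrow> v \<in> V \<Longrightarrow> m + single v 1 \<in> A"
  shows "graded_pieces V mul_indet (mono_piece A :: int \<Rightarrow> ('v, 'k::field) mpoly set)"
  unfolding graded_pieces_def
proof (intro conjI allI ballI)
  fix d and a b :: "('v, 'k) mpoly"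
  assume a: "a \<in> mono_piece A d"
  { assume "b \<in> mono_piece A d"
    then show "a - b \<in> mono_piece A d"
      using a Poly_Mapping.keys_diff[of a b] by (auto simp: mono_piece_def) }
  { fix v assume v: "v \<in> V"
    show "mul_indet v a \<in> mono_piece A (d + 1)"
      unfolding mono_piece_def
    proof (intro CollectI ballI)
      fix m assume "m \<in> keys (mul_indet v a)"
      then obtain k where k: "k \<in> keys a" "m = k + single v 1"
        using Poly_Mapping.keys_mult[of "indet v" a]
        by (auto simp: indet_def monom_of_def add.commute split: if_splits)
      then show "m \<in> A \<and> int (mdeg m) = d + 1"
        using assms v a by (auto simp: mono_piece_def mdeg_add)
    qed }
qed (simp add: mono_piece_def)

text \<open>The Koszul complex of a monomial ideal splits according to multidegree.  Its strand in
  multidegree \<open>b\<close> is the augmented chain complex of the simplicial complex \<open>faces A b\<close>.\<close>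

definition faces :: "('v \<Rightarrow>\<^sub>0 nat) set \<Rightarrow> ('v \<Rightarrow>\<^sub>0 nat) \<Rightarrow> 'v set set" where
  "faces A b = {\<sigma>. \<sigma> \<subseteq> keys b \<and> b - ind \<sigma> \<in> A}"

definition face_chains :: "'v set \<Rightarrow> 'v set set \<Rightarrow> nat \<Rightarrow> ('v set \<Rightarrow> 'a::zero) set" where
  "face_chains V \<Delta> p = {c. \<forall>\<sigma>. c \<sigma> \<noteq> 0 \<longrightarrow> \<sigma> \<subseteq> V \<and> card \<sigma> = p \<and> \<sigma> \<in> \<Delta>}"

abbreviation simp_bd :: "'v::linorder set \<Rightarrow> ('v set \<Rightarrow> 'a) \<Rightarrow> 'v set \<Rightarrow> 'a::ab_group_add" where
  "simp_bd V \<equiv> koszul_bd V (\<lambda>_ x. x)"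

text \<open>The part of multidegree \<open>b\<close>: at \<open>\<sigma>\<close> only the monomial
  \<open>b - ind \<sigma>\<close> counts. The guard rules out those \<open>\<sigma>\<close> for
  which the truncated difference would have the wrong multidegree.\<close>

definition strand :: "('v \<Rightarrow>\<^sub>0 nat) \<Rightarrow> ('v set \<Rightarrow> ('v, 'k::field) mpoly) \<Rightarrow> 'v set \<Rightarrow> 'k" where
  "strand b c \<sigma> = (if \<sigma> \<subseteq> keys b then lookup (c \<sigma>) (b - ind \<sigma>) else 0)"

text \<open>Dropping \<open>v\<close> from the face and multiplying by the variable \<open>v\<close>
  compensate each other in the multidegree, so every strand is a complex of its own.\<close>

lemma strand_koszul_bd:
  "strand b (koszul_bd V mul_indet c) = simp_bd V (strand b c)"
proof
  fix \<tau>
  show "strand b (koszul_bd V mul_indet c) \<tau> = simp_bd V (strand b c) \<tau>"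
  proof (cases "\<tau> \<subseteq> keys b")
    case False
    then show ?thesis by (simp add: strand_def koszul_bd_def)
  next
    case True
    then have fin: "finite \<tau>" by (rule finite_subset) simp
    have lk: "additive (\<lambda>p :: ('a, 'b) mpoly. lookup p m)" for m
      by (simp add: additive_def lookup_add)
    have "lookup (sgn_ins v \<tau> (mul_indet v (c (insert v \<tau>)))) (b - ind \<tau>) =
        sgn_ins v \<tau> (strand b c (insert v \<tau>))" if "v \<in> V - \<tau>" for v
    proof -
      have "v \<in> keys (b - ind \<tau>) \<longleftrightarrow> v \<in> keys b"
        using that fin by (simp add: in_keys_iff lookup_minus lookup_ind)
      moreover have "b - ind \<tau> - single v 1 = b - ind (insert v \<tau>)"
        using that fin by (simp add: ind_insert diff_diff_eq)
      ultimately show ?thesis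
        using True by (simp add: additive_comp_sgn_ins[OF lk] lookup_indet_mult strand_def)
    qed
    then show ?thesis using True
      by (simp add: strand_def[of b "koszul_bd V mul_indet c"] koszul_bd_def lookup_sum)
  qed
qed

lemma lookup_eq_strand:
  "finite \<sigma> \<Longrightarrow> lookup (c \<sigma>) m = strand (m + ind \<sigma>) c \<sigma>"
  by (auto simp: strand_def in_keys_iff lookup_add lookup_ind)

lemma strand_eqI:
  assumes "finite V" "b \<in> koszul_chains V p M" "c \<in> koszul_chains V q N"
    and "\<And>x. strand x b = strand x c"
  shows "b = c"
proof
  fix \<sigma>
  show "b \<sigma> = c \<sigma>"
  proof (cases "finite \<sigma>")
    case True
    then show ?thesis by (intro poly_mapping_eqI) (simp add: lookup_eq_strand assms(4))
  next
    case False
    then have "\<not> \<sigma> \<subseteq> V" using finite_subset[OF _ assms(1)] by blast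
    then have "b \<sigma> = 0" "c \<sigma> = 0" using assms(2,3) by (auto simp: koszul_chains_def)
    then show ?thesis by simp
  qed
qed

lemma strand_in_face_chains:
  assumes "c \<in> koszul_chains V p (mono_piece A d)"
  shows "strand b c \<in> face_chains V (faces A b) p"
    and "int (mdeg b) \<noteq> int p + d \<Longrightarrow> strand b c = 0"
proof -
  have *: "\<sigma> \<subseteq> V \<and> card \<sigma> = p \<and> \<sigma> \<in> faces A b \<and> int (mdeg b) = int p + d"
    if "strand b c \<sigma> \<noteq> 0" for \<sigma>
  proof -
    from that have \<sigma>: "\<sigma> \<subseteq> keys b" and k: "b - ind \<sigma> \<in> keys (c \<sigma>)"
      by (auto simp: strand_def in_keys_iff split: if_splits)
    then have "c \<sigma> \<noteq> 0" by auto
    then have "\<sigma> \<subseteq> V" "card \<sigma> = p" "c \<sigma> \<in> mono_piece A d"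
      using assms by (auto simp: koszul_chains_def)
    then show ?thesis
      using \<sigma> k mdeg_minus_ind[OF \<sigma>] by (auto simp: mono_piece_def faces_def)
  qed
  then show "strand b c \<in> face_chains V (faces A b) p" by (simp add: face_chains_def)
  show "int (mdeg b) \<noteq> int p + d \<Longrightarrow> strand b c = 0" using * by (metis ext zero_fun_apply)
qed

text \<open>Boundaries found separately in each multidegree are glued into one polynomial chain.
  Strands of total degree other than \<open>p + d\<close> are set to 0, which leaves a sum over
  finitely many monomials.\<close>

lemma koszul_boundary_if_strands:
  fixes c :: "'v::linorder set \<Rightarrow> ('v, 'k::field) mpoly"
  assumes V: "finite V" and A: "\<And>m. m \<in> A \<Longrightarrow> keys m \<subseteq> V"
    and up: "\<And>m v. m \<in> A \<Longrightarrow> v \<in> V \<Longrightarrow> m + single v 1 \<in> A"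
    and c: "c \<in> koszul_chains V p (mono_piece A d)"
    and ex: "\<And>b. int (mdeg b) = int p + d \<Longrightarrow>
       \<exists>e \<in> face_chains V (faces A b) (Suc p). simp_bd V e = strand b c"
  shows "\<exists>b \<in> koszul_chains V (Suc p) (mono_piece A (d - 1)). koszul_bd V mul_indet b = c"
proof -
  have "\<exists>e. (int (mdeg b) = int p + d \<longrightarrow> e \<in> face_chains V (faces A b) (Suc p) \<and> simp_bd V e = strand b c)
      \<and> (int (mdeg b) \<noteq> int p + d \<longrightarrow> e = 0)" for b
    using ex[of b] by (cases "int (mdeg b) = int p + d") auto
  then obtain e where e: "\<And>b. int (mdeg b) = int p + d \<Longrightarrow> e b \<in> face_chains V (faces A b) (Suc p)"
      "\<And>b. int (mdeg b) = int p + d \<Longrightarrow> simp_bd V (e b) = strand b c"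
      "\<And>b. int (mdeg b) \<noteq> int p + d \<Longrightarrow> e b = 0"
    by metis
  \<comment> \<open>For \<open>d \<le> 0\<close> the truncation by \<open>nat\<close> is harmless:
    by the degree identity in \<open>enz\<close> below, every \<open>e b\<close> is then 0.\<close>
  define B where "B = {m. keys m \<subseteq> V \<and> mdeg m = nat (d - 1)}"
  have "finite B" unfolding B_def by (rule finite_monomials[OF V])
  define f where "f = (\<lambda>\<sigma>. if \<sigma> \<subseteq> V then \<Sum>m\<in>B. single m (e (m + ind \<sigma>) \<sigma>) else 0)"
  have lf: "lookup (f \<sigma>) m = (if m \<in> B then e (m + ind \<sigma>) \<sigma> else 0)" if "\<sigma> \<subseteq> V" for m \<sigma>
    using that \<open>finite B\<close> by (simp add: f_def lookup_sum lookup_single when_def)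
  have enz: "\<sigma> \<subseteq> V" "card \<sigma> = Suc p" "\<sigma> \<subseteq> keys b" "b - ind \<sigma> \<in> A" "b - ind \<sigma> \<in> B"
      "int (mdeg (b - ind \<sigma>)) = d - 1"
    if "e b \<sigma> \<noteq> 0" for b \<sigma>
  proof -
    have b: "int (mdeg b) = int p + d" using that e(3) by force
    with that e(1) show 1: "\<sigma> \<subseteq> V" "card \<sigma> = Suc p" "\<sigma> \<subseteq> keys b" "b - ind \<sigma> \<in> A"
      by (auto simp: face_chains_def faces_def)
    show "int (mdeg (b - ind \<sigma>)) = d - 1" using mdeg_minus_ind[OF 1(3)] b 1(2) by linarith
    with A[OF 1(4)] show "b - ind \<sigma> \<in> B" by (simp add: B_def)
  qed
  have fch: "f \<in> koszul_chains V (Suc p) (mono_piece A (d - 1))"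
    unfolding koszul_chains_def
  proof (intro CollectI allI conjI impI)
    fix \<sigma>
    have *: "\<sigma> \<subseteq> V \<and> card \<sigma> = Suc p \<and> m \<in> A \<and> int (mdeg m) = d - 1"
      if "m \<in> keys (f \<sigma>)" for m
    proof -
      from that have \<sigma>: "\<sigma> \<subseteq> V" by (auto simp: f_def split: if_splits)
      with that have "e (m + ind \<sigma>) \<sigma> \<noteq> 0" by (auto simp: in_keys_iff lf split: if_splits)
      from enz[OF this] show ?thesis by simp
    qed
    then show "f \<sigma> \<in> mono_piece A (d - 1)" by (simp add: mono_piece_def)
    assume "f \<sigma> \<noteq> 0"
    then obtain m where "m \<in> keys (f \<sigma>)" by (metis all_not_in_conv keys_eq_empty)
    with * show "\<sigma> \<subseteq> V" "card \<sigma> = Suc p" by blast+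
  qed
  have sf: "strand b f = e b" for b
  proof
    fix \<sigma>
    show "strand b f \<sigma> = e b \<sigma>"
    proof (cases "e b \<sigma> = 0")
      case True
      then show ?thesis
        by (cases "\<sigma> \<subseteq> V") (simp_all add: strand_def lf minus_ind_add_ind, simp add: f_def)
    next
      case False
      then show ?thesis using enz[OF False] by (simp add: strand_def lf minus_ind_add_ind)
    qed
  qed
  have "koszul_bd V mul_indet f \<in> koszul_chains V p (mono_piece A (d - 1 + 1))"
    by (rule koszul_bd_in_chains[OF V commuting_actions_mul_indet graded_pieces_mono_piece[OF up] fch])
  then have "koszul_bd V mul_indet f = c"
  proof (rule strand_eqI[OF V _ c])
    fix b
    show "strand b (koszul_bd V mul_indet f) = strand b c"
    proof (cases "int (mdeg b) = int p + d")
      case True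
      then show ?thesis by (simp add: strand_koszul_bd sf e(2))
    next
      case False
      then have "strand b c = 0" by (rule strand_in_face_chains(2)[OF c])
      moreover have "simp_bd V (0 :: 'v set \<Rightarrow> 'k) = 0" by (rule ext) (simp add: koszul_bd_def)
      ultimately show ?thesis using False by (simp add: strand_koszul_bd sf e(3))
    qed
  qed
  with fch show ?thesis by blast
qed

text \<open>Inserting the apex \<open>v\<close> is a contracting homotopy. Since the empty set
  counts as a face, the case \<open>p = 0\<close> says that the reduced homology in degree -1
  vanishes as well.\<close>

lemma simp_bd_cone:
  fixes c :: "'v::linorder set \<Rightarrow> 'a::ab_group_add"
  assumes V: "finite V" and v: "v \<in> V" and cone: "\<And>\<sigma>. \<sigma> \<in> \<Delta> \<Longrightarrow> \<sigma> \<subseteq> V \<Longrightarrow> v \<notin> \<sigma> \<Longrightarrow> insert v \<sigma> \<in> \<Delta>"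
    and c: "c \<in> face_chains V \<Delta> p" and c0: "simp_bd V c = 0"
  shows "\<exists>e \<in> face_chains V \<Delta> (Suc p). simp_bd V e = c"
proof -
  define e where "e = (\<lambda>\<sigma>. if v \<in> \<sigma> then sgn_ins v (\<sigma> - {v}) (c (\<sigma> - {v})) else 0)"
  have "e \<in> face_chains V \<Delta> (Suc p)"
    unfolding face_chains_def
  proof (intro CollectI allI impI)
    fix \<sigma> assume "e \<sigma> \<noteq> 0"
    then have 1: "v \<in> \<sigma>" "c (\<sigma> - {v}) \<noteq> 0" by (auto simp: e_def split: if_splits)
    then have 2: "\<sigma> - {v} \<subseteq> V" "card (\<sigma> - {v}) = p" "\<sigma> - {v} \<in> \<Delta>"
      using c by (auto simp: face_chains_def)
    then have "finite \<sigma>" using V finite_subset[of "\<sigma> - {v}" V] by simp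
    then have "card \<sigma> = Suc p" using card.remove[of \<sigma> v] 1(1) 2(2) by simp
    with 1 2 cone[of "\<sigma> - {v}"] v show "\<sigma> \<subseteq> V \<and> card \<sigma> = Suc p \<and> \<sigma> \<in> \<Delta>"
      by (auto simp: insert_absorb)
  qed
  moreover have "simp_bd V e \<tau> = c \<tau>" for \<tau>
  proof (cases "v \<in> \<tau>")
    case False
    have "simp_bd V e \<tau> = (\<Sum>w\<in>V - \<tau>. if w = v then c \<tau> else 0)"
      unfolding koszul_bd_def using False by (intro sum.cong refl) (auto simp: e_def insert_Diff_if)
    also have "\<dots> = c \<tau>" using V v False by simp
    finally show ?thesis .
  next
    case True
    define \<rho> where "\<rho> = \<tau> - {v}"
    have \<rho>: "v \<notin> \<rho>" "\<tau> = insert v \<rho>" using True by (auto simp: \<rho>_def)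
    show ?thesis
    proof (cases "\<tau> \<subseteq> V")
      case False
      then have "c \<tau> = 0" using c by (auto simp: face_chains_def)
      moreover have "c (insert w \<tau> - {v}) = 0" if "w \<in> V" for w
        using c False v by (auto simp: face_chains_def)
      ultimately show ?thesis using True by (simp add: koszul_bd_def e_def)
    next
      case \<tau>V: True
      then have fin: "finite \<rho>" using V \<rho>(2) finite_subset[of \<rho> V] by simp
      \<comment> \<open>The cycle condition at \<open>\<tau> - {v}\<close> contains the term of
        \<open>v\<close>, which is \<open>c \<tau>\<close> up to sign; it is solved for that
        term.\<close>
      have "(\<Sum>w\<in>V - \<rho>. sgn_ins w \<rho> (c (insert w \<rho>))) = 0"
        using fun_cong[OF c0, of \<rho>] by (simp add: koszul_bd_def)
      moreover have "V - \<rho> = insert v (V - \<tau>)" using v \<rho> by auto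
      ultimately have 1: "(\<Sum>w\<in>V - \<tau>. sgn_ins w \<rho> (c (insert w \<rho>))) = - sgn_ins v \<rho> (c \<tau>)"
        using V True \<rho>(2)[symmetric] by (simp add: eq_neg_iff_add_eq_0 add.commute)
      have "simp_bd V e \<tau> = (\<Sum>w\<in>V - \<tau>. - sgn_ins v \<rho> (sgn_ins w \<rho> (c (insert w \<rho>))))"
        unfolding koszul_bd_def
      proof (intro sum.cong refl)
        fix w assume "w \<in> V - \<tau>"
        then have w: "w \<noteq> v" "w \<notin> \<rho>" using \<rho> by auto
        then have "insert w \<tau> - {v} = insert w \<rho>" using \<rho> by auto
        then show "sgn_ins w \<tau> (e (insert w \<tau>)) = - sgn_ins v \<rho> (sgn_ins w \<rho> (c (insert w \<rho>)))"
          using True w \<rho> fin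
          by (simp add: e_def sgn_ins_swap(2))
      qed
      also have "\<dots> = - sgn_ins v \<rho> (\<Sum>w\<in>V - \<tau>. sgn_ins w \<rho> (c (insert w \<rho>)))"
        by (simp add: sum_negf additive.sum[OF additive_sgn_ins])
      also have "\<dots> = c \<tau>"
        by (simp only: 1 additive.minus[OF additive_sgn_ins] sgn_ins_sgn_ins minus_minus)
      finally show ?thesis .
    qed
  qed
  ultimately show ?thesis by blast
qed

section \<open>Minimal covers by free modules\<close>

lemma lookup_mult_0:
  fixes a b :: "('v, 'k::field) mpoly"
  shows "lookup (a * b) 0 = lookup a 0 * lookup b 0"
proof -
  have add0: "k + m = 0 \<longleftrightarrow> k = 0 \<and> m = 0" for k m :: "'v \<Rightarrow>\<^sub>0 nat"
    by (metis add_is_0 mdeg_add mdeg_eq_0_iff)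
  have "a * b = (\<Sum>k\<in>keys a. \<Sum>m\<in>keys b.
      single (k + m) (lookup a k * lookup b m))"
    by (subst poly_mapping_sum_single[of a], subst poly_mapping_sum_single[of b])
      (simp add: sum_product mult_single)
  then have "lookup (a * b) 0 = (\<Sum>k\<in>keys a. \<Sum>m\<in>keys b.
      if k = 0 \<and> m = 0 then lookup a k * lookup b m else 0)"
    by (simp add: lookup_sum lookup_single when_def add0)
  also have "\<dots> = (\<Sum>k\<in>keys a. if k = 0 then lookup a k else 0) *
      (\<Sum>m\<in>keys b. if m = 0 then lookup b m else 0)"
    unfolding sum_product by (intro sum.cong refl) auto
  finally show ?thesis by (simp add: in_keys_iff)
qed

lemma carrier_closed:
  assumes "p \<in> carrier (mpoly_ring V)" "q \<in> carrier (mpoly_ring V)"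
  shows "p + q \<in> carrier (mpoly_ring V :: ('v, 'k::field) mpoly ring)"
    and "p * q \<in> carrier (mpoly_ring V :: ('v, 'k::field) mpoly ring)"
proof -
  interpret cring "mpoly_ring V :: ('v, 'k::field) mpoly ring" by (rule cring_mpoly_ring)
  show "p + q \<in> carrier (mpoly_ring V)" "p * q \<in> carrier (mpoly_ring V)"
    using a_closed[OF assms] m_closed[OF assms] by (simp_all only: mpoly_ring_simps(2,4))
qed

lemma carrier_sum:
  "(\<And>i. i \<in> I \<Longrightarrow> f i \<in> carrier (mpoly_ring V)) \<Longrightarrow>
   sum f I \<in> carrier (mpoly_ring V :: ('v, 'k::field) mpoly ring)"
proof (induction I rule: infinite_finite_induct)
  case (insert x F)
  then show ?case
    unfolding sum.insert[OF insert.hyps(1,2)] by (intro carrier_closed(1)) blast+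
qed (simp_all add: mpoly_ring_def)

definition hpart :: "int \<Rightarrow> ('v, 'k::field) mpoly \<Rightarrow> ('v, 'k) mpoly" where
  "hpart d p = (\<Sum>m \<in> {m \<in> keys p. int (mdeg m) = d}. single m (lookup p m))"

lemma lookup_hpart:
  "lookup (hpart d p) m = (if int (mdeg m) = d then lookup p m else 0)"
proof -
  have "lookup (hpart d p) m =
      (\<Sum>k \<in> {k \<in> keys p. int (mdeg k) = d}. if k = m then lookup p m else 0)"
    unfolding hpart_def lookup_sum lookup_single when_def by (rule sum.cong) auto
  then show ?thesis by (simp add: in_keys_iff)
qed

lemma hpart_in_mono_piece: "p \<in> carrier (mpoly_ring V) \<Longrightarrow> hpart d p \<in> mono_piece {m. keys m \<subseteq> V} d"
  by (auto simp: mono_piece_def in_keys_iff lookup_hpart split: if_splits)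

lemma hpart_add: "hpart d (p + q) = hpart d p + hpart d q"
  by (rule poly_mapping_eqI) (simp add: lookup_hpart lookup_add)

lemma hpart_zero [simp]: "hpart d 0 = 0"
  by (rule poly_mapping_eqI) (simp add: lookup_hpart)

lemma hpart_sum: "hpart d (sum f I) = (\<Sum>i\<in>I. hpart d (f i))"
  by (induction I rule: infinite_finite_induct) (simp_all add: hpart_add)

lemma hpart_id: "(\<And>m. m \<in> keys p \<Longrightarrow> int (mdeg m) = d) \<Longrightarrow> hpart d p = p"
  by (rule poly_mapping_eqI) (auto simp: lookup_hpart in_keys_iff)

lemma hpart_mult:
  fixes a p :: "('v, 'k::field) mpoly"
  assumes "\<And>m. m \<in> keys a \<Longrightarrow> int (mdeg m) = e"
  shows "hpart (e + d) (a * p) = a * hpart d p"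
proof (rule poly_mapping_eqI)
  fix m
  define h where "h = hpart d p"
  define r where "r = p - h"
  have deg: "int (mdeg m) = e + i" if "m \<in> keys (a * q)"
    "\<And>m. m \<in> keys q \<Longrightarrow> int (mdeg m) = i" for q m i
    using Poly_Mapping.keys_mult[of a q] that assms by (fastforce simp: mdeg_add)
  have r: "int (mdeg m) \<noteq> d" if "m \<in> keys r" for m
    using that by (auto simp: r_def h_def in_keys_iff lookup_minus lookup_hpart split: if_splits)
  have hd: "int (mdeg m) = d" if "m \<in> keys h" for m
    using that by (auto simp: h_def in_keys_iff lookup_hpart split: if_splits)
  have "int (mdeg m) \<noteq> e + d" if "m \<in> keys (a * r)" for m
    using Poly_Mapping.keys_mult[of a r] that assms r by (fastforce simp: mdeg_add)
  then have 1: "int (mdeg m) = e + d \<Longrightarrow> lookup (a * r) m = 0"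
    by (meson in_keys_iff)
  have 2: "int (mdeg m) \<noteq> e + d \<Longrightarrow> lookup (a * h) m = 0"
    using deg[of m h d] hd by (meson in_keys_iff)
  have "p = h + r" by (simp add: r_def)
  then have "lookup (a * p) m = lookup (a * h) m + lookup (a * r) m"
    by (simp add: distrib_left lookup_add)
  then show "lookup (hpart (e + d) (a * p)) m = lookup (a * hpart d p) m"
    using 1 2 by (simp add: lookup_hpart h_def)
qed

section \<open>Koszul acyclicity of free modules\<close>

abbreviation ring_piece :: "'v set \<Rightarrow> int \<Rightarrow> ('v, 'k::field) mpoly set" where
  "ring_piece V \<equiv> mono_piece {m. keys m \<subseteq> V}"

lemma keys_add_single_subset:
  "keys m \<subseteq> V \<Longrightarrow> v \<in> V \<Longrightarrow> keys (m + single v (1::nat)) \<subseteq> V"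
  using Poly_Mapping.keys_add[of m "single v 1"] by auto

lemma strand_eq_0_outside:
  fixes c :: "'v set \<Rightarrow> ('v, 'k::field) mpoly"
  assumes V: "finite V" and A: "\<And>m. m \<in> A \<Longrightarrow> keys m \<subseteq> V"
    and c: "c \<in> koszul_chains V p (mono_piece A d)" and b: "\<not> keys b \<subseteq> V"
  shows "strand b c = 0"
proof (rule ext, rule ccontr)
  fix \<sigma> assume "strand b c \<sigma> \<noteq> 0 \<sigma>"
  with strand_in_face_chains(1)[OF c, of b] have \<sigma>: "\<sigma> \<subseteq> V" "\<sigma> \<subseteq> keys b" "keys (b - ind \<sigma>) \<subseteq> V"
    using A by (auto simp: face_chains_def faces_def)
  moreover have "finite \<sigma>" using \<sigma>(1) V by (rule finite_subset)
  ultimately have "keys b \<subseteq> V"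
    using Poly_Mapping.keys_add[of "b - ind \<sigma>" "ind \<sigma>"] minus_ind_add_ind[OF \<sigma>(2)] by auto
  with b show False by blast
qed

text \<open>In a multidegree \<open>b \<noteq> 0\<close> supported in \<open>V\<close> all subsets
  of the support are faces, so the strand is a full simplex and any variable of \<open>b\<close> is
  an apex. Multidegree 0 carries only the constant term of \<open>c {}\<close>, which
  \<open>const\<close> excludes.\<close>

lemma ring_koszul_acyclic:
  fixes c :: "'v::linorder set \<Rightarrow> ('v, 'k::field) mpoly"
  assumes V: "finite V" and c: "c \<in> koszul_chains V p (ring_piece V d)" "koszul_bd V mul_indet c = 0"
    and const: "p = 0 \<Longrightarrow> lookup (c {}) 0 = 0"
  shows "\<exists>b \<in> koszul_chains V (Suc p) (ring_piece V (d - 1)). koszul_bd V mul_indet b = c"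
proof (rule koszul_boundary_if_strands[OF V _ _ c(1)])
  fix b :: "'v \<Rightarrow>\<^sub>0 nat"
  let ?\<Delta> = "faces {m. keys m \<subseteq> V} b"
  have s: "strand b c \<in> face_chains V ?\<Delta> p" by (rule strand_in_face_chains(1)[OF c(1)])
  have zero: "\<exists>e\<in>face_chains V ?\<Delta> (Suc p). simp_bd V e = strand b c" if "strand b c = 0"
  proof
    show "0 \<in> face_chains V ?\<Delta> (Suc p)" by (simp add: face_chains_def)
    show "simp_bd V 0 = strand b c" unfolding that by (rule ext) (simp add: koszul_bd_def)
  qed
  show "\<exists>e\<in>face_chains V ?\<Delta> (Suc p). simp_bd V e = strand b c"
  proof (cases "keys b \<subseteq> V")
    case False
    then show ?thesis by (intro zero strand_eq_0_outside[OF V _ c(1)]) auto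
  next
    case bV: True
    show ?thesis
    proof (cases "b = 0")
      case True
      have "strand b c \<sigma> = 0" for \<sigma>
      proof (rule ccontr)
        assume nz: "strand b c \<sigma> \<noteq> 0"
        then have "\<sigma> = {}" using True by (auto simp: strand_def split: if_splits)
        moreover from nz s have "card \<sigma> = p" by (auto simp: face_chains_def)
        ultimately show False using nz const True by (simp add: strand_def ind_def)
      qed
      then show ?thesis by (intro zero) auto
    next
      case False
      then obtain v where v: "v \<in> keys b" by (metis all_not_in_conv keys_eq_empty)
      show ?thesis
      proof (rule simp_bd_cone[OF V _ _ s])
        show "v \<in> V" using v bV by blast
        show "simp_bd V (strand b c) = 0"
          unfolding strand_koszul_bd[symmetric] c(2) by (rule ext) (simp add: strand_def)
        show "insert v \<sigma> \<in> ?\<Delta>" if "\<sigma> \<in> ?\<Delta>" for \<sigma>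
          using that v bV by (auto simp: faces_def in_keys_iff lookup_minus)
      qed
    qed
  qed
qed (auto intro: keys_add_single_subset[THEN subsetD])

text \<open>The degree \<open>d\<close> component of the sum of the \<open>R(- s q)\<close>. The
  difference is formed in the integers, so a coordinate whose shift exceeds \<open>d\<close>
  contributes only 0.\<close>

definition free_piece :: "'v set \<Rightarrow> nat \<Rightarrow> (nat \<Rightarrow> nat) \<Rightarrow> int \<Rightarrow> (nat \<Rightarrow> ('v, 'k::field) mpoly) set" where
  "free_piece V r s d = {f. \<forall>q. f q \<in> (if q < r then ring_piece V (d - int (s q)) else {0})}"

lemma free_pieceD:
  assumes "f \<in> free_piece V r s d"
  shows "q < r \<Longrightarrow> f q \<in> ring_piece V (d - int (s q))" and "\<not> q < r \<Longrightarrow> f q = 0"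
  using assms unfolding free_piece_def by (auto dest!: spec[of _ q])

abbreviation mul_indet_fun :: "'v \<Rightarrow> (nat \<Rightarrow> ('v, 'k::field) mpoly) \<Rightarrow> nat \<Rightarrow> ('v, 'k) mpoly" where
  "mul_indet_fun v f \<equiv> \<lambda>q. indet v * f q"

lemma commuting_actions_mul_indet_fun: "commuting_actions mul_indet_fun"
  by (auto simp: commuting_actions_def additive_def distrib_left mult.left_commute fun_eq_iff)

lemma graded_pieces_ring_piece: "graded_pieces V mul_indet (ring_piece V)"
  by (rule graded_pieces_mono_piece) (auto intro: keys_add_single_subset[THEN subsetD])

lemma graded_pieces_free_piece: "graded_pieces V mul_indet_fun (free_piece V r s)"
proof -
  note R = graded_piecesD[OF graded_pieces_ring_piece[of V]]
  show ?thesis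
    unfolding graded_pieces_def
  proof (intro conjI allI ballI)
    fix v d and a :: "nat \<Rightarrow> ('a, 'b) mpoly" assume v: "v \<in> V" and a: "a \<in> free_piece V r s d"
    have "mul_indet v (a q) \<in> ring_piece V (d + 1 - int (s q))" if "q < r" for q
    proof -
      have "a q \<in> ring_piece V (d - int (s q))" using a that by (rule free_pieceD)
      from R(5)[OF v this] show ?thesis by (simp add: algebra_simps)
    qed
    then show "mul_indet_fun v a \<in> free_piece V r s (d + 1)"
      using free_pieceD(2)[OF a] by (simp add: free_piece_def)
  next
    fix d and a b :: "nat \<Rightarrow> ('a, 'b) mpoly" assume a: "a \<in> free_piece V r s d" and b: "b \<in> free_piece V r s d"
    have "(a - b) q \<in> (if q < r then ring_piece V (d - int (s q)) else {0})" for q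
      using R(2)[OF free_pieceD(1)[OF a] free_pieceD(1)[OF b], of q] free_pieceD(2)[OF a, of q] free_pieceD(2)[OF b, of q]
      by simp
    then show "a - b \<in> free_piece V r s d" by (simp add: free_piece_def)
  qed (auto simp: free_piece_def intro: R)
qed

lemma free_piece_koszul_acyclic:
  fixes c :: "'v::linorder set \<Rightarrow> nat \<Rightarrow> ('v, 'k::field) mpoly"
  assumes V: "finite V" and c: "c \<in> koszul_chains V p (free_piece V r s d)" "koszul_bd V mul_indet_fun c = 0"
    and const: "\<And>q. p = 0 \<Longrightarrow> lookup (c {} q) 0 = 0"
  shows "\<exists>b \<in> koszul_chains V (Suc p) (free_piece V r s (d - 1)). koszul_bd V mul_indet_fun b = c"
proof -
  have comp: "koszul_bd V mul_indet (\<lambda>\<sigma>. b \<sigma> q) = (\<lambda>\<tau>. koszul_bd V mul_indet_fun b \<tau> q)"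
    for q and b :: "'v set \<Rightarrow> nat \<Rightarrow> ('v, 'k::field) mpoly"
    by (rule koszul_bd_comp[where \<phi> = "\<lambda>f. f q" and X = mul_indet_fun]) (simp_all add: additive_def)
  have "\<exists>b \<in> koszul_chains V (Suc p) (ring_piece V (d - int (s q) - 1)).
      koszul_bd V mul_indet b = (\<lambda>\<sigma>. c \<sigma> q)" if "q < r" for q
  proof (rule ring_koszul_acyclic[OF V])
    show "(\<lambda>\<sigma>. c \<sigma> q) \<in> koszul_chains V p (ring_piece V (d - int (s q)))"
      unfolding koszul_chains_def
    proof (intro CollectI allI conjI impI)
      fix \<sigma>
      have "c \<sigma> \<in> free_piece V r s d" and *: "c \<sigma> \<noteq> 0 \<Longrightarrow> \<sigma> \<subseteq> V \<and> card \<sigma> = p"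
        using c(1) by (auto simp: koszul_chains_def)
      then show "c \<sigma> q \<in> ring_piece V (d - int (s q))" using that by (auto dest: free_pieceD)
      assume "c \<sigma> q \<noteq> 0"
      then have "c \<sigma> \<noteq> 0" by auto
      with * show "\<sigma> \<subseteq> V" "card \<sigma> = p" by blast+
    qed
    show "koszul_bd V mul_indet (\<lambda>\<sigma>. c \<sigma> q) = 0" using c(2) by (simp add: comp fun_eq_iff)
  qed (rule const)
  then obtain b where b: "\<And>q. q < r \<Longrightarrow> b q \<in> koszul_chains V (Suc p) (ring_piece V (d - int (s q) - 1))"
      "\<And>q. q < r \<Longrightarrow> koszul_bd V mul_indet (b q) = (\<lambda>\<sigma>. c \<sigma> q)"
    by metis
  define e where "e = (\<lambda>\<sigma> q. if q < r then b q \<sigma> else 0)"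
  have "e \<in> koszul_chains V (Suc p) (free_piece V r s (d - 1))"
    unfolding koszul_chains_def
  proof (intro CollectI allI conjI impI)
    fix \<sigma>
    show "e \<sigma> \<in> free_piece V r s (d - 1)"
      using b(1) by (simp add: free_piece_def e_def koszul_chains_def algebra_simps)
    assume "e \<sigma> \<noteq> 0"
    then obtain q where "q < r" "b q \<sigma> \<noteq> 0" by (auto simp: e_def fun_eq_iff split: if_splits)
    with b(1)[of q] show "\<sigma> \<subseteq> V" "card \<sigma> = Suc p" by (auto simp: koszul_chains_def)
  qed
  moreover have "koszul_bd V mul_indet_fun e = c"
  proof (intro ext)
    fix \<tau> q
    have "koszul_bd V mul_indet_fun e \<tau> q = koszul_bd V mul_indet (\<lambda>\<sigma>. e \<sigma> q) \<tau>" by (simp only: comp)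
    also have "\<dots> = c \<tau> q"
    proof (cases "q < r")
      case True
      then show ?thesis using b(2)[OF True] by (simp add: e_def)
    next
      case False
      then have "c \<tau> q = 0" using c(1) by (auto simp: koszul_chains_def dest: free_pieceD)
      with False show ?thesis by (simp add: e_def koszul_bd_def)
    qed
    finally show "koszul_bd V mul_indet_fun e \<tau> q = c \<tau> q" .
  qed
  ultimately show ?thesis by blast
qed

text \<open>The condition on constant terms says that the kernel lies in the maximal ideal times the
  free module, i.e. that the cover is minimal.\<close>

definition minimal_cover ::
    "'v set \<Rightarrow> nat \<Rightarrow> (nat \<Rightarrow> nat) \<Rightarrow> ((nat \<Rightarrow> ('v, 'k::field) mpoly) \<Rightarrow> 'b::ab_group_add) \<Rightarrow>
     ('v \<Rightarrow> 'b \<Rightarrow> 'b) \<Rightarrow> (int \<Rightarrow> 'b set) \<Rightarrow> bool" where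
  "minimal_cover V r s \<phi> Y N \<longleftrightarrow>
     additive \<phi> \<and> (\<forall>v f. \<phi> (mul_indet_fun v f) = Y v (\<phi> f)) \<and>
     (\<forall>d. N d = \<phi> ` free_piece V r s d) \<and>
     (\<forall>d. \<forall>f \<in> free_piece V r s d. \<phi> f = 0 \<longrightarrow> (\<forall>q. lookup (f q) 0 = 0))"

section \<open>Dimension shifting and the graded Nakayama argument\<close>

text \<open>The free module in the middle is acyclic up to constant terms, so homology of the
  covered module passes to its first syzygies one step lower. Minimality of the cover is what
  includes \<open>p = 0\<close>.\<close>

lemma koszul_exact_Suc_minimal_cover:
  assumes "finite V" "commuting_actions Y" "minimal_cover V r s \<phi> Y N"
  shows "koszul_exact V Y N (Suc p) d \<longleftrightarrow>
    koszul_exact V mul_indet_fun (\<lambda>d. {f \<in> free_piece V r s d. \<phi> f = 0}) p (d + 1)"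
  using assms(3) unfolding minimal_cover_def
  by (intro koszul_exact_kernel[where M = "free_piece V r s" and \<phi> = \<phi>] assms(1,2)
      commuting_actions_mul_indet_fun graded_pieces_free_piece free_piece_koszul_acyclic) auto

text \<open>Zeroth Koszul homology is the module modulo the maximal ideal times it. As the cover is
  minimal, this quotient has a nonzero class in degree \<open>d\<close> exactly when some generator
  has that degree.\<close>

lemma koszul_exact_0_minimal_cover:
  fixes \<phi> :: "(nat \<Rightarrow> ('v::linorder, 'k::field) mpoly) \<Rightarrow> 'b::ab_group_add"
  assumes V: "finite V" and Y: "commuting_actions Y" and cover: "minimal_cover V r s \<phi> Y N"
  shows "koszul_exact V Y N 0 d \<longleftrightarrow> (\<forall>q<r. int (s q) \<noteq> d)"
proof -
  have \<phi>: "additive \<phi>" "\<And>v f. \<phi> (mul_indet_fun v f) = Y v (\<phi> f)"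
    and N: "\<And>d. N d = \<phi> ` free_piece V r s d"
    and const: "\<And>d f q. f \<in> free_piece V r s d \<Longrightarrow> \<phi> f = 0 \<Longrightarrow> lookup (f q) 0 = 0"
    using cover unfolding minimal_cover_def by blast+
  have Y0: "Y v 0 = 0" for v using Y by (simp add: commuting_actions_def additive.zero)
  have "graded_pieces V mul_indet_fun (free_piece V r s :: int \<Rightarrow> (nat \<Rightarrow> ('v, 'k) mpoly) set)"
    by (rule graded_pieces_free_piece)
  note G = graded_piecesD[OF this]
  note comp = koszul_bd_comp[where X = mul_indet_fun and Y = Y and \<phi> = \<phi>, OF \<phi>]
  have \<phi>0: "\<phi> 0 = 0" using \<phi>(1) by (rule additive.zero)
  note lift = koszul_chains_lift[where \<phi> = \<phi> and V = V, OF N _ \<phi>0]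
  show ?thesis
  proof
    assume ex: "koszul_exact V Y N 0 d"
    show "\<forall>q<r. int (s q) \<noteq> d"
    proof (intro allI impI notI)
      fix q assume q: "q < r" "int (s q) = d"
      define u :: "nat \<Rightarrow> ('v, 'k) mpoly" where "u = (\<lambda>i. if i = q then 1 else 0)"
      have u: "u \<in> free_piece V r s d" using q by (auto simp: free_piece_def u_def mono_piece_def)
      define c where "c = (\<lambda>\<sigma> :: 'v set. if \<sigma> = {} then \<phi> u else 0)"
      have c: "c \<in> koszul_chains V 0 (N d)"
        using u G(1)[of d] \<phi>0 by (auto simp: koszul_chains_def c_def N image_iff intro: bexI[of _ 0])
      have "koszul_bd V Y c = 0" by (rule ext) (simp add: koszul_bd_def c_def Y0)
      then obtain b where b: "b \<in> koszul_chains V (Suc 0) (N (d - 1))" "koszul_bd V Y b = c"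
        using koszul_exactE[OF ex c] by blast
      obtain b' where b': "b' \<in> koszul_chains V (Suc 0) (free_piece V r s (d - 1))" "(\<lambda>\<sigma>. \<phi> (b' \<sigma>)) = b"
        using lift[OF G(1) b(1)] by blast
      \<comment> \<open>If the image of the basis vector \<open>u\<close> were a boundary, lifting
        that boundary would give \<open>w\<close> in the maximal ideal times the free module with
        the same image. Then \<open>u - w\<close> is a relation with constant coefficient 1.\<close>
      define w where "w = koszul_bd V mul_indet_fun b' {}"
      have "koszul_bd V mul_indet_fun b' \<in> koszul_chains V 0 (free_piece V r s (d - 1 + 1))"
        by (rule koszul_bd_in_chains[OF V commuting_actions_mul_indet_fun graded_pieces_free_piece b'(1)])
      then have w: "w \<in> free_piece V r s d" by (simp add: koszul_chains_def w_def)
      have "\<phi> w = \<phi> u" using fun_cong[OF comp[of V b'], of "{}"] b(2) b'(2) by (simp add: w_def c_def)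
      then have "\<phi> (u - w) = 0" by (simp add: additive.diff[OF \<phi>(1)])
      then have "lookup ((u - w) q) 0 = 0" by (rule const[OF G(2)[OF u w]])
      moreover have "lookup (w q) 0 = 0"
      proof -
        have "w q = (\<Sum>v\<in>V. indet v * b' {v} q)"
          by (simp add: w_def koszul_bd_def sgn_ins_def) (induction V rule: infinite_finite_induct; simp)
        then show ?thesis
          by (simp add: lookup_sum lookup_indet_mult)
      qed
      ultimately show False by (simp add: u_def lookup_minus)
    qed
  next
    assume no: "\<forall>q<r. int (s q) \<noteq> d"
    show "koszul_exact V Y N 0 d"
      unfolding koszul_exact_def
    proof (intro ballI impI)
      fix c assume c: "c \<in> koszul_chains V 0 (N d)"
      obtain c' where c': "c' \<in> koszul_chains V 0 (free_piece V r s d)" "(\<lambda>\<sigma>. \<phi> (c' \<sigma>)) = c"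
        using lift[OF G(1) c] by blast
      have bd0: "koszul_bd V mul_indet_fun c' = 0"
        by (rule koszul_bd_0_chain[OF V commuting_actions_mul_indet_fun c'(1)])
      \<comment> \<open>Without a generator of degree \<open>d\<close> every coordinate has nonzero
        degree, hence no constant term.\<close>
      have const0: "lookup (c' {} q) 0 = 0" for q
      proof (cases "q < r")
        case True
        then have "c' {} q \<in> ring_piece V (d - int (s q))" "d - int (s q) \<noteq> 0"
          using free_pieceD(1)[of "c' {}" V r s d q] c'(1) no by (auto simp: koszul_chains_def)
        then show ?thesis unfolding mono_piece_def by (metis (mono_tags, lifting) in_keys_iff int_ops(1) mdeg_zero mem_Collect_eq)
      next
        case False
        then have "c' {} q = 0"
          using free_pieceD(2)[of "c' {}" V r s d q] c'(1) by (auto simp: koszul_chains_def)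
        then show ?thesis by simp
      qed
      obtain b where b: "b \<in> koszul_chains V (Suc 0) (free_piece V r s (d - 1))"
          "koszul_bd V mul_indet_fun b = c'"
        using free_piece_koszul_acyclic[OF V c'(1) bd0 const0] by blast
      have "(\<lambda>\<sigma>. \<phi> (b \<sigma>)) \<in> koszul_chains V (Suc 0) (N (d - 1))"
        using b(1) \<phi>0 by (force simp: koszul_chains_def N)
      moreover have "koszul_bd V Y (\<lambda>\<sigma>. \<phi> (b \<sigma>)) = c"
        by (simp only: comp b(2) c'(2))
      ultimately show "\<exists>b\<in>koszul_chains V (Suc 0) (N (d - 1)). koszul_bd V Y b = c" by blast
    qed
  qed
qed

section \<open>Betti numbers and Koszul homology\<close>

definition free_hpart :: "nat \<Rightarrow> (nat \<Rightarrow> nat) \<Rightarrow> int \<Rightarrow> (nat \<Rightarrow> ('v, 'k::field) mpoly) \<Rightarrow> nat \<Rightarrow> ('v, 'k) mpoly" where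
  "free_hpart r s d f = (\<lambda>q. if q < r then hpart (d - int (s q)) (f q) else 0)"

lemma free_modD:
  assumes "f \<in> free_mod V r"
  shows "q < r \<Longrightarrow> f q \<in> carrier (mpoly_ring V)" and "\<not> q < r \<Longrightarrow> f q = 0"
    and "f q \<in> carrier (mpoly_ring V)"
proof -
  show 1: "q < r \<Longrightarrow> f q \<in> carrier (mpoly_ring V)" "\<not> q < r \<Longrightarrow> f q = 0"
    using assms by (auto simp: free_mod_def simp del: mpoly_ring_simps)
  then show "f q \<in> carrier (mpoly_ring V)" by (cases "q < r") auto
qed

lemma free_modI:
  "(\<And>q. q < r \<Longrightarrow> f q \<in> carrier (mpoly_ring V)) \<Longrightarrow> (\<And>q. \<not> q < r \<Longrightarrow> f q = 0) \<Longrightarrow> f \<in> free_mod V r"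
  by (simp add: free_mod_def not_less)

lemma ring_piece_carrier: "p \<in> ring_piece V d \<Longrightarrow> p \<in> carrier (mpoly_ring V)"
  by (auto simp: mono_piece_def)

lemma free_piece_subset: "f \<in> free_piece V r s d \<Longrightarrow> f \<in> free_mod V r"
  using ring_piece_carrier by (intro free_modI) (blast dest: free_pieceD)+

lemma free_hpart_in_free_piece: "f \<in> free_mod V r \<Longrightarrow> free_hpart r s d f \<in> free_piece V r s d"
  unfolding free_piece_def free_hpart_def using hpart_in_mono_piece free_modD(1)[of f V r]
  by (auto simp del: mpoly_ring_simps)

lemma free_hpart_id:
  assumes "f \<in> free_piece V r s d"
  shows "free_hpart r s d f = f"
proof
  fix q
  show "free_hpart r s d f q = f q"
    using free_pieceD[OF assms, of q] by (auto simp: free_hpart_def mono_piece_def intro!: hpart_id)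
qed

text \<open>Taking homogeneous components commutes with a row of a graded matrix whose target has
  shift \<open>e\<close>. The augmentation is the case \<open>e = 0\<close>.\<close>

lemma hpart_matrix_row:
  fixes D :: "nat \<Rightarrow> ('v, 'k::field) mpoly"
  assumes "\<And>q m. q < r' \<Longrightarrow> m \<in> keys (D q) \<Longrightarrow> int (mdeg m) = int (s' q) - e"
  shows "hpart (d - e) (\<Sum>q<r'. D q * f q) = (\<Sum>q<r'. D q * free_hpart r' s' d f q)"
  unfolding hpart_sum
proof (intro sum.cong refl)
  fix q assume "q \<in> {..<r'}"
  then show "hpart (d - e) (D q * f q) = D q * free_hpart r' s' d f q"
    using hpart_mult[of "D q" "int (s' q) - e" "d - int (s' q)" "f q"] assms[of q]
    by (auto simp: free_hpart_def)
qed

abbreviation homogeneous_part :: "('v, 'k::field) mpoly set \<Rightarrow> int \<Rightarrow> ('v, 'k) mpoly set" where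
  "homogeneous_part J d \<equiv> {p \<in> J. \<forall>m \<in> keys p. int (mdeg m) = d}"

text \<open>All maps commute with homogeneous components, so exactness restricts to each degree.
  Relations have no constant terms because exactness makes them images under the next differential,
  whose entries have none.\<close>

lemma minimal_covers_of_resolution:
  fixes F :: "('v::linorder, 'k::field) mpoly free_res"
  assumes F: "minimal_graded_free_resolution V J F"
  shows "minimal_cover V (res_rank F 0) (res_shift F 0) (aug_map F) mul_indet (homogeneous_part J)"
    and "minimal_cover V (res_rank F 1) (res_shift F 1) (diff_map F 0) mul_indet_fun
      (\<lambda>d. {f \<in> free_piece V (res_rank F 0) (res_shift F 0) d. aug_map F f = 0})"
    and "minimal_cover V (res_rank F (Suc (Suc i))) (res_shift F (Suc (Suc i))) (diff_map F (Suc i)) mul_indet_fun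
      (\<lambda>d. {f \<in> free_piece V (res_rank F (Suc i)) (res_shift F (Suc i)) d. diff_map F i f = 0})"
proof -
  note [simp del] = mpoly_ring_simps
  let ?P = "\<lambda>i. free_piece V (res_rank F i) (res_shift F i) :: int \<Rightarrow> (nat \<Rightarrow> ('v, 'k) mpoly) set"
  have augdeg: "\<And>q m. q < res_rank F 0 \<Longrightarrow> m \<in> keys (res_aug F q) \<Longrightarrow>
        int (mdeg m) = int (res_shift F 0 q) - 0"
    and diffdeg: "\<And>i p q m. p < res_rank F i \<Longrightarrow> q < res_rank F (Suc i) \<Longrightarrow>
        m \<in> keys (res_diff F i p q) \<Longrightarrow>
        int (mdeg m) = int (res_shift F (Suc i) q) - int (res_shift F i p)"
    and diffcarr: "\<And>i p q. p < res_rank F i \<Longrightarrow> q < res_rank F (Suc i) \<Longrightarrow> res_diff F i p q \<in> carrier (mpoly_ring V)"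
    and img: "aug_map F ` free_mod V (res_rank F 0) = J"
    and ker0: "{v \<in> free_mod V (res_rank F 0). aug_map F v = 0} = diff_map F 0 ` free_mod V (res_rank F 1)"
    and ker: "\<And>i. {v \<in> free_mod V (res_rank F (Suc i)). diff_map F i v = 0}
       = diff_map F (Suc i) ` free_mod V (res_rank F (Suc (Suc i)))"
    and const: "\<And>i p q. p < res_rank F i \<Longrightarrow> q < res_rank F (Suc i) \<Longrightarrow>
        lookup (res_diff F i p q) 0 = 0"
  proof -
    have G: "graded_free_resolution V J F"
      and C: "\<And>i p q. p < res_rank F i \<Longrightarrow> q < res_rank F (i + 1) \<Longrightarrow> lookup (res_diff F i p q) 0 = 0"
      using F unfolding minimal_graded_free_resolution_def by blast+
    note G' = G[unfolded graded_free_resolution_def]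
    note G1 = conjunct1[OF G'] and G2 = conjunct1[OF conjunct2[OF G']]
      and G3 = conjunct1[OF conjunct2[OF conjunct2[OF G']]]
      and G4 = conjunct1[OF conjunct2[OF conjunct2[OF conjunct2[OF G']]]]
      and G5 = conjunct2[OF conjunct2[OF conjunct2[OF conjunct2[OF G']]]]
    show "\<And>q m. q < res_rank F 0 \<Longrightarrow> m \<in> keys (res_aug F q) \<Longrightarrow>
        int (mdeg m) = int (res_shift F 0 q) - 0"
      using G1 by (simp add: homogeneous_def)
    show "int (mdeg m) = int (res_shift F (Suc i) q) - int (res_shift F i p)"
      if "p < res_rank F i" "q < res_rank F (Suc i)" "m \<in> keys (res_diff F i p q)" for i p q m
    proof -
      have "mdeg m + res_shift F i p = res_shift F (Suc i) q" using G2 that by simp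
      then show ?thesis by linarith
    qed
    show "\<And>i p q. p < res_rank F i \<Longrightarrow> q < res_rank F (Suc i) \<Longrightarrow> res_diff F i p q \<in> carrier (mpoly_ring V)"
      using G2 by simp
    show "aug_map F ` free_mod V (res_rank F 0) = J" by (rule G3)
    show "{v \<in> free_mod V (res_rank F 0). aug_map F v = 0} = diff_map F 0 ` free_mod V (res_rank F 1)"
      by (rule G4)
    show "\<And>i. {v \<in> free_mod V (res_rank F (Suc i)). diff_map F i v = 0}
       = diff_map F (Suc i) ` free_mod V (res_rank F (Suc (Suc i)))"
      using G5 by (simp add: zero_fun_def)
    show "\<And>i p q. p < res_rank F i \<Longrightarrow> q < res_rank F (Suc i) \<Longrightarrow> lookup (res_diff F i p q) 0 = 0"
      using C by simp
  qed
  have hpaug: "hpart d (aug_map F f) = aug_map F (free_hpart (res_rank F 0) (res_shift F 0) d f)" for d f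
    using hpart_matrix_row[where D = "res_aug F" and e = 0, OF augdeg] by (simp add: aug_map_def)
  have hpdiff: "free_hpart (res_rank F i) (res_shift F i) d (diff_map F i f) =
      diff_map F i (free_hpart (res_rank F (Suc i)) (res_shift F (Suc i)) d f)" for i d f
  proof
    fix p
    show "free_hpart (res_rank F i) (res_shift F i) d (diff_map F i f) p =
      diff_map F i (free_hpart (res_rank F (Suc i)) (res_shift F (Suc i)) d f) p"
    proof (cases "p < res_rank F i")
      case True
      show ?thesis
        using hpart_matrix_row[where D = "res_diff F i p" and e = "int (res_shift F i p)", OF diffdeg[OF True]] True
        by (simp add: diff_map_def free_hpart_def[of "res_rank F i"])
    qed (simp add: diff_map_def free_hpart_def)
  qed
  have addaug: "additive (aug_map F)"
    by (simp add: additive_def aug_map_def distrib_left sum.distrib)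
  have adddiff: "additive (diff_map F i)" for i
    by (auto simp: additive_def diff_map_def distrib_left sum.distrib fun_eq_iff)
  have mulaug: "aug_map F (mul_indet_fun v f) = indet v * aug_map F f" for v f
    by (simp add: aug_map_def sum_distrib_left mult.left_commute)
  have muldiff: "diff_map F i (mul_indet_fun v f) = mul_indet_fun v (diff_map F i f)" for i v f
    by (auto simp: diff_map_def sum_distrib_left mult.left_commute fun_eq_iff)
  have boundary_const: "lookup (diff_map F i w q) 0 = 0" for i w q
    by (auto simp: diff_map_def lookup_sum lookup_mult_0 const)
  have augpiece: "aug_map F f \<in> homogeneous_part J d" if "f \<in> ?P 0 d" for f d
  proof -
    have "aug_map F f = hpart d (aug_map F f)" using that by (simp add: hpaug free_hpart_id)
    then have "int (mdeg m) = d" if "m \<in> keys (aug_map F f)" for m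
      using that by (metis in_keys_iff lookup_hpart)
    moreover have "aug_map F f \<in> J" using img free_piece_subset[OF that] by blast
    ultimately show ?thesis by simp
  qed
  have augsurj: "p \<in> aug_map F ` ?P 0 d" if p: "p \<in> homogeneous_part J d" for p d
  proof -
    obtain w where w: "w \<in> free_mod V (res_rank F 0)" "p = aug_map F w" using p img by blast
    have "p = hpart d p" using p by (intro hpart_id[symmetric]) auto
    then have "p = aug_map F (free_hpart (res_rank F 0) (res_shift F 0) d w)" using w(2) by (simp add: hpaug)
    then show ?thesis using free_hpart_in_free_piece[OF w(1)] by blast
  qed
  have diffpiece: "diff_map F i f \<in> ?P i d" if f: "f \<in> ?P (Suc i) d" for f d i
  proof -
    have fm: "f \<in> free_mod V (res_rank F (Suc i))" by (rule free_piece_subset[OF f])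
    have "diff_map F i f \<in> free_mod V (res_rank F i)"
    proof (rule free_modI)
      fix p assume "p < res_rank F i"
      then show "diff_map F i f p \<in> carrier (mpoly_ring V)"
        using diffcarr free_modD(3)[OF fm] unfolding diff_map_def
        by (simp del: mpoly_ring_simps) (intro carrier_sum carrier_closed(2); simp)
    qed (simp add: diff_map_def)
    moreover have "diff_map F i f = free_hpart (res_rank F i) (res_shift F i) d (diff_map F i f)"
      using f by (simp add: hpdiff free_hpart_id)
    ultimately show ?thesis using free_hpart_in_free_piece by metis
  qed
  have diffsurj: "f \<in> diff_map F i ` ?P (Suc i) d"
    if f: "f \<in> ?P i d" "f \<in> diff_map F i ` free_mod V (res_rank F (Suc i))" for f i d
  proof -
    obtain w where w: "w \<in> free_mod V (res_rank F (Suc i))" "f = diff_map F i w" using f(2) by blast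
    have "f = diff_map F i (free_hpart (res_rank F (Suc i)) (res_shift F (Suc i)) d w)"
      using free_hpart_id[OF f(1)] w(2) by (simp add: hpdiff)
    then show ?thesis using free_hpart_in_free_piece[OF w(1)] by blast
  qed
  have z0: "aug_map F f = 0 \<Longrightarrow> f \<in> ?P 0 d \<Longrightarrow> f \<in> diff_map F 0 ` free_mod V (res_rank F (Suc 0))" for f d
    using ker0 free_piece_subset[of f V] by auto
  have zi: "diff_map F i f = 0 \<Longrightarrow> f \<in> ?P (Suc i) d \<Longrightarrow> f \<in> diff_map F (Suc i) ` free_mod V (res_rank F (Suc (Suc i)))" for f d i
    using ker[of i] free_piece_subset[of f V] by auto
  have b0: "f \<in> ?P (Suc 0) d \<Longrightarrow> aug_map F (diff_map F 0 f) = 0" for f d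
    using ker0 free_piece_subset[of f V] by auto
  have bi: "f \<in> ?P (Suc (Suc i)) d \<Longrightarrow> diff_map F i (diff_map F (Suc i) f) = 0" for f d i
    using ker[of i] free_piece_subset[of f V] by blast
  show "minimal_cover V (res_rank F 0) (res_shift F 0) (aug_map F) mul_indet (homogeneous_part J)"
    unfolding minimal_cover_def
  proof (intro conjI allI ballI impI addaug mulaug)
    show "homogeneous_part J d = aug_map F ` ?P 0 d" for d
      using augpiece augsurj by blast
    fix d f q assume "f \<in> ?P 0 d" "aug_map F f = 0"
    then show "lookup (f q) 0 = 0" using z0 boundary_const by blast
  qed
  show "minimal_cover V (res_rank F 1) (res_shift F 1) (diff_map F 0) mul_indet_fun
      (\<lambda>d. {f \<in> ?P 0 d. aug_map F f = 0})"
    unfolding minimal_cover_def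
  proof (intro conjI allI ballI impI adddiff muldiff)
    show "{f \<in> ?P 0 d. aug_map F f = 0} = diff_map F 0 ` ?P 1 d" for d
      using diffpiece[of _ 0 d] b0[of _ d] diffsurj[of _ 0 d] z0[of _ d] by auto
    fix d f q assume "f \<in> ?P 1 d" "diff_map F 0 f = 0"
    then have "f \<in> diff_map F (Suc 0) ` free_mod V (res_rank F (Suc (Suc 0)))" using zi[of 0 f d] by simp
    then show "lookup (f q) 0 = 0" using boundary_const by blast
  qed
  show "minimal_cover V (res_rank F (Suc (Suc i))) (res_shift F (Suc (Suc i))) (diff_map F (Suc i)) mul_indet_fun
      (\<lambda>d. {f \<in> ?P (Suc i) d. diff_map F i f = 0})"
    unfolding minimal_cover_def
  proof (intro conjI allI ballI impI adddiff muldiff)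
    show "{f \<in> ?P (Suc i) d. diff_map F i f = 0} = diff_map F (Suc i) ` ?P (Suc (Suc i)) d" for d
      using diffpiece[of _ "Suc i" d] bi[of _ i d] diffsurj[of _ "Suc i" d] zi[of i _ d] by auto
    fix d f q assume "f \<in> ?P (Suc (Suc i)) d" "diff_map F (Suc i) f = 0"
    then have "f \<in> diff_map F (Suc (Suc i)) ` free_mod V (res_rank F (Suc (Suc (Suc i))))" using zi[of "Suc i" f d] by simp
    then show "lookup (f q) 0 = 0" using boundary_const by blast
  qed
qed

text \<open>Shifting along the resolution turns the \<open>i\<close>-th homology of \<open>J\<close>
  into the zeroth homology of the \<open>i\<close>-th syzygies, which detects generator degrees. The
  left side does not mention \<open>F\<close>, so it does not matter which minimal resolution was
  chosen.\<close>

theorem koszul_exact_iff_no_shift: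
  fixes F :: "('v::linorder, 'k::field) mpoly free_res"
  assumes V: "finite V" and F: "minimal_graded_free_resolution V J F"
  shows "koszul_exact V mul_indet (homogeneous_part J) i d \<longleftrightarrow>
    (\<forall>q<res_rank F i. int (res_shift F i q) \<noteq> d + int i)"
proof -
  note c = minimal_covers_of_resolution[OF F]
  note S = koszul_exact_Suc_minimal_cover[OF V] and Z = koszul_exact_0_minimal_cover[OF V]
  note com = commuting_actions_mul_indet commuting_actions_mul_indet_fun
  let ?P = "\<lambda>i. free_piece V (res_rank F i) (res_shift F i) :: int \<Rightarrow> (nat \<Rightarrow> ('v, 'k) mpoly) set"
  let ?K = "\<lambda>i d. {f \<in> ?P i d. case i of 0 \<Rightarrow> aug_map F f = 0 | Suc j \<Rightarrow> diff_map F j f = 0}"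
  have cover: "minimal_cover V (res_rank F (Suc i)) (res_shift F (Suc i)) (diff_map F i) mul_indet_fun (?K i)" for i
    using c(2,3) by (cases i) auto
  \<comment> \<open>Each step trades one homological degree for one coefficient degree; reaching the
    kernel of the \<open>i\<close>-th map takes \<open>i + 1\<close> steps.\<close>
  have down: "koszul_exact V mul_indet (homogeneous_part J) (Suc (i + p)) d \<longleftrightarrow>
      koszul_exact V mul_indet_fun (?K i) p (d + int i + 1)" for i p
  proof (induction i arbitrary: p)
    case 0
    show ?case using S[OF com(1) c(1), of p d] by simp
  next
    case (Suc i)
    show ?case using Suc[of "Suc p"] S[OF com(2) cover[of i], of p "d + int i + 1"] by (simp add: algebra_simps)
  qed
  show ?thesis
  proof (cases i)
    case 0
    then show ?thesis using Z[OF com(1) c(1), of d] by simp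
  next
    case (Suc j)
    then show ?thesis using down[of j 0] Z[OF com(2) cover[of j], of "d + int j + 1"] by (simp add: algebra_simps)
  qed
qed

section \<open>Existence of minimal resolutions\<close>

definition submod :: "'v set \<Rightarrow> (nat \<Rightarrow> ('v, 'k::field) mpoly) set \<Rightarrow> bool" where
  "submod V M \<longleftrightarrow> 0 \<in> M \<and> (\<forall>f\<in>M. \<forall>g\<in>M. f + g \<in> M) \<and>
     (\<forall>a\<in>carrier (mpoly_ring V). \<forall>f\<in>M. (\<lambda>p. a * f p) \<in> M)"

lemma submodD:
  assumes "submod V M"
  shows "0 \<in> M" and "f \<in> M \<Longrightarrow> g \<in> M \<Longrightarrow> f + g \<in> M"
    and "a \<in> carrier (mpoly_ring V) \<Longrightarrow> f \<in> M \<Longrightarrow> (\<lambda>p. a * f p) \<in> M"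
  using assms unfolding submod_def by blast+

lemma sum_fun_apply: "(\<Sum>i\<in>I. h i) x = (\<Sum>i\<in>I. h i x)"
  for h :: "'i \<Rightarrow> 'x \<Rightarrow> 'y::comm_monoid_add"
  by (induction I rule: infinite_finite_induct) simp_all

lemma submod_sum:
  assumes "submod V M" "\<And>i. i \<in> I \<Longrightarrow> h i \<in> M"
  shows "(\<Sum>i\<in>I. h i) \<in> M"
  using assms(2)
proof (induction I rule: infinite_finite_induct)
  case (insert x F)
  then show ?case unfolding sum.insert[OF insert.hyps(1,2)] by (intro submodD(2)[OF assms(1)]) auto
qed (simp_all add: submodD(1)[OF assms(1)])

lemma constant_in_carrier [simp]: "single 0 c \<in> carrier (mpoly_ring V)"
  by simp

text \<open>A graded piece lies in the span of finitely many monomial unit vectors, so a maximal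
  independent subset of \<open>N\<close> inside it is finite.\<close>

lemma finite_spanning_set_of_piece:
  fixes N :: "(nat \<Rightarrow> ('v, 'k::field) mpoly) set"
  assumes "finite V"
  shows "\<exists>B. finite B \<and> B \<subseteq> N \<inter> free_piece V r s d \<and>
    (\<forall>M. submod V M \<longrightarrow> B \<subseteq> M \<longrightarrow> N \<inter> free_piece V r s d \<subseteq> M)"
proof -
  let ?scale = "\<lambda>(c::'k) (f :: nat \<Rightarrow> ('v, 'k) mpoly) q. single 0 c * f q"
  interpret vs: vector_space ?scale
    by unfold_locales
      (auto simp: fun_eq_iff distrib_left distrib_right single_add mult_single mult.assoc[symmetric])
  define unit :: "nat \<Rightarrow> ('v \<Rightarrow>\<^sub>0 nat) \<Rightarrow> nat \<Rightarrow> ('v, 'k) mpoly"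
    where "unit = (\<lambda>q m i. if i = q then single m 1 else 0)"
  \<comment> \<open>Degrees up to \<open>nat d\<close> suffice, since the shifts \<open>s q\<close>
    are nonnegative.\<close>
  define T where "T = (\<lambda>(q, m). unit q m) ` ({..<r} \<times> (\<Union>n\<le>nat d. {m. keys m \<subseteq> V \<and> mdeg m = n}))"
  have finT: "finite T" unfolding T_def using finite_monomials[OF assms] by auto
  have piece: "free_piece V r s d \<subseteq> vs.span T"
  proof
    fix f :: "nat \<Rightarrow> ('v, 'k) mpoly" assume f: "f \<in> free_piece V r s d"
    have "f = (\<Sum>q<r. \<Sum>m\<in>keys (f q). ?scale (lookup (f q) m) (unit q m))"
    proof
      fix i
      have "(\<Sum>q<r. \<Sum>m\<in>keys (f q). ?scale (lookup (f q) m) (unit q m)) i =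
          (\<Sum>q<r. if i = q then \<Sum>m\<in>keys (f q). single m (lookup (f q) m) else 0)"
        unfolding sum_fun_apply by (intro sum.cong refl) (simp add: unit_def mult_single)
      also have "\<dots> = f i"
        using free_pieceD(2)[OF f, of i] by (auto simp: poly_mapping_sum_single[symmetric])
      finally show "f i = (\<Sum>q<r. \<Sum>m\<in>keys (f q). ?scale (lookup (f q) m) (unit q m)) i"
        by simp
    qed
    also have "\<dots> \<in> vs.span T"
    proof (intro vs.span_sum vs.span_scale vs.span_base)
      fix q m assume q: "q \<in> {..<r}" and m: "m \<in> keys (f q)"
      then have "keys m \<subseteq> V" "int (mdeg m) = d - int (s q)"
        using free_pieceD(1)[OF f, of q] by (auto simp: mono_piece_def)
      then have "keys m \<subseteq> V" "mdeg m \<le> nat d" by linarith+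
      then show "unit q m \<in> T" using q by (auto simp: T_def)
    qed
    finally show "f \<in> vs.span T" .
  qed
  obtain B where B: "B \<subseteq> N \<inter> free_piece V r s d" "vs.independent B" "N \<inter> free_piece V r s d \<subseteq> vs.span B"
    by (rule vs.maximal_independent_subset)
  have "finite B" using vs.independent_span_bound[OF finT B(2)] B(1) piece by blast
  moreover have "N \<inter> free_piece V r s d \<subseteq> M" if M: "submod V M" "B \<subseteq> M" for M
  proof -
    have "vs.subspace M"
      unfolding vs.subspace_def using M(1) constant_in_carrier unfolding submod_def by blast
    then show ?thesis using B(3) vs.span_minimal[OF M(2)] by blast
  qed
  ultimately show ?thesis using B(1) by blast
qed

lemma free_mod_sum_free_hpart:
  assumes "f \<in> free_mod V r"
  obtains I where "finite I" "f = (\<Sum>d\<in>I. free_hpart r s d f)"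
proof
  define I where "I = (\<Union>q<r. (\<lambda>m. int (mdeg m) + int (s q)) ` keys (f q))"
  show "finite I" by (simp add: I_def)
  show "f = (\<Sum>d\<in>I. free_hpart r s d f)"
  proof
    fix q
    show "f q = (\<Sum>d\<in>I. free_hpart r s d f) q"
    proof (cases "q < r")
      case False
      then show ?thesis using free_modD(2)[OF assms, of q] by (simp add: sum_fun_apply free_hpart_def)
    next
      case True
      show ?thesis
      proof (rule poly_mapping_eqI)
        fix m
        have "lookup ((\<Sum>d\<in>I. free_hpart r s d f) q) m =
            (\<Sum>d\<in>I. if d = int (mdeg m) + int (s q) then lookup (f q) m else 0)"
          using True by (auto simp: sum_fun_apply free_hpart_def lookup_sum lookup_hpart intro!: sum.cong)
        also have "\<dots> = lookup (f q) m"
        proof (cases "m \<in> keys (f q)")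
          case m: True
          then have "int (mdeg m) + int (s q) \<in> I" using True by (auto simp: I_def)
          then show ?thesis using \<open>finite I\<close> by simp
        qed (auto simp: in_keys_iff intro: sum.neutral)
        finally show "lookup (f q) m = lookup ((\<Sum>d\<in>I. free_hpart r s d f) q) m"
          by simp
      qed
    qed
  qed
qed

lemma indet_in_carrier: "v \<in> V \<Longrightarrow> indet v \<in> carrier (mpoly_ring V)"
  by (simp add: indet_def monom_of_def)

text \<open>Vanishing of zeroth homology writes \<open>f\<close> as a sum of variables times
  elements of \<open>N\<close> of degree \<open>d - 1\<close>.\<close>

lemma koszul_exact_0_generated:
  fixes N :: "(nat \<Rightarrow> ('v::linorder, 'k::field) mpoly) set"
  assumes ex: "koszul_exact V mul_indet_fun (\<lambda>d. N \<inter> free_piece V r s d) 0 d" and N: "0 \<in> N"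
    and f: "f \<in> N \<inter> free_piece V r s d"
    and M: "submod V M" "N \<inter> free_piece V r s (d - 1) \<subseteq> M"
  shows "f \<in> M"
proof -
  have "graded_pieces V mul_indet_fun (free_piece V r s :: int \<Rightarrow> (nat \<Rightarrow> ('v, 'k) mpoly) set)"
    by (rule graded_pieces_free_piece)
  note G = graded_piecesD[OF this]
  define c where "c = (\<lambda>\<sigma> :: 'v set. if \<sigma> = {} then f else 0)"
  have c: "c \<in> koszul_chains V 0 (N \<inter> free_piece V r s d)"
    using f N G(1)[of d] by (simp add: koszul_chains_def c_def)
  have "koszul_bd V mul_indet_fun c = 0"
    by (intro ext) (simp add: koszul_bd_def c_def zero_fun_def[symmetric] sum_fun_apply)
  then obtain b where b: "b \<in> koszul_chains V (Suc 0) (N \<inter> free_piece V r s (d - 1))"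
      "koszul_bd V mul_indet_fun b = c"
    using koszul_exactE[OF ex c] by blast
  have "f = koszul_bd V mul_indet_fun b {}" using b(2) by (simp add: c_def)
  also have "\<dots> = (\<Sum>v\<in>V. mul_indet_fun v (b {v}))"
    by (simp add: koszul_bd_def sgn_ins_def)
  also have "\<dots> \<in> M"
  proof (rule submod_sum[OF M(1)])
    fix v assume "v \<in> V"
    moreover have "b {v} \<in> M" using b(1) M(2) by (auto simp: koszul_chains_def)
    ultimately show "mul_indet_fun v (b {v}) \<in> M"
      by (intro submodD(3)[OF M(1)] indet_in_carrier)
  qed
  finally show ?thesis .
qed

definition graded_submod :: "'v set \<Rightarrow> nat \<Rightarrow> (nat \<Rightarrow> nat) \<Rightarrow> (nat \<Rightarrow> ('v, 'k::field) mpoly) set \<Rightarrow> bool" where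
  "graded_submod V r s N \<longleftrightarrow> N \<subseteq> free_mod V r \<and> submod V N \<and> (\<forall>f\<in>N. \<forall>d. free_hpart r s d f \<in> N)"

text \<open>Finite spanning sets of the pieces in degrees 0 to \<open>D\<close> generate everything,
  because above \<open>D\<close> each element comes from one degree lower. This takes the place of a
  Noetherian argument.\<close>

lemma finite_homogeneous_generators:
  fixes N :: "(nat \<Rightarrow> ('v::linorder, 'k::field) mpoly) set"
  assumes V: "finite V" and N: "graded_submod V r s N"
    and ex: "\<And>d. d > D \<Longrightarrow> koszul_exact V mul_indet_fun (\<lambda>d. N \<inter> free_piece V r s d) 0 d"
  obtains G where "finite G" "\<And>g. g \<in> G \<Longrightarrow> \<exists>d::nat. g \<in> N \<inter> free_piece V r s (int d)"
    "\<And>M. submod V M \<Longrightarrow> G \<subseteq> M \<Longrightarrow> N \<subseteq> M"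
proof -
  have "\<forall>d. \<exists>B. finite B \<and> B \<subseteq> N \<inter> free_piece V r s d \<and>
      (\<forall>M. submod V M \<longrightarrow> B \<subseteq> M \<longrightarrow> N \<inter> free_piece V r s d \<subseteq> M)"
    by (intro allI finite_spanning_set_of_piece V)
  from choice[OF this] obtain B where "\<forall>d. finite (B d) \<and> B d \<subseteq> N \<inter> free_piece V r s d \<and>
      (\<forall>M. submod V M \<longrightarrow> B d \<subseteq> M \<longrightarrow> N \<inter> free_piece V r s d \<subseteq> M)" ..
  then have B: "\<And>d. finite (B d)" "\<And>d. B d \<subseteq> N \<inter> free_piece V r s d"
      "\<And>d M. submod V M \<Longrightarrow> B d \<subseteq> M \<Longrightarrow> N \<inter> free_piece V r s d \<subseteq> M"
    by blast+
  define G where "G = (\<Union>n\<le>nat D. B (int n))"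
  show thesis
  proof (rule that[of G])
    show "finite G" by (simp add: G_def B(1))
    show "\<exists>d::nat. g \<in> N \<inter> free_piece V r s (int d)" if "g \<in> G" for g
    proof -
      from \<open>g \<in> G\<close> obtain n where "g \<in> B (int n)" unfolding G_def by (rule UN_E)
      then show ?thesis using B(2)[of "int n"] by (intro exI[of _ n]) (rule subsetD)
    qed
    fix M assume M: "submod V M" "G \<subseteq> M"
    have pos: "N \<inter> free_piece V r s (int n) \<subseteq> M" for n
    proof (induction n)
      case 0
      have "B (int 0) \<subseteq> M" using M(2) unfolding G_def by blast
      then show ?case by (rule B(3)[OF M(1)])
    next
      case (Suc n)
      show ?case
      proof (cases "Suc n \<le> nat D")
        case True
        then have "B (int (Suc n)) \<subseteq> M" using M(2) unfolding G_def by blast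
        then show ?thesis by (rule B(3)[OF M(1)])
      next
        case False
        then have "D < int (Suc n)" by linarith
        moreover have "0 \<in> N" using N by (simp add: graded_submod_def submod_def)
        ultimately show ?thesis
          using koszul_exact_0_generated[OF ex _ _ M(1)] Suc.IH by fastforce
      qed
    qed
    have piece: "N \<inter> free_piece V r s d \<subseteq> M" for d
    proof (cases "d \<ge> 0")
      case True
      then show ?thesis using pos[of "nat d"] by simp
    next
      case False
      have "f = 0" if "f \<in> free_piece V r s d" for f :: "nat \<Rightarrow> ('v, 'k) mpoly"
      proof
        fix q
        have "keys (f q) = {}"
        proof (cases "q < r")
          case True
          then show ?thesis using free_pieceD(1)[OF that True] False by (force simp: mono_piece_def)
        qed (use free_pieceD(2)[OF that] in simp)
        then show "f q = 0 q" by simp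
      qed
      then show ?thesis using M(1) by (auto simp: submod_def)
    qed
    show "N \<subseteq> M"
    proof
      fix f assume f: "f \<in> N"
      then have fm: "f \<in> free_mod V r" using N by (auto simp: graded_submod_def)
      obtain I where I: "f = (\<Sum>d\<in>I. free_hpart r s d f)"
        by (rule free_mod_sum_free_hpart[OF fm])
      have "free_hpart r s d f \<in> M" for d
        using piece[of d] free_hpart_in_free_piece[OF fm] f N by (auto simp: graded_submod_def)
      then show "f \<in> M" using submod_sum[OF M(1), of I] I by metis
    qed
  qed
qed

section \<open>Minimal generators and their syzygies\<close>

text \<open>The matrix map with columns \<open>g q\<close>. The differentials of the resolution will
  be of this form, and so will its augmentation once \<open>J\<close> is embedded in
  \<open>R^1\<close>.\<close>

definition comb :: "nat \<Rightarrow> (nat \<Rightarrow> nat \<Rightarrow> ('v, 'k::field) mpoly) \<Rightarrow> (nat \<Rightarrow> ('v, 'k) mpoly) \<Rightarrow> nat \<Rightarrow> ('v, 'k) mpoly" where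
  "comb r g f = (\<lambda>p. \<Sum>q<r. g q p * f q)"

lemma additive_comb: "additive (comb r g)"
  by (auto simp: additive_def comb_def distrib_left sum.distrib fun_eq_iff)

lemma comb_mult: "comb r g (\<lambda>q. a * f q) = (\<lambda>p. a * comb r g f p)"
  by (auto simp: comb_def sum_distrib_left mult.left_commute fun_eq_iff)

lemma comb_in_submod:
  assumes M: "submod V M" and g: "\<And>q. q < r \<Longrightarrow> g q \<in> M" and f: "f \<in> free_mod V r"
  shows "comb r g f \<in> M"
proof -
  have "(\<Sum>q\<in>{..<r}. (\<lambda>p. f q * g q p)) \<in> M"
  proof (rule submod_sum[OF M])
    fix q assume "q \<in> {..<r}"
    then show "(\<lambda>p. f q * g q p) \<in> M"
      using M g free_modD(3)[OF f, of q] unfolding submod_def by blast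
  qed
  also have "(\<Sum>q\<in>{..<r}. (\<lambda>p. f q * g q p)) = comb r g f"
    by (rule ext) (simp add: sum_fun_apply comb_def mult.commute)
  finally show ?thesis .
qed

lemma submod_free_mod: "submod V (free_mod V r)"
  unfolding submod_def
proof (intro conjI ballI)
  fix f g :: "nat \<Rightarrow> ('a, 'b) mpoly" assume f: "f \<in> free_mod V r" and g: "g \<in> free_mod V r"
  show "f + g \<in> free_mod V r"
    using carrier_closed(1)[OF free_modD(3)[OF f] free_modD(3)[OF g]] free_modD(2)[OF f] free_modD(2)[OF g]
    by (intro free_modI) auto
next
  fix a :: "('a, 'b) mpoly" and f :: "nat \<Rightarrow> ('a, 'b) mpoly" assume a: "a \<in> carrier (mpoly_ring V)" and f: "f \<in> free_mod V r"
  show "(\<lambda>p. a * f p) \<in> free_mod V r"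
    using carrier_closed(2)[OF a free_modD(3)[OF f]] free_modD(2)[OF f] by (intro free_modI) auto
qed (auto simp: free_mod_def)

lemma submod_comb_image: "submod V (comb r g ` free_mod V r)"
  unfolding submod_def
proof (intro conjI ballI)
  note S = submodD[OF submod_free_mod[of V r]]
  show "0 \<in> comb r g ` free_mod V r"
    by (rule image_eqI[where x = 0]) (simp_all add: S(1) additive.zero[OF additive_comb])
  fix x assume "x \<in> comb r g ` free_mod V r"
  then obtain f where f: "f \<in> free_mod V r" "x = comb r g f" by blast
  { fix y assume "y \<in> comb r g ` free_mod V r"
    then obtain h where h: "h \<in> free_mod V r" "y = comb r g h" by blast
    then have "x + y = comb r g (f + h)" using f by (simp add: additive.add[OF additive_comb])
    then show "x + y \<in> comb r g ` free_mod V r"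
      by (rule image_eqI[where x = "f + h"]) (rule S(2)[OF f(1) h(1)]) }
  { fix a :: "('a, 'b) mpoly" assume "a \<in> carrier (mpoly_ring V)"
    from S(3)[OF this f(1)] show "(\<lambda>p. a * x p) \<in> comb r g ` free_mod V r"
      by (intro image_eqI[where x = "\<lambda>q. a * f q"]) (simp add: f(2) comb_mult) }
qed

lemma comb_unit:
  "q < r \<Longrightarrow> comb r g (\<lambda>i. if i = q then 1 else 0) = g q"
  by (simp add: comb_def if_distrib[of "\<lambda>x. _ * x"] cong: if_cong)

text \<open>In a generating set of minimal cardinality a unit coefficient in a relation would make the
  corresponding generator redundant.\<close>

lemma minimal_generators:
  fixes N :: "(nat \<Rightarrow> ('v::linorder, 'k::field) mpoly) set"
  assumes V: "finite V" and N: "graded_submod V r s N"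
    and ex: "\<And>d. d > D \<Longrightarrow> koszul_exact V mul_indet_fun (\<lambda>d. N \<inter> free_piece V r s d) 0 d"
  obtains r' s' g where "\<And>q. q < r' \<Longrightarrow> g q \<in> N \<inter> free_piece V r s (int (s' q))"
    "N = comb r' g ` free_mod V r'"
    "\<And>d f q. f \<in> free_piece V r' s' d \<Longrightarrow> comb r' g f = 0 \<Longrightarrow> lookup (f q) 0 = 0"
proof -
  define P where "P = (\<lambda>G. finite G \<and> (\<forall>g\<in>G. \<exists>d::nat. g \<in> N \<inter> free_piece V r s (int d)) \<and>
    (\<forall>M. submod V M \<longrightarrow> G \<subseteq> M \<longrightarrow> N \<subseteq> M))"
  have "\<exists>G. P G" using finite_homogeneous_generators[OF V N ex] unfolding P_def by metis
  then obtain G where G: "P G" and Gmin: "\<And>G'. P G' \<Longrightarrow> card G \<le> card G'"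
    using ex_has_least_nat[of P _ card] by blast
  have finG: "finite G" and gen: "\<And>M. submod V M \<Longrightarrow> G \<subseteq> M \<Longrightarrow> N \<subseteq> M"
    and hom: "\<And>g. g \<in> G \<Longrightarrow> \<exists>d::nat. g \<in> N \<inter> free_piece V r s (int d)"
    using G unfolding P_def by blast+
  define r' where "r' = card G"
  obtain g where g: "bij_betw g {0..<r'} G" using ex_bij_betw_nat_finite[OF finG] unfolding r'_def by blast
  then have gG: "g ` {..<r'} = G" and inj: "inj_on g {..<r'}"
    by (auto simp: bij_betw_def lessThan_atLeast0)
  obtain s' where s': "\<And>q. q < r' \<Longrightarrow> g q \<in> N \<inter> free_piece V r s (int (s' q))"
  proof -
    have "\<forall>q. \<exists>d::nat. q < r' \<longrightarrow> g q \<in> N \<inter> free_piece V r s (int d)" using hom gG by blast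
    then show thesis using that by metis
  qed
  have subN: "submod V N" using N by (simp add: graded_submod_def)
  show thesis
  proof (rule that[OF s'])
    show "N = comb r' g ` free_mod V r'"
    proof
      have "g q \<in> comb r' g ` free_mod V r'" if "q < r'" for q
      proof -
        have "(\<lambda>i. if i = q then 1 else 0) \<in> free_mod V r'" using that by (auto simp: free_mod_def)
        then show ?thesis using comb_unit[OF that, of g] by (metis image_eqI)
      qed
      then show "N \<subseteq> comb r' g ` free_mod V r'" using gG by (intro gen submod_comb_image) auto
      show "comb r' g ` free_mod V r' \<subseteq> N" using comb_in_submod[OF subN] s' by blast
    qed
    fix d f q0 assume f: "f \<in> free_piece V r' s' d" "comb r' g f = 0"
    show "lookup (f q0) 0 = 0"
    proof (rule ccontr)
      assume nz: "lookup (f q0) 0 \<noteq> 0"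
      then have q0: "q0 < r'" using free_pieceD(2)[OF f(1), of q0] by fastforce
      define c where "c = lookup (f q0) 0"
      \<comment> \<open>The coordinate is homogeneous, so a nonzero constant term forces it to be
        constant.\<close>
      have "f q0 = single 0 c"
      proof (rule poly_mapping_eqI)
        fix m
        have p: "\<And>m. m \<in> keys (f q0) \<Longrightarrow> int (mdeg m) = d - int (s' q0)"
          using free_pieceD(1)[OF f(1) q0] by (simp add: mono_piece_def)
        have "d - int (s' q0) = 0" using p[of 0] nz by (simp add: in_keys_iff)
        then have "m \<noteq> 0 \<Longrightarrow> lookup (f q0) m = 0"
          using p[of m] by (auto simp: in_keys_iff mdeg_eq_0_iff)
        then show "lookup (f q0) m = lookup (single 0 c) m"
          by (auto simp: c_def lookup_single when_def)
      qed
      have "P (G - {g q0})"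
        unfolding P_def
      proof (intro conjI allI impI ballI)
        fix M assume M: "submod V M" "G - {g q0} \<subseteq> M"
        \<comment> \<open>The relation solved for the generator \<open>g q0\<close>: its
          coefficients are divided by \<open>- c\<close>, and the coordinate \<open>q0\<close> is
          removed.\<close>
        define h where "h = (\<lambda>q. if q = q0 then 0 else single 0 (- 1 / c) * f q)"
        define g' where "g' = (\<lambda>q. if q = q0 then 0 else g q)"
        have h: "h \<in> free_mod V r'"
          using carrier_closed(2)[OF constant_in_carrier free_modD(3)[OF free_piece_subset[OF f(1)]]]
            free_modD(2)[OF free_piece_subset[OF f(1)]]
          by (intro free_modI) (auto simp: h_def)
        have "g' q \<in> M" if "q < r'" for q
        proof (cases "q = q0")
          case True
          then show ?thesis using M(1) by (simp add: g'_def submod_def)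
        next
          case False
          then have "g q \<in> G - {g q0}" using that q0 inj gG by (auto simp: inj_on_def)
          then show ?thesis using M(2) False by (auto simp: g'_def)
        qed
        then have "comb r' g' h \<in> M" using comb_in_submod[OF M(1) _ h] by blast
        also have "comb r' g' h = g q0"
        proof
          fix p
          have "0 = (\<Sum>q<r'. g q p * f q)" using fun_cong[OF f(2), of p] by (simp add: comb_def)
          also have "\<dots> = g q0 p * single 0 c + (\<Sum>q\<in>{..<r'} - {q0}. g q p * f q)"
            using q0 \<open>f q0 = single 0 c\<close> by (simp add: sum.remove)
          finally have "(\<Sum>q\<in>{..<r'} - {q0}. g q p * f q) = - (g q0 p * single 0 c)"
            by (simp add: eq_neg_iff_add_eq_0 add.commute)
          then have "single 0 (- 1 / c) * (\<Sum>q\<in>{..<r'} - {q0}. g q p * f q) =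
              - (g q0 p * (single 0 c * single 0 (- 1 / c)))"
            by (simp add: mult_ac)
          also have "\<dots> = g q0 p"
            using nz by (simp add: mult_single c_def single_uminus)
          finally have "(\<Sum>q\<in>{..<r'} - {q0}. g q p * h q) = g q0 p"
            by (simp add: h_def sum_distrib_left mult.left_commute)
          moreover have "comb r' g' h p = (\<Sum>q\<in>{..<r'} - {q0}. g q p * h q)"
            unfolding comb_def using q0
            by (subst sum.remove[of _ q0]) (auto simp: g'_def intro!: sum.cong)
          ultimately show "comb r' g' h p = g q0 p" by simp
        qed
        finally have "G \<subseteq> M" using M(2) by blast
        then show "N \<subseteq> M" by (rule gen[OF M(1)])
      qed (use finG hom in auto)
      moreover have "g q0 \<in> G" using q0 gG by blast
      ultimately show False using Gmin[of "G - {g q0}"] finG card_gt_0_iff[of G] by fastforce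
    qed
  qed
qed

text \<open>The bound is uniform in \<open>p\<close>, because passing to syzygies moves
  \<open>p\<close>.\<close>

definition koszul_bounded :: "'v::linorder set \<Rightarrow> nat \<Rightarrow> (nat \<Rightarrow> nat) \<Rightarrow> (nat \<Rightarrow> ('v, 'k::field) mpoly) set \<Rightarrow> bool" where
  "koszul_bounded V r s N \<longleftrightarrow>
     (\<exists>D. \<forall>p d. d > D \<longrightarrow> koszul_exact V mul_indet_fun (\<lambda>d. N \<inter> free_piece V r s d) p d)"

text \<open>The inductive step: cover \<open>N\<close> minimally and return the kernel with the same
  invariants. A bound \<open>D\<close> for \<open>N\<close> becomes \<open>D + 1\<close> for the
  kernel, as dimension shifting raises the coefficient degree by one.\<close>

lemma minimal_cover_step:
  fixes N :: "(nat \<Rightarrow> ('v::linorder, 'k::field) mpoly) set"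
  assumes V: "finite V" and N: "graded_submod V r s N" and bd: "koszul_bounded V r s N"
  obtains r' s' g where "\<And>q. q < r' \<Longrightarrow> g q \<in> N \<inter> free_piece V r s (int (s' q))"
    "N = comb r' g ` free_mod V r'"
    "\<And>f q. f \<in> free_mod V r' \<Longrightarrow> comb r' g f = 0 \<Longrightarrow> lookup (f q) 0 = 0"
    "graded_submod V r' s' {f \<in> free_mod V r'. comb r' g f = 0}"
    "koszul_bounded V r' s' {f \<in> free_mod V r'. comb r' g f = 0}"
proof -
  obtain D where D: "\<And>p d. d > D \<Longrightarrow> koszul_exact V mul_indet_fun (\<lambda>d. N \<inter> free_piece V r s d) p d"
    using bd unfolding koszul_bounded_def by blast
  obtain r' s' g where cols: "\<And>q. q < r' \<Longrightarrow> g q \<in> N \<inter> free_piece V r s (int (s' q))"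
    and img: "N = comb r' g ` free_mod V r'"
    and const: "\<And>d f q. f \<in> free_piece V r' s' d \<Longrightarrow> comb r' g f = 0 \<Longrightarrow> lookup (f q) 0 = 0"
    using minimal_generators[OF V N D] by metis
  let ?Z = "{f \<in> free_mod V r'. comb r' g f = 0}"
  have hp: "free_hpart r s d (comb r' g f) = comb r' g (free_hpart r' s' d f)" for d f
  proof
    fix p
    have col: "q < r' \<Longrightarrow> g q \<in> free_piece V r s (int (s' q))" for q using cols by blast
    show "free_hpart r s d (comb r' g f) p = comb r' g (free_hpart r' s' d f) p"
    proof (cases "p < r")
      case True
      have "int (mdeg m) = int (s' q) - int (s p)" if "q < r'" "m \<in> keys (g q p)" for q m
        using free_pieceD(1)[OF col[OF that(1)] True] that(2) by (simp add: mono_piece_def)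
      then show ?thesis
        using hpart_matrix_row[where D = "\<lambda>q. g q p" and e = "int (s p)" and r' = r' and s' = s' and d = d and f = f] True
        by (simp add: free_hpart_def[of r] comb_def)
    next
      case False
      then have "q < r' \<Longrightarrow> g q p = 0" for q using free_pieceD(2)[OF col] by blast
      then show ?thesis using False by (simp add: free_hpart_def[of r] comb_def)
    qed
  qed
  have Nf: "N \<subseteq> free_mod V r" using N by (simp add: graded_submod_def)
  have pieces: "N \<inter> free_piece V r s d = comb r' g ` free_piece V r' s' d" for d
  proof
    show "N \<inter> free_piece V r s d \<subseteq> comb r' g ` free_piece V r' s' d"
    proof
      fix f assume f: "f \<in> N \<inter> free_piece V r s d"
      then obtain w where w: "w \<in> free_mod V r'" "f = comb r' g w" using img by auto
      have "free_hpart r s d f = f" using f by (intro free_hpart_id) blast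
      then have "f = comb r' g (free_hpart r' s' d w)" using hp[of d w] w(2) by simp
      then show "f \<in> comb r' g ` free_piece V r' s' d"
        using free_hpart_in_free_piece[OF w(1)] by blast
    qed
    show "comb r' g ` free_piece V r' s' d \<subseteq> N \<inter> free_piece V r s d"
    proof (rule image_subsetI)
      fix f :: "nat \<Rightarrow> ('v, 'k) mpoly" assume f: "f \<in> free_piece V r' s' d"
      have 1: "comb r' g f \<in> N" unfolding img by (rule imageI) (rule free_piece_subset[OF f])
      have "free_hpart r s d (comb r' g f) = comb r' g f" by (simp add: hp free_hpart_id[OF f])
      moreover have "free_hpart r s d (comb r' g f) \<in> free_piece V r s d"
        using 1 Nf by (intro free_hpart_in_free_piece) (rule subsetD)
      ultimately show "comb r' g f \<in> N \<inter> free_piece V r s d" using 1 by simp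
    qed
  qed
  have Zpiece: "?Z \<inter> free_piece V r' s' d = {f \<in> free_piece V r' s' d. comb r' g f = 0}" for d
    using free_piece_subset by auto
  have cover: "minimal_cover V r' s' (comb r' g) mul_indet_fun (\<lambda>d. N \<inter> free_piece V r s d)"
    unfolding minimal_cover_def
    by (intro conjI allI ballI impI additive_comb comb_mult pieces) (rule const)
  have S: "submod V ?Z"
    unfolding submod_def
  proof (intro conjI ballI)
    note F = submodD[OF submod_free_mod[of V r']]
    show "0 \<in> ?Z" by (simp add: F(1) additive.zero[OF additive_comb])
    fix f assume f: "f \<in> ?Z"
    { fix h assume "h \<in> ?Z"
      with f show "f + h \<in> ?Z" by (simp add: F(2) additive.add[OF additive_comb] del: plus_fun_apply) }
    { fix a :: "('v, 'k) mpoly" assume "a \<in> carrier (mpoly_ring V)"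
      moreover have "f \<in> free_mod V r'" "comb r' g f = 0" using f by auto
      ultimately show "(\<lambda>p. a * f p) \<in> ?Z"
        using submodD(3)[OF submod_free_mod, of a V f r'] by (simp add: comb_mult zero_fun_def del: mpoly_ring_simps) }
  qed
  have hZ: "free_hpart r' s' d f \<in> ?Z" if "f \<in> ?Z" for f d
  proof -
    have "free_hpart r s d (0 :: nat \<Rightarrow> ('v, 'k) mpoly) = 0" by (auto simp: free_hpart_def fun_eq_iff)
    then show ?thesis
      using that free_piece_subset[OF free_hpart_in_free_piece] hp[of d f] by auto
  qed
  show thesis
  proof (rule that[OF cols img])
    fix f q assume f: "f \<in> free_mod V r'" "comb r' g f = 0"
    show "lookup (f q) 0 = 0"
    proof (cases "q < r'")
      case True
      \<comment> \<open>Minimality is known for homogeneous relations. The constant term of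
        coordinate \<open>q\<close> sits in the component of degree \<open>s' q\<close>, which is
        again a relation.\<close>
      have "free_hpart r' s' (int (s' q)) f \<in> ?Z" using hZ f by blast
      then have "lookup (free_hpart r' s' (int (s' q)) f q) 0 = 0"
        using const free_hpart_in_free_piece[OF f(1)] by blast
      then show ?thesis using True by (simp add: free_hpart_def lookup_hpart)
    qed (use free_modD(2)[OF f(1)] in simp)
  next
    show "graded_submod V r' s' ?Z" using S hZ by (auto simp: graded_submod_def)
    have "koszul_exact V mul_indet_fun (\<lambda>d. ?Z \<inter> free_piece V r' s' d) p d" if "d > D + 1" for p d
      unfolding Zpiece
      using koszul_exact_Suc_minimal_cover[OF V commuting_actions_mul_indet_fun cover, of p "d - 1"] D[of "d - 1" "Suc p"] that
      by simp
    then show "koszul_bounded V r' s' ?Z" unfolding koszul_bounded_def by blast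
  qed
qed

section \<open>Assembling the resolution\<close>

text \<open>Places \<open>J\<close> inside \<open>R^1\<close>, so that the recursion meets only
  submodules of free modules.\<close>

definition single_coord :: "'a::zero \<Rightarrow> nat \<Rightarrow> 'a" where
  "single_coord p = (\<lambda>q. if q = 0 then p else 0)"

definition graded_ideal :: "'v set \<Rightarrow> ('v, 'k::field) mpoly set \<Rightarrow> bool" where
  "graded_ideal V J \<longleftrightarrow> J \<subseteq> carrier (mpoly_ring V) \<and> 0 \<in> J \<and> (\<forall>p\<in>J. \<forall>q\<in>J. p + q \<in> J) \<and>
     (\<forall>a\<in>carrier (mpoly_ring V). \<forall>p\<in>J. a * p \<in> J) \<and> (\<forall>p\<in>J. \<forall>d. hpart d p \<in> J)"

lemma graded_submod_single_coord:
  assumes "graded_ideal V J"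
  shows "graded_submod V 1 (\<lambda>_. 0) (single_coord ` J)"
  unfolding graded_submod_def submod_def
proof (intro conjI ballI allI)
  note J = assms[unfolded graded_ideal_def]
  show "single_coord ` J \<subseteq> free_mod V 1"
    using J by (auto simp: single_coord_def intro!: free_modI simp del: mpoly_ring_simps split: if_splits)
  show "0 \<in> single_coord ` J" using J by (auto simp: single_coord_def image_iff fun_eq_iff intro: bexI[of _ 0])
  fix f assume "f \<in> single_coord ` J"
  then obtain p where p: "p \<in> J" "f = single_coord p" by blast
  { fix g assume "g \<in> single_coord ` J"
    then obtain q where q: "q \<in> J" "g = single_coord q" by blast
    show "f + g \<in> single_coord ` J"
      using p q J by (intro image_eqI[where x = "p + q"]) (auto simp: single_coord_def) }
  { fix a :: "('a, 'b) mpoly" assume "a \<in> carrier (mpoly_ring V)"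
    then show "(\<lambda>p. a * f p) \<in> single_coord ` J"
      using p J by (intro image_eqI[where x = "a * p"]) (auto simp: single_coord_def simp del: mpoly_ring_simps) }
  { fix d show "free_hpart 1 (\<lambda>_. 0) d f \<in> single_coord ` J"
      using p J by (intro image_eqI[where x = "hpart d p"]) (auto simp: single_coord_def free_hpart_def) }
qed

lemma koszul_exact_single_coord:
  fixes J :: "('v::linorder, 'k::field) mpoly set"
  assumes J: "J \<subseteq> carrier (mpoly_ring V)" and ex: "koszul_exact V mul_indet (homogeneous_part J) p d"
  shows "koszul_exact V mul_indet_fun (\<lambda>d. single_coord ` J \<inter> free_piece V 1 (\<lambda>_. 0) d) p d"
  unfolding koszul_exact_def
proof (intro ballI impI)
  fix c assume c: "c \<in> koszul_chains V p (single_coord ` J \<inter> free_piece V 1 (\<lambda>_. 0) d)"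
    and c0: "koszul_bd V mul_indet_fun c = 0"
  have comp1: "koszul_bd V mul_indet (\<lambda>\<sigma>. c \<sigma> 0) = (\<lambda>\<tau>. koszul_bd V mul_indet_fun c \<tau> 0)"
    by (rule koszul_bd_comp[where \<phi> = "\<lambda>f. f 0" and X = mul_indet_fun]) (simp_all add: additive_def)
  have comp2: "koszul_bd V mul_indet_fun (\<lambda>\<sigma>. single_coord (b \<sigma>)) = (\<lambda>\<tau>. single_coord (koszul_bd V mul_indet b \<tau>))"
    for b :: "'v set \<Rightarrow> ('v, 'k) mpoly"
    by (rule koszul_bd_comp[where \<phi> = single_coord and X = mul_indet]) (auto simp: additive_def single_coord_def)
  have cs: "single_coord (c \<sigma> 0) = c \<sigma>" "c \<sigma> 0 \<in> J" "c \<sigma> \<in> free_piece V 1 (\<lambda>_. 0) d" for \<sigma>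
  proof -
    have "c \<sigma> \<in> single_coord ` J" and 1: "c \<sigma> \<in> free_piece V 1 (\<lambda>_. 0) d"
      using c by (auto simp: koszul_chains_def)
    then obtain a where a: "a \<in> J" "c \<sigma> = single_coord a" by blast
    show "single_coord (c \<sigma> 0) = c \<sigma>" "c \<sigma> 0 \<in> J" using a by (simp_all add: single_coord_def)
    show "c \<sigma> \<in> free_piece V 1 (\<lambda>_. 0) d" by (rule 1)
  qed
  have "(\<lambda>\<sigma>. c \<sigma> 0) \<in> koszul_chains V p (homogeneous_part J d)"
    unfolding koszul_chains_def
  proof (intro CollectI allI conjI impI ballI)
    fix \<sigma>
    show "c \<sigma> 0 \<in> J" by (rule cs(2))
    show "int (mdeg m) = d" if "m \<in> keys (c \<sigma> 0)" for m
      using free_pieceD(1)[OF cs(3), of 0 \<sigma>] that by (simp add: mono_piece_def)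
    assume "c \<sigma> 0 \<noteq> 0"
    then have "c \<sigma> \<noteq> 0" by auto
    then show "\<sigma> \<subseteq> V" "card \<sigma> = p" using c by (auto simp: koszul_chains_def)
  qed
  moreover have "koszul_bd V mul_indet (\<lambda>\<sigma>. c \<sigma> 0) = 0" unfolding comp1 c0 by (rule ext) simp
  ultimately obtain b where b: "b \<in> koszul_chains V (Suc p) (homogeneous_part J (d - 1))"
      "koszul_bd V mul_indet b = (\<lambda>\<sigma>. c \<sigma> 0)"
    by (rule koszul_exactE[OF ex])
  have "(\<lambda>\<sigma>. single_coord (b \<sigma>)) \<in> koszul_chains V (Suc p) (single_coord ` J \<inter> free_piece V 1 (\<lambda>_. 0) (d - 1))"
    unfolding koszul_chains_def
  proof (intro CollectI allI conjI impI IntI)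
    fix \<sigma>
    have bs: "b \<sigma> \<in> homogeneous_part J (d - 1)" using b(1) by (auto simp: koszul_chains_def)
    then show "single_coord (b \<sigma>) \<in> single_coord ` J" by blast
    show "single_coord (b \<sigma>) \<in> free_piece V 1 (\<lambda>_. 0) (d - 1)"
      using bs subsetD[OF J, of "b \<sigma>"] by (auto simp: free_piece_def single_coord_def mono_piece_def)
    assume "single_coord (b \<sigma>) \<noteq> 0"
    then have "b \<sigma> \<noteq> 0" by (auto simp: single_coord_def)
    then show "\<sigma> \<subseteq> V" "card \<sigma> = Suc p" using b(1) by (auto simp: koszul_chains_def)
  qed
  moreover have "koszul_bd V mul_indet_fun (\<lambda>\<sigma>. single_coord (b \<sigma>)) = c"
    unfolding comp2 b(2) by (rule ext) (rule cs(1))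
  ultimately show "\<exists>b\<in>koszul_chains V (Suc p) (single_coord ` J \<inter> free_piece V 1 (\<lambda>_. 0) (d - 1)).
      koszul_bd V mul_indet_fun b = c" by blast
qed

theorem minimal_resolution_exists:
  fixes J :: "('v::linorder, 'k::field) mpoly set"
  assumes V: "finite V" and J: "graded_ideal V J"
    and bounded: "\<And>p d. d > D \<Longrightarrow> koszul_exact V mul_indet (homogeneous_part J) p d"
  shows "\<exists>F. minimal_graded_free_resolution V J F"
proof -
  note [simp del] = mpoly_ring_simps
  have Jc: "J \<subseteq> carrier (mpoly_ring V)" using J by (simp add: graded_ideal_def)
  \<comment> \<open>A stage consists of a free module with its shifts, the submodule to be covered
    next, and the matrix from this free module to the previous one. Stage 0 is \<open>J\<close> in
    \<open>R^1\<close>; constant terms are restricted only later, since \<open>J\<close> itself may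
    contain units.\<close>
  define P where "P = (\<lambda>n (r, s, N, g :: nat \<Rightarrow> nat \<Rightarrow> ('v, 'k) mpoly).
    graded_submod V r s N \<and> koszul_bounded V r s N \<and>
    (n = (0::nat) \<longrightarrow> r = 1 \<and> s = (\<lambda>_. 0) \<and> N = single_coord ` J) \<and>
    (n > 0 \<longrightarrow> (\<forall>f\<in>N. \<forall>q. lookup (f q) 0 = 0)))"
  define Q where "Q = (\<lambda>(n::nat) (r, s, N, g :: nat \<Rightarrow> nat \<Rightarrow> ('v, 'k) mpoly) (r', s', N', g' :: nat \<Rightarrow> nat \<Rightarrow> ('v, 'k) mpoly).
    (\<forall>q<r'. g' q \<in> N \<inter> free_piece V r s (int (s' q))) \<and> N = comb r' g' ` free_mod V r' \<and>
    N' = {f \<in> free_mod V r'. comb r' g' f = 0})"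
  have "\<exists>st. \<forall>n. P n (st n) \<and> Q n (st n) (st (Suc n))"
  proof (rule dependent_nat_choice)
    have "koszul_bounded V 1 (\<lambda>_. 0) (single_coord ` J)"
      unfolding koszul_bounded_def using koszul_exact_single_coord[OF Jc bounded] by blast
    then have "P 0 (1, \<lambda>_. 0, single_coord ` J, undefined)"
      using graded_submod_single_coord[OF J] by (simp add: P_def)
    then show "\<exists>x. P 0 x" by blast
  next
    fix x n assume Px: "P n x"
    obtain r s N g where x: "x = (r, s, N, g)" by (cases x)
    have "graded_submod V r s N" "koszul_bounded V r s N" using Px by (simp_all add: P_def x)
    then obtain r' s' g' where c: "\<And>q. q < r' \<Longrightarrow> g' q \<in> N \<inter> free_piece V r s (int (s' q))"
      "N = comb r' g' ` free_mod V r'"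
      "\<And>f q. f \<in> free_mod V r' \<Longrightarrow> comb r' g' f = 0 \<Longrightarrow> lookup (f q) 0 = 0"
      "graded_submod V r' s' {f \<in> free_mod V r'. comb r' g' f = 0}"
      "koszul_bounded V r' s' {f \<in> free_mod V r'. comb r' g' f = 0}"
      by (rule minimal_cover_step[OF V]) blast
    have "P (Suc n) (r', s', {f \<in> free_mod V r'. comb r' g' f = 0}, g')" using c(3,4,5) by (simp add: P_def)
    moreover have "Q n x (r', s', {f \<in> free_mod V r'. comb r' g' f = 0}, g')"
      using c(1,2) by (simp add: Q_def x)
    ultimately show "\<exists>y. P (Suc n) y \<and> Q n x y" by blast
  qed
  then obtain st where st: "\<And>n. P n (st n)" "\<And>n. Q n (st n) (st (Suc n))" by blast
  define R where "R = (\<lambda>n. fst (st n))"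
  define S where "S = (\<lambda>n. fst (snd (st n)))"
  define N where "N = (\<lambda>n. fst (snd (snd (st n))))"
  define g where "g = (\<lambda>n. snd (snd (snd (st n))))"
  have st_eq: "st n = (R n, S n, N n, g n)" for n by (simp add: R_def S_def N_def g_def)
  have init: "R 0 = 1" "S 0 = (\<lambda>_. 0)" "N 0 = single_coord ` J"
    using st(1)[of 0] by (simp_all add: st_eq P_def)
  have const: "f \<in> N (Suc n) \<Longrightarrow> lookup (f q) 0 = 0" for f n q
    using st(1)[of "Suc n"] by (simp add: st_eq P_def)
  have cols: "g (Suc n) q \<in> N n" "g (Suc n) q \<in> free_piece V (R n) (S n) (int (S (Suc n) q))"
    if "q < R (Suc n)" for n q
    using st(2)[of n] that by (auto simp: st_eq Q_def)
  have img: "N n = comb (R (Suc n)) (g (Suc n)) ` free_mod V (R (Suc n))" for n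
    using st(2)[of n] by (simp add: st_eq Q_def)
  have ker: "N (Suc n) = {f \<in> free_mod V (R (Suc n)). comb (R (Suc n)) (g (Suc n)) f = 0}" for n
    using st(2)[of n] by (simp add: st_eq Q_def)
  \<comment> \<open>The ambient \<open>R^1\<close> of stage 0 does not belong to the resolution,
    hence the offset by one; the augmentation is coordinate 0 of the first matrix.\<close>
  define F where "F = \<lparr>res_rank = \<lambda>i. R (Suc i), res_shift = \<lambda>i. S (Suc i), res_aug = \<lambda>q. g 1 q 0,
    res_diff = \<lambda>i p q. g (Suc (Suc i)) q p\<rparr>"
  have F: "res_rank F i = R (Suc i)" "res_shift F i = S (Suc i)" "res_aug F q = g 1 q 0"
    "res_diff F i p q = g (Suc (Suc i)) q p" for i p q by (simp_all add: F_def)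
  have aug: "comb (R 1) (g 1) f = single_coord (aug_map F f)" for f
  proof
    fix p
    have "g 1 q p = 0" if "q < R 1" "p \<noteq> 0" for q
      using cols(1)[of q 0] that init(3) by (auto simp: single_coord_def)
    then show "comb (R 1) (g 1) f p = single_coord (aug_map F f) p"
      by (auto simp: comb_def single_coord_def aug_map_def F)
  qed
  have diff: "comb (R (Suc (Suc i))) (g (Suc (Suc i))) f = diff_map F i f" for f i
  proof
    fix p
    have "g (Suc (Suc i)) q p = 0" if "q < R (Suc (Suc i))" "\<not> p < R (Suc i)" for q
      using free_pieceD(2)[OF cols(2)[OF that(1)] that(2)] .
    then show "comb (R (Suc (Suc i))) (g (Suc (Suc i))) f p = diff_map F i f p"
      by (auto simp: comb_def diff_map_def F)
  qed
  have inj: "single_coord p = single_coord q \<longleftrightarrow> p = q" for p q :: "('v, 'k) mpoly"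
    by (auto simp: single_coord_def fun_eq_iff)
  have sc0: "single_coord p = 0 \<longleftrightarrow> p = 0" for p :: "('v, 'k) mpoly"
    by (auto simp: single_coord_def fun_eq_iff)
  have "graded_free_resolution V J F"
    unfolding graded_free_resolution_def
  proof (intro conjI allI impI ballI)
    fix q assume q: "q < res_rank F 0"
    have "g 1 q \<in> free_piece V 1 (\<lambda>_. 0) (int (S 1 q))" using cols(2)[of q 0] q by (simp add: F init)
    then have "g 1 q 0 \<in> ring_piece V (int (S 1 q))" using free_pieceD(1)[of "g 1 q" V 1 _ _ 0] by fastforce
    then show "res_aug F q \<in> carrier (mpoly_ring V)" "homogeneous (res_shift F 0 q) (res_aug F q)"
      by (auto simp: F homogeneous_def mono_piece_def mpoly_ring_simps(1))
  next
    fix i p q assume p: "p < res_rank F i" and q: "q < res_rank F (i + 1)"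
    have "g (Suc (Suc i)) q p \<in> ring_piece V (int (S (Suc (Suc i)) q) - int (S (Suc i) p))"
      using free_pieceD(1)[OF cols(2)] p q by (simp add: F)
    then show "res_diff F i p q \<in> carrier (mpoly_ring V)"
      and "\<And>m. m \<in> keys (res_diff F i p q) \<Longrightarrow> mdeg m + res_shift F i p = res_shift F (i + 1) q"
      by (auto simp: F mono_piece_def mpoly_ring_simps(1))
  next
    have "single_coord ` (aug_map F ` free_mod V (res_rank F 0)) = single_coord ` J"
      using img[of 0] by (simp add: F init image_image aug[unfolded One_nat_def])
    then show "aug_map F ` free_mod V (res_rank F 0) = J"
      by (simp add: inj_image_eq_iff inj_def inj)
    have "N 1 = {f \<in> free_mod V (R 1). aug_map F f = 0}"
      using ker[of 0] by (simp add: aug[unfolded One_nat_def] sc0)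
    then show "{v \<in> free_mod V (res_rank F 0). aug_map F v = 0} = diff_map F 0 ` free_mod V (res_rank F 1)"
      using img[of 1] by (simp add: F diff)
  next
    fix i
    show "{v \<in> free_mod V (res_rank F (i + 1)). diff_map F i v = (\<lambda>p. 0)} =
         diff_map F (i + 1) ` free_mod V (res_rank F (i + 2))"
      using img[of "Suc (Suc i)"] ker[of "Suc i"] by (simp add: F diff zero_fun_def)
  qed
  moreover have "lookup (res_diff F i p q) 0 = 0" if "q < res_rank F (i + 1)" for i p q
    using const[OF cols(1)[of q "Suc i"]] that by (simp add: F)
  ultimately have "minimal_graded_free_resolution V J F"
    by (simp add: minimal_graded_free_resolution_def)
  then show ?thesis by blast
qed

section \<open>Monomial ideals and squarefree powers\<close>

definition mono_ideal :: "('v \<Rightarrow>\<^sub>0 nat) set \<Rightarrow> ('v, 'k::field) mpoly set" where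
  "mono_ideal A = {p. keys p \<subseteq> A}"

definition up_closed :: "'v set \<Rightarrow> ('v \<Rightarrow>\<^sub>0 nat) set \<Rightarrow> bool" where
  "up_closed V A \<longleftrightarrow> (\<forall>m\<in>A. keys m \<subseteq> V) \<and>
     (\<forall>m\<in>A. \<forall>m'. keys m' \<subseteq> V \<longrightarrow> m + m' \<in> A)"

lemma homogeneous_part_mono_ideal: "homogeneous_part (mono_ideal A) d = mono_piece A d"
  by (auto simp: mono_ideal_def mono_piece_def)

lemma mono_ideal_closed:
  fixes p q :: "('v, 'k::field) mpoly"
  shows "0 \<in> mono_ideal A" "p \<in> mono_ideal A \<Longrightarrow> q \<in> mono_ideal A \<Longrightarrow> p + q \<in> mono_ideal A"
    "p \<in> mono_ideal A \<Longrightarrow> - p \<in> mono_ideal A" "p \<in> mono_ideal A \<Longrightarrow> hpart d p \<in> mono_ideal A"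
  using Poly_Mapping.keys_add[of p q] by (auto simp: mono_ideal_def in_keys_iff lookup_hpart split: if_splits)

lemma mono_ideal_mult:
  fixes a p :: "('v, 'k::field) mpoly"
  assumes "up_closed V A" "a \<in> carrier (mpoly_ring V)" "p \<in> mono_ideal A"
  shows "a * p \<in> mono_ideal A"
  unfolding mono_ideal_def
proof (intro CollectI subsetI)
  fix m assume "m \<in> keys (a * p)"
  then obtain x y where "x \<in> keys a" "y \<in> keys p" "m = x + y"
    using Poly_Mapping.keys_mult[of a p] by blast
  moreover from this have "y \<in> A" "keys x \<subseteq> V" using assms(2,3) by (auto simp: mono_ideal_def)
  ultimately show "m \<in> A" using assms(1) by (auto simp: up_closed_def add.commute)
qed

lemma mono_ideal_subset_carrier: "up_closed V A \<Longrightarrow> p \<in> mono_ideal A \<Longrightarrow> p \<in> carrier (mpoly_ring V)"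
  by (auto simp: mono_ideal_def up_closed_def)

lemma graded_ideal_mono_ideal: "up_closed V A \<Longrightarrow> graded_ideal V (mono_ideal A)"
  unfolding graded_ideal_def
  by (auto simp del: mpoly_ring_simps intro: mono_ideal_closed mono_ideal_mult mono_ideal_subset_carrier)

lemma ideal_mono_ideal:
  assumes A: "up_closed V A"
  shows "ideal (mono_ideal A) (mpoly_ring V :: ('v, 'k::field) mpoly ring)"
proof -
  interpret cring "mpoly_ring V :: ('v, 'k::field) mpoly ring" by (rule cring_mpoly_ring)
  note [simp del] = mpoly_ring_simps(1)
  show ?thesis
  proof (rule idealI[OF ring_axioms])
    show "subgroup (mono_ideal A) (add_monoid (mpoly_ring V :: ('v, 'k) mpoly ring))"
    proof (rule add.subgroupI)
      show "mono_ideal A \<subseteq> carrier (mpoly_ring V :: ('v, 'k) mpoly ring)"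
        using mono_ideal_subset_carrier[OF A] by blast
      show "mono_ideal A \<noteq> ({} :: ('v, 'k) mpoly set)" using mono_ideal_closed(1) by blast
      fix a b :: "('v, 'k) mpoly" assume a: "a \<in> mono_ideal A"
      have "\<ominus>\<^bsub>mpoly_ring V\<^esub> a = - a"
        using mono_ideal_subset_carrier[OF A] a mono_ideal_closed(3)[OF a] by (intro minus_equality) auto
      then show "\<ominus>\<^bsub>mpoly_ring V\<^esub> a \<in> mono_ideal A" using mono_ideal_closed(3)[OF a] by simp
      assume "b \<in> mono_ideal A"
      then show "a \<oplus>\<^bsub>mpoly_ring V\<^esub> b \<in> mono_ideal A" using mono_ideal_closed(2)[OF a] by simp
    qed
    fix a x :: "('v, 'k) mpoly" assume a: "a \<in> mono_ideal A" and x: "x \<in> carrier (mpoly_ring V)"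
    show "x \<otimes>\<^bsub>mpoly_ring V\<^esub> a \<in> mono_ideal A" "a \<otimes>\<^bsub>mpoly_ring V\<^esub> x \<in> mono_ideal A"
      using mono_ideal_mult[OF A x a] by (simp_all add: mult.commute)
  qed
qed

definition multiples :: "'v set \<Rightarrow> ('v \<Rightarrow>\<^sub>0 nat) set \<Rightarrow> ('v \<Rightarrow>\<^sub>0 nat) set" where
  "multiples V B = {b + m |b m. b \<in> B \<and> keys m \<subseteq> V}"

lemma keys_add_nat: "keys (a + b) = keys a \<union> keys b"
  for a b :: "'v \<Rightarrow>\<^sub>0 nat"
  by (auto simp: in_keys_iff lookup_add)

lemma up_closed_multiples:
  assumes "\<And>b. b \<in> B \<Longrightarrow> keys b \<subseteq> V"
  shows "up_closed V (multiples V B)"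
  unfolding up_closed_def
proof (intro conjI ballI allI impI)
  fix x assume "x \<in> multiples V B"
  then obtain b m where x: "x = b + m" "b \<in> B" "keys m \<subseteq> V" by (auto simp: multiples_def)
  then show "keys x \<subseteq> V" using assms by (simp add: keys_add_nat)
  fix m' :: "'a \<Rightarrow>\<^sub>0 nat" assume "keys m' \<subseteq> V"
  then have "x + m' = b + (m + m')" "keys (m + m') \<subseteq> V"
    using x by (simp_all add: keys_add_nat add.assoc)
  then show "x + m' \<in> multiples V B" using x(2) by (auto simp: multiples_def)
qed

lemma additive_closed_contains:
  fixes p :: "('v, 'k::field) mpoly"
  assumes "0 \<in> I" "\<And>a b. a \<in> I \<Longrightarrow> b \<in> I \<Longrightarrow> a + b \<in> I"
    and "\<And>m. m \<in> keys p \<Longrightarrow> single m (lookup p m) \<in> I"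
  shows "p \<in> I"
proof -
  have "(\<Sum>m\<in>M. single m (lookup p m)) \<in> I" if "finite M" "M \<subseteq> keys p" for M
    using that by (induction M rule: finite_induct) (auto intro: assms)
  then show ?thesis by (subst poly_mapping_sum_single) simp
qed

lemma genideal_monomials:
  fixes B :: "('v \<Rightarrow>\<^sub>0 nat) set"
  assumes B: "\<And>b. b \<in> B \<Longrightarrow> keys b \<subseteq> V"
  shows "Idl\<^bsub>mpoly_ring V\<^esub> (monom_of ` B :: ('v, 'k::field) mpoly set) = mono_ideal (multiples V B)"
proof
  interpret cring "mpoly_ring V :: ('v, 'k::field) mpoly ring" by (rule cring_mpoly_ring)
  note [simp del] = mpoly_ring_simps(1)
  have BS: "monom_of ` B \<subseteq> carrier (mpoly_ring V :: ('v, 'k) mpoly ring)"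
    using B by (auto simp: monom_of_def mpoly_ring_simps(1))
  have "B \<subseteq> multiples V B" by (force simp: multiples_def)
  then have "monom_of ` B \<subseteq> (mono_ideal (multiples V B) :: ('v, 'k) mpoly set)"
    by (auto simp: mono_ideal_def monom_of_def)
  then show "Idl\<^bsub>mpoly_ring V\<^esub> (monom_of ` B :: ('v, 'k) mpoly set) \<subseteq> mono_ideal (multiples V B)"
    by (intro genideal_minimal ideal_mono_ideal up_closed_multiples B)
  have I: "ideal (Idl\<^bsub>mpoly_ring V\<^esub> (monom_of ` B)) (mpoly_ring V :: ('v, 'k) mpoly ring)"
    by (rule genideal_ideal[OF BS])
  show "mono_ideal (multiples V B) \<subseteq> Idl\<^bsub>mpoly_ring V\<^esub> (monom_of ` B :: ('v, 'k) mpoly set)"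
  proof
    fix p :: "('v, 'k) mpoly" assume p: "p \<in> mono_ideal (multiples V B)"
    show "p \<in> Idl\<^bsub>mpoly_ring V\<^esub> (monom_of ` B)"
    proof (rule additive_closed_contains)
      show "0 \<in> Idl\<^bsub>mpoly_ring V\<^esub> (monom_of ` B :: ('v, 'k) mpoly set)"
        using additive_subgroup.zero_closed[OF ideal.axioms(1)[OF I]] by simp
      show "a + b \<in> Idl\<^bsub>mpoly_ring V\<^esub> (monom_of ` B)"
        if "a \<in> Idl\<^bsub>mpoly_ring V\<^esub> (monom_of ` B)" "b \<in> Idl\<^bsub>mpoly_ring V\<^esub> (monom_of ` B)" for a b :: "('v, 'k) mpoly"
        using additive_subgroup.a_closed[OF ideal.axioms(1)[OF I] that] by simp
      fix x assume "x \<in> keys p"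
      then obtain b m where x: "x = b + m" "b \<in> B" "keys m \<subseteq> V"
        using p by (auto simp: mono_ideal_def multiples_def)
      have "monom_of b \<in> Idl\<^bsub>mpoly_ring V\<^esub> (monom_of ` B :: ('v, 'k) mpoly set)"
        using genideal_self[OF BS] x(2) by blast
      moreover have "single m (lookup p x) \<in> carrier (mpoly_ring V)"
        using x(3) by (simp add: mpoly_ring_simps(1))
      ultimately have "single m (lookup p x) * monom_of b \<in> Idl\<^bsub>mpoly_ring V\<^esub> (monom_of ` B)"
        using ideal.I_l_closed[OF I] by simp
      then show "single x (lookup p x) \<in> Idl\<^bsub>mpoly_ring V\<^esub> (monom_of ` B)"
        by (simp add: monom_of_def mult_single x(1) add.commute)
    qed
  qed
qed

lemma ideal_prod_mono_ideal:
  assumes A: "up_closed V A" and B: "up_closed V B"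
  shows "ideal_prod (mpoly_ring V) (mono_ideal A) (mono_ideal B :: ('v, 'k::field) mpoly set)
    = mono_ideal {a + b |a b. a \<in> A \<and> b \<in> B}" (is "?P = mono_ideal ?S")
proof
  show "?P \<subseteq> mono_ideal ?S"
  proof
    fix p assume "p \<in> ?P"
    then show "p \<in> mono_ideal ?S"
    proof (induction rule: ideal_prod.induct)
      case (prod i j)
      then show ?case using Poly_Mapping.keys_mult[of i j] by (fastforce simp: mono_ideal_def)
    next
      case (sum s1 s2)
      then show ?case using mono_ideal_closed(2) by simp
    qed
  qed
  show "mono_ideal ?S \<subseteq> ?P"
  proof
    fix p :: "('v, 'k) mpoly" assume p: "p \<in> mono_ideal ?S"
    show "p \<in> ?P"
    proof (rule additive_closed_contains)
      show "0 \<in> ?P"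
        using ideal_prod.prod[OF mono_ideal_closed(1)[of A] mono_ideal_closed(1)[of B], of "mpoly_ring V"] by simp
      show "a \<in> ?P \<Longrightarrow> b \<in> ?P \<Longrightarrow> a + b \<in> ?P" for a b
        using ideal_prod.sum[of a "mpoly_ring V"] by simp
      fix x assume "x \<in> keys p"
      then obtain a b where x: "x = a + b" "a \<in> A" "b \<in> B" using p by (auto simp: mono_ideal_def)
      have "single a (lookup p x) \<in> mono_ideal A" "monom_of b \<in> (mono_ideal B :: ('v, 'k) mpoly set)"
        using x by (auto simp: mono_ideal_def monom_of_def)
      from ideal_prod.prod[OF this, of "mpoly_ring V"] show "single x (lookup p x) \<in> ?P"
        by (simp add: monom_of_def mult_single x(1))
    qed
  qed
qed

section \<open>Edge ideals and matchings\<close>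

definition edge_monos :: "'v set set \<Rightarrow> ('v \<Rightarrow>\<^sub>0 nat) set" where
  "edge_monos E = {single x 1 + single y 1 |x y. {x, y} \<in> E}"

lemma keys_edge_monos:
  assumes E: "\<And>e. e \<in> E \<Longrightarrow> e \<subseteq> V" and b: "b \<in> edge_monos E"
  shows "keys b \<subseteq> V"
proof -
  obtain x y where "{x, y} \<in> E" "b = single x 1 + single y 1"
    using b by (auto simp: edge_monos_def)
  then show ?thesis using E[of "{x, y}"] by (simp add: keys_add_nat)
qed

lemma edge_ideal_eq:
  assumes E: "\<And>e. e \<in> E \<Longrightarrow> e \<subseteq> V"
  shows "(edge_ideal V E :: ('v, 'k::field) mpoly set) = mono_ideal (multiples V (edge_monos E))"
proof -
  have "{indet x * indet y |x y. {x, y} \<in> E} = (monom_of ` edge_monos E :: ('v, 'k) mpoly set)"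
    by (auto simp: edge_monos_def indet_def monom_of_def mult_single image_iff; metis)
  with genideal_monomials[OF keys_edge_monos[OF E]] show ?thesis
    unfolding edge_ideal_def by simp
qed

text \<open>The base case is all monomials in \<open>V\<close>, because the unit of ideal
  multiplication is the whole ring.\<close>

fun power_monos :: "'v set \<Rightarrow> ('v \<Rightarrow>\<^sub>0 nat) set \<Rightarrow> nat \<Rightarrow> ('v \<Rightarrow>\<^sub>0 nat) set" where
  "power_monos V A 0 = {m. keys m \<subseteq> V}"
| "power_monos V A (Suc k) = {a + b |a b. a \<in> power_monos V A k \<and> b \<in> A}"

lemma power_mono_ideal:
  assumes A: "up_closed V A"
  shows "up_closed V (power_monos V A k) \<and>
    (mono_ideal A :: ('v, 'k::field) mpoly set) [^]\<^bsub>ideals_set (mpoly_ring V)\<^esub> k = mono_ideal (power_monos V A k)"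
proof (induction k)
  case 0
  have "carrier (mpoly_ring V :: ('v, 'k) mpoly ring) = mono_ideal {m. keys m \<subseteq> V}"
    unfolding mono_ideal_def mpoly_ring_def by (simp add: subset_iff Ball_def)
  then show ?case by (simp add: up_closed_def keys_add_nat ideals_set_def nat_pow_def)
next
  case (Suc k)
  have "up_closed V (power_monos V A (Suc k))"
    unfolding up_closed_def
  proof (intro conjI ballI allI impI)
    fix x assume "x \<in> power_monos V A (Suc k)"
    then obtain a b where x: "x = a + b" "a \<in> power_monos V A k" "b \<in> A" by auto
    then show "keys x \<subseteq> V" using Suc A by (simp add: up_closed_def keys_add_nat)
    fix m' :: "'v \<Rightarrow>\<^sub>0 nat" assume "keys m' \<subseteq> V"
    then have "b + m' \<in> A" using A x(3) by (auto simp: up_closed_def)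
    then show "x + m' \<in> power_monos V A (Suc k)" using x by (auto simp: add.assoc)
  qed
  moreover have "(mono_ideal A :: ('v, 'k) mpoly set) [^]\<^bsub>ideals_set (mpoly_ring V)\<^esub> Suc k =
      ideal_prod (mpoly_ring V) (mono_ideal A [^]\<^bsub>ideals_set (mpoly_ring V)\<^esub> k) (mono_ideal A)"
    by (simp add: nat_pow_def ideals_set_def)
  ultimately show ?case using Suc ideal_prod_mono_ideal[OF _ A, of "power_monos V A k"] by simp
qed

text \<open>Membership in a squarefree monomial ideal depends only on the support; \<open>W\<close>
  says which supports contain that of a generator.\<close>

definition sf_monos :: "'v set \<Rightarrow> ('v set \<Rightarrow> bool) \<Rightarrow> ('v \<Rightarrow>\<^sub>0 nat) set" where
  "sf_monos V W = {m. keys m \<subseteq> V \<and> W (keys m)}"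

definition has_matching :: "'v set set \<Rightarrow> nat \<Rightarrow> 'v set \<Rightarrow> bool" where
  "has_matching E k U \<longleftrightarrow> (\<exists>M. finite M \<and> matching E M \<and> card M = k \<and> \<Union>M \<subseteq> U)"

lemma has_matching_mono: "has_matching E k U \<Longrightarrow> U \<subseteq> U' \<Longrightarrow> has_matching E k U'"
  unfolding has_matching_def by (elim exE conjE, intro exI conjI) (assumption | erule (1) subset_trans)+

text \<open>When all exponents are at most 1, the variables of one edge factor cannot recur in the
  other factors, so the chosen edges are pairwise disjoint.\<close>

lemma matching_of_squarefree:
  assumes "m \<in> power_monos V (multiples V (edge_monos E)) k" "\<And>x. lookup m x \<le> 1"
  shows "has_matching E k (keys m)"
  using assms
proof (induction k arbitrary: m)
  case 0
  show ?case unfolding has_matching_def by (intro exI[of _ "{}"]) (simp add: matching_def)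
next
  case (Suc k)
  then obtain a x y m' where m: "m = a + (single x 1 + single y 1 + m')"
      "a \<in> power_monos V (multiples V (edge_monos E)) k" "{x, y} \<in> E"
    by (auto simp: multiples_def edge_monos_def)
  have le: "lookup a z + ((if x = z then 1 else 0) + (if y = z then 1 else 0) + lookup m' z) \<le> 1" for z
    using Suc.prems(2)[of z] unfolding m(1) lookup_add lookup_single when_def by simp
  have "lookup a z \<le> 1" for z using le[of z] by simp
  from Suc.IH[OF m(2) this] obtain M where M: "finite M" "matching E M" "card M = k" "\<Union>M \<subseteq> keys a"
    by (auto simp: has_matching_def)
  have xy: "x \<notin> keys a" "y \<notin> keys a" using le[of x] le[of y] by (auto simp: in_keys_iff)
  have "{x, y} \<notin> M" using xy M(4) by blast
  moreover have "matching E (insert {x, y} M)"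
    using M(2,4) m(3) xy by (auto simp: matching_def pairwise_insert disjnt_def)
  moreover have "\<Union>(insert {x, y} M) \<subseteq> keys m"
    using M(4) by (auto simp: m(1) keys_add_nat)
  ultimately show ?case
    using M(1,3) unfolding has_matching_def by (intro exI[of _ "insert {x, y} M"]) auto
qed

lemma ind_matching_in_power_monos:
  assumes E: "\<And>e. e \<in> E \<Longrightarrow> e \<subseteq> V \<and> card e = 2" and "finite M" "matching E M"
  shows "finite (\<Union>M) \<and> ind (\<Union>M) \<in> power_monos V (multiples V (edge_monos E)) (card M)"
  using assms(2,3)
proof (induction M rule: finite_induct)
  case empty
  show ?case by (simp add: ind_def)
next
  case (insert e M)
  have "matching E M" using insert.prems by (auto simp: matching_def pairwise_insert)
  with insert.IH have IH: "finite (\<Union>M)" "ind (\<Union>M) \<in> power_monos V (multiples V (edge_monos E)) (card M)" by auto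
  have e: "e \<in> E" using insert.prems by (auto simp: matching_def)
  then obtain x y where xy: "e = {x, y}" "x \<noteq> y" using E[of e] by (auto simp: card_2_iff)
  have "\<And>e'. e' \<in> M \<Longrightarrow> disjnt e e'"
    using insert.prems insert.hyps(2) by (auto simp: matching_def pairwise_insert)
  then have "x \<notin> \<Union>M" "y \<notin> \<Union>M" using xy by (auto simp: disjnt_def)
  then have "ind (\<Union>(insert e M)) = ind (\<Union>M) + (single x 1 + single y 1 + 0)"
    using IH(1) xy by (simp add: ind_insert insert_commute ac_simps)
  moreover have "single x 1 + single y 1 + 0 \<in> multiples V (edge_monos E)"
  proof -
    have "single x 1 + single y 1 \<in> edge_monos E"
      using e xy(1) unfolding edge_monos_def by blast
    then show ?thesis unfolding multiples_def
      by (intro CollectI exI[of _ "single x 1 + single y 1"] exI[of _ 0]) simp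
  qed
  ultimately show ?case using insert.hyps IH xy by auto
qed

text \<open>Every squarefree monomial of the ordinary power has a matching in its support, and every
  matching yields such a monomial; hence the support alone decides membership.\<close>

lemma squarefree_power_eq:
  assumes G: "finite_simple_graph V E"
  shows "(squarefree_power V (edge_ideal V E) k :: ('v, 'k::field) mpoly set) = mono_ideal (sf_monos V (has_matching E k))"
proof -
  have V: "finite V" and E: "\<And>e. e \<in> E \<Longrightarrow> e \<subseteq> V \<and> card e = 2" using G by (auto simp: finite_simple_graph_def)
  let ?A = "multiples V (edge_monos E)"
  have A: "up_closed V ?A"
    using E by (intro up_closed_multiples keys_edge_monos[of E]) auto
  let ?B = "{m \<in> power_monos V ?A k. \<forall>x. lookup m x \<le> 1}"
  have ei: "(edge_ideal V E :: ('v, 'k) mpoly set) = mono_ideal ?A"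
    using E by (intro edge_ideal_eq) blast
  have up: "up_closed V (power_monos V ?A k)"
    and pow: "(edge_ideal V E :: ('v, 'k) mpoly set) [^]\<^bsub>ideals_set (mpoly_ring V)\<^esub> k = mono_ideal (power_monos V ?A k)"
    unfolding ei using power_mono_ideal[OF A, of k] by blast+
  have BV: "keys m \<subseteq> V" if "m \<in> ?B" for m using up that by (auto simp: up_closed_def)
  have "squarefree_monomials V \<inter> mono_ideal (power_monos V ?A k) = (monom_of ` ?B :: ('v, 'k) mpoly set)"
    using BV by (auto simp: squarefree_monomials_def mono_ideal_def monom_of_def)
  then have "(squarefree_power V (edge_ideal V E) k :: ('v, 'k) mpoly set) = mono_ideal (multiples V ?B)"
    unfolding squarefree_power_def pow by (simp only: genideal_monomials[OF BV])
  also have "multiples V ?B = sf_monos V (has_matching E k)"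
  proof
    show "multiples V ?B \<subseteq> sf_monos V (has_matching E k)"
    proof
      fix x assume "x \<in> multiples V ?B"
      then obtain b m where x: "x = b + m" "b \<in> ?B" "keys m \<subseteq> V" by (auto simp: multiples_def)
      have "has_matching E k (keys b)" using matching_of_squarefree x(2) by blast
      then show "x \<in> sf_monos V (has_matching E k)"
        using x BV[OF x(2)] has_matching_mono[of E k "keys b"] by (simp add: sf_monos_def keys_add_nat)
    qed
    show "sf_monos V (has_matching E k) \<subseteq> multiples V ?B"
    proof
      fix x assume "x \<in> sf_monos V (has_matching E k)"
      then obtain M where M: "finite M" "matching E M" "card M = k" "\<Union>M \<subseteq> keys x" "keys x \<subseteq> V"
        by (auto simp: sf_monos_def has_matching_def)
      from ind_matching_in_power_monos[OF E M(1,2)] have fin: "finite (\<Union>M)" and "ind (\<Union>M) \<in> ?B"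
        by (auto simp: M(3) lookup_ind)
      moreover have "x = ind (\<Union>M) + (x - ind (\<Union>M))" using minus_ind_add_ind[OF M(4)] by (simp add: add.commute)
      moreover have "keys (x - ind (\<Union>M)) \<subseteq> V"
        using M(5) by (auto simp: in_keys_iff lookup_minus subset_iff)
      ultimately show "x \<in> multiples V ?B" unfolding multiples_def by blast
    qed
  qed
  finally show ?thesis .
qed

section \<open>Squarefree monomial ideals with a linear resolution\<close>

text \<open>The upper Koszul complex in multidegree \<open>B\<close>. Chains are indexed by the size
  \<open>p\<close> of a face, so index \<open>p\<close> stands for reduced homology in degree
  \<open>p - 1\<close>.\<close>

definition removal_complex :: "('v set \<Rightarrow> bool) \<Rightarrow> 'v set \<Rightarrow> 'v set set" where
  "removal_complex W B = {\<sigma>. \<sigma> \<subseteq> B \<and> W (B - \<sigma>)}"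

lemma ind_minus_ind:
  assumes "finite B" "\<sigma> \<subseteq> B"
  shows "ind B - ind \<sigma> = ind (B - \<sigma>)"
  using assms finite_subset[OF assms(2,1)]
  by (intro poly_mapping_eqI) (auto simp: lookup_minus lookup_ind)

lemma faces_ind:
  assumes "finite V" "B \<subseteq> V"
  shows "faces (sf_monos V W) (ind B) = removal_complex W B"
proof -
  have "finite B" using assms finite_subset by blast
  then show ?thesis using assms(2)
    by (auto simp: faces_def removal_complex_def sf_monos_def ind_minus_ind)
qed

lemma mono_predD: "mono W \<Longrightarrow> W U \<Longrightarrow> U \<subseteq> U' \<Longrightarrow> W U'"
  for W :: "'a set \<Rightarrow> bool"
  by (meson le_boolD monoD)

lemma up_closed_sf_monos:
  assumes "mono W"
  shows "up_closed V (sf_monos V W)"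
  unfolding up_closed_def sf_monos_def using mono_predD[OF assms] by (auto simp: keys_add_nat)

lemma sf_monos_add_single:
  "mono W \<Longrightarrow> m \<in> sf_monos V W \<Longrightarrow> v \<in> V \<Longrightarrow> m + single v 1 \<in> sf_monos V W"
  using up_closed_sf_monos[of W V] unfolding up_closed_def by simp

text \<open>If some exponent of a multidegree is at least 2, removing that variable once keeps the
  support, so the strand is a cone over it. Only squarefree multidegrees remain, and there a
  simplicial cycle is the same as a Koszul cycle concentrated in one strand.\<close>

lemma koszul_exact_sf_iff:
  fixes V :: "'v::linorder set"
  assumes V: "finite V" and mono: "mono W"
  shows "koszul_exact V mul_indet (mono_piece (sf_monos V W) :: int \<Rightarrow> ('v, 'k::field) mpoly set) p d \<longleftrightarrow>
    (\<forall>B\<subseteq>V. int (card B) = int p + d \<longrightarrow>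
       (\<forall>c :: 'v set \<Rightarrow> 'k. c \<in> face_chains V (removal_complex W B) p \<longrightarrow> simp_bd V c = 0 \<longrightarrow>
          (\<exists>e \<in> face_chains V (removal_complex W B) (Suc p). simp_bd V e = c)))"
    (is "?L \<longleftrightarrow> ?R")
proof
  assume R: ?R
  show ?L
    unfolding koszul_exact_def
  proof (intro ballI impI)
    fix c :: "'v set \<Rightarrow> ('v, 'k) mpoly"
    assume c: "c \<in> koszul_chains V p (mono_piece (sf_monos V W) d)" and c0: "koszul_bd V mul_indet c = 0"
    show "\<exists>b \<in> koszul_chains V (Suc p) (mono_piece (sf_monos V W) (d - 1)). koszul_bd V mul_indet b = c"
    proof (rule koszul_boundary_if_strands[OF V _ _ c])
      show "m \<in> sf_monos V W \<Longrightarrow> keys m \<subseteq> V" for m by (simp add: sf_monos_def)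
      show "m \<in> sf_monos V W \<Longrightarrow> v \<in> V \<Longrightarrow> m + single v 1 \<in> sf_monos V W" for m v
        by (rule sf_monos_add_single[OF mono])
      fix b :: "'v \<Rightarrow>\<^sub>0 nat" assume deg: "int (mdeg b) = int p + d"
      let ?\<Delta> = "faces (sf_monos V W) b"
      have s: "strand b c \<in> face_chains V ?\<Delta> p" by (rule strand_in_face_chains(1)[OF c])
      have s0: "simp_bd V (strand b c) = 0"
        unfolding strand_koszul_bd[symmetric] c0 by (rule ext) (simp add: strand_def)
      show "\<exists>e\<in>face_chains V ?\<Delta> (Suc p). simp_bd V e = strand b c"
      proof (cases "keys b \<subseteq> V")
        case False
        then have "strand b c = 0"
          by (intro strand_eq_0_outside[OF V _ c]) (auto simp: sf_monos_def)
        moreover have "simp_bd V (0 :: 'v set \<Rightarrow> 'k) = 0" by (rule ext) (simp add: koszul_bd_def)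
        moreover have "0 \<in> face_chains V ?\<Delta> (Suc p)" by (simp add: face_chains_def)
        ultimately show ?thesis by metis
      next
        case bV: True
        show ?thesis
        proof (cases "\<exists>v. lookup b v \<ge> 2")
          case True
          then obtain v where v: "lookup b v \<ge> 2" by blast
          then have vb: "v \<in> keys b" by (auto simp: in_keys_iff)
          show ?thesis
          proof (rule simp_bd_cone[OF V _ _ s s0])
            show "v \<in> V" using vb bV by blast
            fix \<sigma> assume \<sigma>: "\<sigma> \<in> ?\<Delta>" "\<sigma> \<subseteq> V" "v \<notin> \<sigma>"
            then have fin: "finite \<sigma>" using V finite_subset by metis
            have "keys (b - ind (insert v \<sigma>)) = keys (b - ind \<sigma>)"
              using fin \<sigma>(3) v by (auto simp: in_keys_iff lookup_minus lookup_ind split: if_splits)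
            then show "insert v \<sigma> \<in> ?\<Delta>" using \<sigma>(1) vb by (auto simp: faces_def sf_monos_def)
          qed
        next
          case False
          then have "lookup b x = (if x \<in> keys b then 1 else 0)" for x
            unfolding in_keys_iff by (metis One_nat_def less_2_cases linorder_not_le)
          then have b: "b = ind (keys b)"
            by (intro poly_mapping_eqI) (simp add: lookup_ind)
          define B where "B = keys b"
          have "finite B" by (simp add: B_def)
          have bB: "b = ind B" using b by (simp add: B_def)
          have "B \<subseteq> V" using bV by (simp add: B_def)
          moreover have "int (card B) = int p + d" using deg \<open>finite B\<close> by (simp add: bB)
          ultimately show ?thesis
            using R s s0 unfolding bB faces_ind[OF V \<open>B \<subseteq> V\<close>] by blast
        qed
      qed
    qed
  qed
next
  assume L: ?L
  show ?R
  proof (intro allI impI)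
    fix B and c :: "'v set \<Rightarrow> 'k"
    assume B: "B \<subseteq> V" "int (card B) = int p + d" and c: "c \<in> face_chains V (removal_complex W B) p"
      and c0: "simp_bd V c = 0"
    have fin: "finite B" using B(1) V by (rule finite_subset)
    have cD: "\<sigma> \<subseteq> B" "W (B - \<sigma>)" "card \<sigma> = p" if "c \<sigma> \<noteq> 0" for \<sigma>
      using c that by (auto simp: face_chains_def removal_complex_def)
    \<comment> \<open>Multiplying each coefficient by the monomial of the complement puts the whole
      chain into multidegree \<open>B\<close>.\<close>
    define C where "C = (\<lambda>\<sigma>. single (ind (B - \<sigma>)) (c \<sigma>))"
    have C: "C \<in> koszul_chains V p (mono_piece (sf_monos V W) d)"
      unfolding koszul_chains_def
    proof (intro CollectI allI conjI impI)
      fix \<sigma>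
      have "W (B - \<sigma>) \<and> int (card (B - \<sigma>)) = d" if nz: "c \<sigma> \<noteq> 0"
      proof -
        have "finite \<sigma>" using cD(1)[OF nz] fin by (rule finite_subset)
        then have "card (B - \<sigma>) + card \<sigma> = card B"
          using cD(1)[OF nz] fin by (simp add: card_Diff_subset card_mono)
        then show ?thesis using cD[OF nz] B(2) by simp
      qed
      then show "C \<sigma> \<in> mono_piece (sf_monos V W) d"
        using fin B(1) by (auto simp: C_def mono_piece_def sf_monos_def)
      assume "C \<sigma> \<noteq> 0"
      then have "c \<sigma> \<noteq> 0" by (auto simp: C_def)
      then show "\<sigma> \<subseteq> V" "card \<sigma> = p" using cD B(1) by blast+
    qed
    have sC: "strand b C = (if b = ind B then c else 0)" for b
    proof
      fix \<sigma>
      show "strand b C \<sigma> = (if b = ind B then c else 0) \<sigma>"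
      proof (cases "c \<sigma> = 0")
        case True
        then show ?thesis by (simp add: strand_def C_def)
      next
        case False
        note \<sigma> = cD(1)[OF False]
        show ?thesis
        proof (cases "b = ind B")
          case True
          then show ?thesis using \<sigma> fin by (simp add: strand_def C_def ind_minus_ind)
        next
          case neq: False
          have "ind (B - \<sigma>) \<noteq> b - ind \<sigma>" if "\<sigma> \<subseteq> keys b"
          proof
            assume "ind (B - \<sigma>) = b - ind \<sigma>"
            then have "b = ind (B - \<sigma>) + ind \<sigma>" using minus_ind_add_ind[OF that] by simp
            also have "\<dots> = ind B"
              using minus_ind_add_ind[of \<sigma> "ind B"] \<sigma> fin by (simp add: ind_minus_ind)
            finally show False using neq by simp
          qed
          then show ?thesis using neq by (simp add: strand_def C_def lookup_single when_def)
        qed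
      qed
    qed
    have "koszul_bd V mul_indet C = 0"
    proof (cases p)
      case 0
      then show ?thesis using koszul_bd_0_chain[OF V commuting_actions_mul_indet] C by blast
    next
      case (Suc p')
      have up: "m \<in> sf_monos V W \<Longrightarrow> v \<in> V \<Longrightarrow> m + single v 1 \<in> sf_monos V W" for m v
        by (rule sf_monos_add_single[OF mono])
      have 1: "koszul_bd V mul_indet C \<in> koszul_chains V p' (mono_piece (sf_monos V W) (d + 1))"
        using koszul_bd_in_chains[OF V commuting_actions_mul_indet graded_pieces_mono_piece[OF up]] C Suc by blast
      have 2: "(0 :: 'v set \<Rightarrow> ('v, 'k) mpoly) \<in> koszul_chains V p' UNIV" by (simp add: koszul_chains_def)
      show ?thesis
      proof (rule strand_eqI[OF V 1 2])
        show "strand x (koszul_bd V mul_indet C) = strand x (0 :: 'v set \<Rightarrow> ('v, 'k) mpoly)" for x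
        proof -
          have "strand x (0 :: 'v set \<Rightarrow> ('v, 'k) mpoly) = 0" by (rule ext) (simp add: strand_def)
          moreover have "simp_bd V (0 :: 'v set \<Rightarrow> 'k) = 0" by (rule ext) (simp add: koszul_bd_def)
          ultimately show ?thesis unfolding strand_koszul_bd sC using c0 by simp
        qed
      qed
    qed
    then obtain b where b: "b \<in> koszul_chains V (Suc p) (mono_piece (sf_monos V W) (d - 1))"
        "koszul_bd V mul_indet b = C"
      using koszul_exactE[OF L C] by blast
    have "simp_bd V (strand (ind B) b) = c"
      unfolding strand_koszul_bd[symmetric] b(2) sC by simp
    moreover have "strand (ind B) b \<in> face_chains V (removal_complex W B) (Suc p)"
      using strand_in_face_chains(1)[OF b(1), of "ind B"] faces_ind[OF V B(1)] by simp
    ultimately show "\<exists>e \<in> face_chains V (removal_complex W B) (Suc p). simp_bd V e = c" by blast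
  qed
qed

text \<open>A nonzero class involves a face of size \<open>p\<close> inside some
  \<open>B \<subseteq> V\<close> with \<open>card B = p + d\<close>. This supplies the bound needed
  to construct a resolution and keeps the set of relevant degrees finite.\<close>

lemma not_koszul_exact_sf_bounds:
  fixes V :: "'v::linorder set"
  assumes V: "finite V" and mono: "mono W"
    and nex: "\<not> koszul_exact V mul_indet (mono_piece (sf_monos V W) :: int \<Rightarrow> ('v, 'k::field) mpoly set) p d"
  shows "0 \<le> d" "int p + d \<le> int (card V)"
proof -
  obtain B and c :: "'v set \<Rightarrow> 'k" where B: "B \<subseteq> V" "int (card B) = int p + d"
      and c: "c \<in> face_chains V (removal_complex W B) p"
      and nb: "\<not> (\<exists>e \<in> face_chains V (removal_complex W B) (Suc p). simp_bd V e = c)"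
    using nex unfolding koszul_exact_sf_iff[OF V mono] by blast
  show "int p + d \<le> int (card V)" using B card_mono[OF V B(1)] by linarith
  have "c \<noteq> 0"
  proof
    assume "c = 0"
    moreover have "simp_bd V (0 :: 'v set \<Rightarrow> 'k) = 0" by (rule ext) (simp add: koszul_bd_def)
    moreover have "0 \<in> face_chains V (removal_complex W B) (Suc p)" by (simp add: face_chains_def)
    ultimately show False using nb by blast
  qed
  then obtain \<sigma> where "c \<sigma> \<noteq> 0" by (auto simp: fun_eq_iff)
  then have "\<sigma> \<subseteq> B" "card \<sigma> = p" using c by (auto simp: face_chains_def removal_complex_def)
  then have "p \<le> card B" using card_mono[of B \<sigma>] finite_subset[OF B(1) V] by simp
  then show "0 \<le> d" using B(2) by linarith
qed

section \<open>Regularity and linear resolutions\<close>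

lemma regularity_sf:
  fixes V :: "'v::linorder set"
  assumes V: "finite V" and mono: "mono W"
  defines "S \<equiv> {d. \<exists>p. \<not> koszul_exact V mul_indet (mono_piece (sf_monos V W) :: int \<Rightarrow> ('v, 'k::field) mpoly set) p d}"
  shows "finite S" "regularity V (mono_ideal (sf_monos V W) :: ('v, 'k) mpoly set) = Max S"
proof -
  let ?J = "mono_ideal (sf_monos V W) :: ('v, 'k) mpoly set"
  note bounds = not_koszul_exact_sf_bounds[OF V mono]
  have "S \<subseteq> {0..int (card V)}"
  proof
    fix d assume "d \<in> S"
    then obtain p where "\<not> koszul_exact V mul_indet (mono_piece (sf_monos V W) :: int \<Rightarrow> ('v, 'k) mpoly set) p d"
      by (auto simp: S_def)
    from bounds(1)[OF this] bounds(2)[OF this] show "d \<in> {0..int (card V)}" by simp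
  qed
  then show "finite S" by (rule finite_subset) simp
  have hom: "homogeneous_part ?J = mono_piece (sf_monos V W)"
    by (rule ext) (rule homogeneous_part_mono_ideal)
  have "koszul_exact V mul_indet (homogeneous_part ?J) p d" if "d > int (card V)" for p d
    unfolding hom using bounds(2)[of p d] that by fastforce
  then have "\<exists>F. minimal_graded_free_resolution V ?J F"
    by (rule minimal_resolution_exists[OF V graded_ideal_mono_ideal[OF up_closed_sf_monos[OF mono]]])
  then have F: "minimal_graded_free_resolution V ?J (SOME F. minimal_graded_free_resolution V ?J F)"
    by (rule someI_ex)
  define F where "F = (SOME F. minimal_graded_free_resolution V ?J F)"
  have betti: "graded_betti V ?J i j \<noteq> 0 \<longleftrightarrow> (\<exists>q<res_rank F i. res_shift F i q = j)" for i j
    by (auto simp: graded_betti_def F_def[symmetric] Let_def)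
  have ex: "koszul_exact V mul_indet (mono_piece (sf_monos V W) :: int \<Rightarrow> ('v, 'k) mpoly set) i d \<longleftrightarrow>
      (\<forall>q<res_rank F i. int (res_shift F i q) \<noteq> d + int i)" for i d
    using koszul_exact_iff_no_shift[OF V F, of i d] by (simp add: hom F_def)
  have "{int j - int i |i j. graded_betti V ?J i j \<noteq> 0} = S"
    unfolding betti S_def ex by force
  then show "regularity V ?J = Max S" by (simp add: regularity_def)
qed

lemma keys_mono_ideal_degree_ge:
  fixes S :: "('v, 'k::field) mpoly set"
  assumes S: "S \<subseteq> carrier (mpoly_ring V)" "\<And>s. s \<in> S \<Longrightarrow> homogeneous d s"
    and p: "p \<in> Idl\<^bsub>mpoly_ring V\<^esub> S" "m \<in> keys p"
  shows "d \<le> mdeg m"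
proof -
  interpret cring "mpoly_ring V :: ('v, 'k::field) mpoly ring" by (rule cring_mpoly_ring)
  have "up_closed V {m. keys m \<subseteq> V \<and> d \<le> mdeg m}"
    by (auto simp: up_closed_def keys_add_nat mdeg_add)
  then have "Idl\<^bsub>mpoly_ring V\<^esub> S \<subseteq> mono_ideal {m. keys m \<subseteq> V \<and> d \<le> mdeg m}"
    using S by (intro genideal_minimal ideal_mono_ideal) (force simp: mono_ideal_def homogeneous_def)+
  then show ?thesis using p by (auto simp: mono_ideal_def)
qed

definition generated_in_degree :: "'v set \<Rightarrow> ('v set \<Rightarrow> bool) \<Rightarrow> nat \<Rightarrow> bool" where
  "generated_in_degree V W g \<longleftrightarrow> (\<exists>U\<subseteq>V. W U) \<and> (\<forall>U\<subseteq>V. W U \<longrightarrow> (\<exists>U'\<subseteq>U. card U' = g \<and> W U'))"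

text \<open>Below degree \<open>g\<close> the ideal is 0, and in degree \<open>g\<close> its
  generators give nonzero zeroth homology. So the regularity is at least \<open>g\<close>, with
  equality exactly when no homology survives above.\<close>

theorem has_linear_resolution_sf_iff:
  fixes V :: "'v::linorder set"
  assumes V: "finite V" and mono: "mono W" and gen: "generated_in_degree V W g"
  shows "has_linear_resolution V (mono_ideal (sf_monos V W) :: ('v, 'k::field) mpoly set) \<longleftrightarrow>
    (\<forall>p d. d > int g \<longrightarrow> koszul_exact V mul_indet (mono_piece (sf_monos V W) :: int \<Rightarrow> ('v, 'k) mpoly set) p d)"
    (is "_ \<longleftrightarrow> ?R")
proof -
  let ?A = "sf_monos V W"
  let ?J = "mono_ideal ?A :: ('v, 'k) mpoly set"
  define S where "S = {d. \<exists>p. \<not> koszul_exact V mul_indet (mono_piece ?A :: int \<Rightarrow> ('v, 'k) mpoly set) p d}"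
  have finS: "finite S" and reg: "regularity V ?J = Max S"
    using regularity_sf[OF V mono] by (auto simp: S_def)
  obtain U where U: "U \<subseteq> V" "card U = g" "W U" using gen unfolding generated_in_degree_def by (meson subset_trans)
  have finU: "finite U" using U(1) V by (rule finite_subset)
  have UA: "ind U \<in> ?A" "mdeg (ind U) = g" using U finU by (auto simp: sf_monos_def)
  have genA: "\<exists>U'\<subseteq>keys m. card U' = g \<and> W U'" if "m \<in> ?A" for m
    using gen that by (auto simp: generated_in_degree_def sf_monos_def)
  have degA: "g \<le> mdeg m" if m: "m \<in> ?A" for m
  proof -
    obtain U' where U': "U' \<subseteq> keys m" "card U' = g" using genA[OF m] by blast
    show ?thesis using mdeg_minus_ind[OF U'(1)] U'(2) by linarith
  qed
  interpret cring "mpoly_ring V :: ('v, 'k::field) mpoly ring" by (rule cring_mpoly_ring)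
  show ?thesis
  proof
    assume "has_linear_resolution V ?J"
    then obtain d T where T: "minimal_homogeneous_generators V ?J T" "\<forall>s\<in>T. homogeneous d s"
        and r: "regularity V ?J = int d"
      unfolding has_linear_resolution_def by blast
    have "monom_of (ind U) \<in> Idl\<^bsub>mpoly_ring V\<^esub> T"
      using T(1) UA(1) by (simp add: minimal_homogeneous_generators_def mono_ideal_def monom_of_def)
    \<comment> \<open>The \<open>d\<close> of the definition is merely existential. An ideal
      generated in degree \<open>d\<close> that contains the monomial of \<open>U\<close> must have
      \<open>d \<le> g\<close>, and this already excludes homology above \<open>g\<close>.\<close>
    then have "d \<le> g"
      using keys_mono_ideal_degree_ge[of T V d "monom_of (ind U)" "ind U"] T UA(2)
      by (auto simp: minimal_homogeneous_generators_def monom_of_def)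
    show ?R
    proof (intro allI impI, rule ccontr)
      fix p e assume "e > int g" "\<not> koszul_exact V mul_indet (mono_piece ?A :: int \<Rightarrow> ('v, 'k) mpoly set) p e"
      then have "e \<in> S" "e > int g" by (auto simp: S_def)
      then have "Max S > int g" using finS Max_ge[of S e] by linarith
      then show False using r reg \<open>d \<le> g\<close> by linarith
    qed
  next
    assume R: ?R
    have zero: "mono_piece ?A d = ({0} :: ('v, 'k) mpoly set)" if "d < int g" for d
    proof -
      have "p = 0" if "p \<in> mono_piece ?A d" for p :: "('v, 'k) mpoly"
      proof -
        have "m \<notin> keys p" for m
          using that degA[of m] \<open>d < int g\<close> by (auto simp: mono_piece_def)
        then show ?thesis by (metis all_not_in_conv keys_eq_empty)
      qed
      then show ?thesis by (auto simp: mono_piece_def)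
    qed
    have chain0: "c = 0" if "c \<in> koszul_chains V p (mono_piece ?A d)" "d < int g"
      for c :: "'v set \<Rightarrow> ('v, 'k) mpoly" and p d
      using that(1) unfolding zero[OF that(2)] by (auto simp: koszul_chains_def fun_eq_iff)
    have bd0: "koszul_bd V mul_indet (0 :: 'v set \<Rightarrow> ('v, 'k) mpoly) = 0" by (rule ext) (simp add: koszul_bd_def)
    have "d = int g" if "d \<in> S" for d
    proof (rule ccontr)
      assume "d \<noteq> int g"
      obtain p where p: "\<not> koszul_exact V mul_indet (mono_piece ?A :: int \<Rightarrow> ('v, 'k) mpoly set) p d"
        using \<open>d \<in> S\<close> by (auto simp: S_def)
      then have "\<not> d > int g" using R by blast
      then have "d < int g" using \<open>d \<noteq> int g\<close> by linarith
      have "0 \<in> koszul_chains V (Suc p) (mono_piece ?A (d - 1) :: ('v, 'k) mpoly set)"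
        by (simp add: koszul_chains_def mono_piece_def)
      then have "koszul_exact V mul_indet (mono_piece ?A :: int \<Rightarrow> ('v, 'k) mpoly set) p d"
        unfolding koszul_exact_def using chain0[OF _ \<open>d < int g\<close>] bd0 by blast
      with p show False by blast
    qed
    moreover have "int g \<in> S"
    proof -
      \<comment> \<open>The class of a generator: it bounds nothing, because chains with
        coefficients of degree \<open>g - 1\<close> are 0.\<close>
      define c where "c = (\<lambda>\<sigma> :: 'v set. if \<sigma> = {} then monom_of (ind U) :: ('v, 'k) mpoly else 0)"
      have c: "c \<in> koszul_chains V 0 (mono_piece ?A (int g))"
        using UA by (auto simp: koszul_chains_def c_def mono_piece_def monom_of_def)
      have "\<not> koszul_exact V mul_indet (mono_piece ?A :: int \<Rightarrow> ('v, 'k) mpoly set) 0 (int g)"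
      proof
        assume ex: "koszul_exact V mul_indet (mono_piece ?A :: int \<Rightarrow> ('v, 'k) mpoly set) 0 (int g)"
        obtain b where b: "b \<in> koszul_chains V (Suc 0) (mono_piece ?A (int g - 1))" "koszul_bd V mul_indet b = c"
          by (rule koszul_exactE[OF ex c koszul_bd_0_chain[OF V commuting_actions_mul_indet c]])
        have "c = 0" using chain0[OF b(1)] b(2) bd0 by simp
        from arg_cong[OF fun_cong[OF this, of "{}"], of "\<lambda>p. lookup p (ind U)"]
        show False by (simp add: c_def monom_of_def)
      qed
      then show ?thesis by (auto simp: S_def)
    qed
    ultimately have "S = {int g}" by blast
    then have r: "regularity V ?J = int g" by (simp add: reg)
    define B where "B = {m \<in> ?A. mdeg m = g}"
    have BV: "keys b \<subseteq> V" if "b \<in> B" for b using that by (simp add: B_def sf_monos_def)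
    have "multiples V B = ?A"
    proof
      show "multiples V B \<subseteq> ?A"
        using up_closed_sf_monos[OF mono, of V] by (auto simp: multiples_def B_def up_closed_def)
      show "?A \<subseteq> multiples V B"
      proof
        fix m assume m: "m \<in> ?A"
        then obtain U' where U': "U' \<subseteq> keys m" "card U' = g" "W U'"
          using genA by blast
        have "finite U'" using U'(1) by (rule finite_subset) simp
        have "m = ind U' + (m - ind U')" using minus_ind_add_ind[OF U'(1)] by (simp add: add.commute)
        moreover have "ind U' \<in> B" using U' m \<open>finite U'\<close> by (auto simp: B_def sf_monos_def)
        moreover have "keys (m - ind U') \<subseteq> V"
          using m by (auto simp: sf_monos_def in_keys_iff lookup_minus subset_iff)
        ultimately show "m \<in> multiples V B" unfolding multiples_def by blast
      qed
    qed
    then have IB: "Idl\<^bsub>mpoly_ring V\<^esub> (monom_of ` B) = ?J" by (simp add: genideal_monomials[OF BV])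
    have "minimal_homogeneous_generators V ?J (monom_of ` B)"
      unfolding minimal_homogeneous_generators_def
    proof (intro conjI allI impI IB ballI)
      show "monom_of ` B \<subseteq> carrier (mpoly_ring V :: ('v, 'k) mpoly ring)" using BV by (auto simp: monom_of_def)
      show "\<exists>d. homogeneous d s" if "s \<in> monom_of ` B" for s :: "('v, 'k) mpoly"
        using that by (intro exI[of _ g]) (auto simp: homogeneous_def monom_of_def B_def)
      fix T :: "('v, 'k) mpoly set" assume T: "T \<subset> monom_of ` B"
      define B' where "B' = {b \<in> B. monom_of b \<in> T}"
      have T': "T = monom_of ` B'" using T by (auto simp: B'_def)
      have "B' \<subseteq> B" by (auto simp: B'_def)
      moreover have "B' \<noteq> B" using T unfolding T' by (metis psubset_eq)
      ultimately obtain b where b: "b \<in> B" "b \<notin> B'" by blast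
      show "Idl\<^bsub>mpoly_ring V\<^esub> T \<noteq> ?J"
      proof
        assume eq: "Idl\<^bsub>mpoly_ring V\<^esub> T = ?J"
        have BV': "keys b \<subseteq> V" if "b \<in> B'" for b
          using BV that \<open>B' \<subseteq> B\<close> by blast
        have "mono_ideal (multiples V B') = ?J"
          using eq genideal_monomials[where B = B' and 'k = 'k, OF BV'] unfolding T' by simp
        moreover have "monom_of b \<in> ?J" using b(1) by (simp add: mono_ideal_def monom_of_def B_def)
        ultimately have "(monom_of b :: ('v, 'k) mpoly) \<in> mono_ideal (multiples V B')" by simp
        then have "b \<in> multiples V B'" by (simp add: mono_ideal_def monom_of_def)
        \<comment> \<open>Both monomials have degree \<open>g\<close>, so the cofactor
          \<open>m\<close> is trivial and no generator is redundant.\<close>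
        then obtain b' m where "b = b' + m" "b' \<in> B'" by (auto simp: multiples_def)
        moreover from this have "mdeg m = 0" using b(1) \<open>B' \<subseteq> B\<close> by (auto simp: B_def mdeg_add)
        ultimately show False using b(2) by (simp add: mdeg_eq_0_iff)
      qed
    qed
    moreover have "\<forall>s \<in> monom_of ` B. homogeneous g (s :: ('v, 'k) mpoly)"
      by (auto simp: homogeneous_def monom_of_def B_def)
    ultimately show "has_linear_resolution V ?J" unfolding has_linear_resolution_def using r by blast
  qed
qed

section \<open>Cycles\<close>

text \<open>The boundary of a chain of vertices lives on the empty face alone, where it is the
  augmentation.\<close>

lemma simp_bd_vertices:
  fixes c :: "'v::linorder set \<Rightarrow> 'a::ab_group_add"
  assumes V: "finite V" and c: "c \<in> face_chains V \<Delta> (Suc 0)"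
  shows "simp_bd V c = 0 \<longleftrightarrow> (\<Sum>v\<in>V. c {v}) = 0"
proof -
  have "simp_bd V c {} = (\<Sum>v\<in>V. c {v})" by (simp add: koszul_bd_def sgn_ins_def)
  moreover have "simp_bd V c \<tau> = 0" if ne: "\<tau> \<noteq> {}" for \<tau>
  proof -
    have "c (insert v \<tau>) = 0" if v: "v \<in> V - \<tau>" for v
    proof (rule ccontr)
      assume "c (insert v \<tau>) \<noteq> 0"
      then have "insert v \<tau> \<subseteq> V" "card (insert v \<tau>) = Suc 0" using c by (auto simp: face_chains_def)
      moreover from this have "finite \<tau>" using finite_subset[of "insert v \<tau>" V] V by simp
      ultimately show False using v ne by simp
    qed
    then show ?thesis by (simp add: koszul_bd_def)
  qed
  ultimately show ?thesis
    unfolding fun_eq_iff zero_fun_apply by (metis (no_types))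
qed

definition coboundary :: "('v::linorder set \<Rightarrow> 'a::ab_group_add) \<Rightarrow> 'v set \<Rightarrow> 'a" where
  "coboundary f T = (\<Sum>v\<in>T. sgn_ins v (T - {v}) (f (T - {v})))"

text \<open>Both sides sum over the pairs of a set \<open>T\<close> and a vertex \<open>v\<close> of
  it, with \<open>\<sigma> = T - {v}\<close>.\<close>

lemma pairing_boundary:
  fixes f e :: "'v::linorder set \<Rightarrow> 'k::field"
  assumes V: "finite V"
  shows "(\<Sum>\<sigma>\<in>Pow V. f \<sigma> * simp_bd V e \<sigma>) = (\<Sum>T\<in>Pow V. coboundary f T * e T)"
proof -
  have sg: "a * sgn_ins v \<tau> b = sgn_ins v \<tau> a * b" for a b :: 'k and v and \<tau> :: "'v set"
    by (simp add: sgn_ins_def)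
  have fin: "finite (V - \<sigma>)" "finite (Pow V)" for \<sigma> using V by auto
  have finT: "T \<in> Pow V \<Longrightarrow> finite T" for T using V finite_subset by auto
  have "(\<Sum>\<sigma>\<in>Pow V. f \<sigma> * simp_bd V e \<sigma>) =
      (\<Sum>\<sigma>\<in>Pow V. \<Sum>v\<in>V - \<sigma>. sgn_ins v \<sigma> (f \<sigma>) * e (insert v \<sigma>))"
    by (simp add: koszul_bd_def sum_distrib_left sg)
  also have "\<dots> = (\<Sum>(\<sigma>, v)\<in>(SIGMA \<sigma>:Pow V. V - \<sigma>). sgn_ins v \<sigma> (f \<sigma>) * e (insert v \<sigma>))"
    using fin by (intro sum.Sigma) auto
  also have "\<dots> = (\<Sum>(T, v)\<in>(SIGMA T:Pow V. T). sgn_ins v (T - {v}) (f (T - {v})) * e T)"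
    by (rule sum.reindex_bij_witness[of _ "\<lambda>(T, v). (T - {v}, v)" "\<lambda>(\<sigma>, v). (insert v \<sigma>, v)"])
      (auto simp: insert_absorb)
  also have "\<dots> = (\<Sum>T\<in>Pow V. \<Sum>v\<in>T. sgn_ins v (T - {v}) (f (T - {v})) * e T)"
    using fin finT by (intro sum.Sigma[symmetric]) auto
  finally show ?thesis by (simp add: coboundary_def sum_distrib_right)
qed

definition simp_exact :: "'k::field itself \<Rightarrow> 'v::linorder set \<Rightarrow> 'v set set \<Rightarrow> nat \<Rightarrow> bool" where
  "simp_exact _ V \<Delta> p \<longleftrightarrow> (\<forall>c :: 'v set \<Rightarrow> 'k. c \<in> face_chains V \<Delta> p \<longrightarrow> simp_bd V c = 0 \<longrightarrow>
     (\<exists>e \<in> face_chains V \<Delta> (Suc p). simp_bd V e = c))"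

text \<open>The nontrivial cycle is the boundary of \<open>T\<close>, which is then not a face itself.\<close>

lemma not_simp_exact_if_cocycle:
  fixes f :: "'v::linorder set \<Rightarrow> 'k::field"
  assumes V: "finite V" and T: "T \<subseteq> V" "card T = Suc p" "coboundary f T \<noteq> 0"
    and faces: "\<And>v. v \<in> T \<Longrightarrow> T - {v} \<in> \<Delta>"
    and cocycle: "\<And>T'. T' \<in> \<Delta> \<Longrightarrow> T' \<subseteq> V \<Longrightarrow> card T' = Suc p \<Longrightarrow> coboundary f T' = 0"
  shows "\<not> simp_exact TYPE('k) V \<Delta> p"
proof
  assume ex: "simp_exact TYPE('k) V \<Delta> p"
  define \<delta> where "\<delta> = (\<lambda>\<sigma>. if \<sigma> = T then 1 else 0 :: 'k)"
  define c where "c = simp_bd V \<delta>"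
  have "\<delta> \<in> koszul_chains V (Suc p) UNIV" using T by (auto simp: koszul_chains_def \<delta>_def)
  moreover have "commuting_actions (\<lambda>(_::'v) x :: 'k. x)" by (simp add: commuting_actions_def additive_def)
  ultimately have c0: "simp_bd V c = 0" unfolding c_def using koszul_bd_koszul_bd[OF V] by blast
  have "c \<in> face_chains V \<Delta> p"
    unfolding face_chains_def
  proof (intro CollectI allI impI)
    fix \<tau> assume "c \<tau> \<noteq> 0"
    then obtain v where "v \<in> V - \<tau>" "sgn_ins v \<tau> (\<delta> (insert v \<tau>)) \<noteq> 0"
      unfolding c_def koszul_bd_def by (rule sum.not_neutral_contains_not_neutral)
    then have v: "v \<in> T" "\<tau> = T - {v}" by (auto simp: \<delta>_def split: if_splits)
    then show "\<tau> \<subseteq> V \<and> card \<tau> = p \<and> \<tau> \<in> \<Delta>" using T faces by auto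
  qed
  then obtain e where e: "e \<in> face_chains V \<Delta> (Suc p)" "simp_bd V e = c"
    using ex c0 unfolding simp_exact_def by blast
  \<comment> \<open>The chain \<open>c\<close> is paired with \<open>f\<close> in two ways: as the
    boundary of \<open>e\<close>, which lives on faces where the coboundary vanishes, and as the
    boundary of \<open>T\<close>, where it does not.\<close>
  have "0 = (\<Sum>T\<in>Pow V. coboundary f T * e T)"
  proof (rule sum.neutral[symmetric], intro ballI)
    fix T' assume "T' \<in> Pow V"
    show "coboundary f T' * e T' = 0"
      using e(1) cocycle[of T'] by (cases "e T' = 0") (auto simp: face_chains_def)
  qed
  also have "\<dots> = (\<Sum>\<sigma>\<in>Pow V. f \<sigma> * c \<sigma>)" using pairing_boundary[OF V, of f e] by (simp add: e(2))
  also have "\<dots> = (\<Sum>T'\<in>Pow V. coboundary f T' * \<delta> T')" unfolding c_def by (rule pairing_boundary[OF V])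
  also have "\<dots> = (\<Sum>T'\<in>Pow V. if T' = T then coboundary f T else 0)"
    by (intro sum.cong refl) (simp add: \<delta>_def)
  also have "\<dots> = coboundary f T" using T(1) V by simp
  finally show False using T(3) by simp
qed

text \<open>This is reduced homology in degree -1: either the empty set is not a face, or there is a
  vertex \<open>v\<close>, and then the faces \<open>{}\<close> and \<open>{v}\<close> form a
  cone.\<close>

lemma simp_exact_0:
  fixes V :: "'v::linorder set"
  assumes V: "finite V" and ne: "{} \<in> \<Delta> \<Longrightarrow> \<exists>v\<in>V. {v} \<in> \<Delta>"
  shows "simp_exact TYPE('k::field) V \<Delta> 0"
  unfolding simp_exact_def
proof (intro allI impI)
  fix c :: "'v set \<Rightarrow> 'k" assume c: "c \<in> face_chains V \<Delta> 0"
  have sup: "\<sigma> = {} \<and> {} \<in> \<Delta>" if "c \<sigma> \<noteq> 0" for \<sigma>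
  proof -
    have "\<sigma> \<subseteq> V" "card \<sigma> = 0" "\<sigma> \<in> \<Delta>" using c that by (auto simp: face_chains_def)
    then show ?thesis using finite_subset[OF _ V, of \<sigma>] by simp
  qed
  show "\<exists>e \<in> face_chains V \<Delta> (Suc 0). simp_bd V e = c"
  proof (cases "c {} = 0")
    case True
    then have "c = 0" using sup by (metis ext zero_fun_apply)
    moreover have "simp_bd V (0 :: 'v set \<Rightarrow> 'k) = 0" by (rule ext) (simp add: koszul_bd_def)
    moreover have "0 \<in> face_chains V \<Delta> (Suc 0)" by (simp add: face_chains_def)
    ultimately show ?thesis by metis
  next
    case False
    then obtain v where v: "v \<in> V" "{v} \<in> \<Delta>" using sup ne by blast
    let ?C = "{\<sigma>. \<sigma> = {} \<or> \<sigma> = {v}}"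
    have "c \<in> face_chains V ?C 0" using c sup by (auto simp: face_chains_def)
    moreover have "simp_bd V c = 0"
    proof
      fix \<tau>
      have "c (insert w \<tau>) = 0" for w using sup[of "insert w \<tau>"] by blast
      then show "simp_bd V c \<tau> = 0 \<tau>" by (simp add: koszul_bd_def)
    qed
    ultimately obtain e where e: "e \<in> face_chains V ?C (Suc 0)" "simp_bd V e = c"
      using simp_bd_cone[OF V v(1), of ?C c 0] by auto
    have "e \<in> face_chains V \<Delta> (Suc 0)" using e(1) v(2) by (fastforce simp: face_chains_def)
    then show ?thesis using e(2) by blast
  qed
qed

text \<open>A cycle splits into one on each of the two stars, which are cones.\<close>

lemma simp_exact_1_two_stars:
  fixes V :: "'v::linorder set"
  assumes V: "finite V" and ab: "b \<in> V" "b \<in> A" "a \<in> V" "a \<notin> A"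
    and star_b: "\<And>w. w \<in> V \<Longrightarrow> w \<notin> A \<Longrightarrow> {b, w} \<in> \<Delta>"
    and star_a: "\<And>w. w \<in> V \<Longrightarrow> w \<in> A \<Longrightarrow> {a, w} \<in> \<Delta>"
  shows "simp_exact TYPE('k::field) V \<Delta> (Suc 0)"
  unfolding simp_exact_def
proof (intro allI impI)
  fix c :: "'v set \<Rightarrow> 'k" assume c: "c \<in> face_chains V \<Delta> (Suc 0)" and c0: "simp_bd V c = 0"
  define s where "s = (\<Sum>v\<in>V. if v \<in> A then c {v} else 0)"
  \<comment> \<open>The part of \<open>c\<close> on \<open>A\<close>, balanced by \<open>- s\<close>
    at the apex \<open>a\<close>. Its coefficients sum to 0, so \<open>c1\<close> and
    \<open>c - c1\<close> are both cycles.\<close>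
  define c1 where "c1 = (\<lambda>\<sigma>. if \<exists>v\<in>A. \<sigma> = {v} then c \<sigma> else if \<sigma> = {a} then - s else 0)"
  define c2 where "c2 = c - c1"
  \<comment> \<open>The cones with apex \<open>a\<close> over the vertices in \<open>A\<close> and
    with apex \<open>b\<close> over those outside; their two-element faces are the edges given by
    \<open>star_a\<close> and \<open>star_b\<close>.\<close>
  let ?\<Delta>1 = "{\<sigma>. \<sigma> - {a} = {} \<or> (\<exists>w\<in>A \<inter> V. \<sigma> - {a} = {w})}"
  let ?\<Delta>2 = "{\<sigma>. \<sigma> - {b} = {} \<or> (\<exists>w\<in>V - A. \<sigma> - {b} = {w})}"
  have singleton: "\<exists>v\<in>V. \<sigma> = {v}" if "c \<sigma> \<noteq> 0" for \<sigma>
    using c that by (auto simp: face_chains_def card_1_singleton_iff)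
  have c1f: "c1 \<in> face_chains V ?\<Delta>1 (Suc 0)"
    unfolding face_chains_def
  proof (intro CollectI allI impI)
    fix \<sigma> assume "c1 \<sigma> \<noteq> 0"
    then consider "\<exists>v\<in>A. \<sigma> = {v}" "c \<sigma> \<noteq> 0" | "\<sigma> = {a}" by (auto simp: c1_def split: if_splits)
    then show "\<sigma> \<subseteq> V \<and> card \<sigma> = Suc 0 \<and> \<sigma> \<in> ?\<Delta>1"
    proof cases
      case 1
      then obtain v where "v \<in> A" "v \<in> V" "\<sigma> = {v}" using singleton by blast
      then show ?thesis using ab by auto
    qed (use ab in auto)
  qed
  have c2f: "c2 \<in> face_chains V ?\<Delta>2 (Suc 0)"
    unfolding face_chains_def
  proof (intro CollectI allI impI)
    fix \<sigma> assume nz: "c2 \<sigma> \<noteq> 0"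
    then have "c \<sigma> \<noteq> 0 \<or> \<sigma> = {a}" by (auto simp: c2_def c1_def split: if_splits)
    then obtain v where v: "v \<in> V" "\<sigma> = {v}" using singleton ab by blast
    then have "v \<notin> A" using nz by (auto simp: c2_def c1_def)
    then show "\<sigma> \<subseteq> V \<and> card \<sigma> = Suc 0 \<and> \<sigma> \<in> ?\<Delta>2" using v ab by auto
  qed
  have "(\<Sum>v\<in>V. c1 {v}) = (\<Sum>v\<in>V. (if v \<in> A then c {v} else 0) + (if v = a then - s else 0))"
    using ab(4) by (intro sum.cong refl) (auto simp: c1_def)
  also have "\<dots> = 0" using ab V by (simp add: sum.distrib s_def)
  finally have s1: "(\<Sum>v\<in>V. c1 {v}) = 0" .
  then have z1: "simp_bd V c1 = 0" using simp_bd_vertices[OF V c1f] by simp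
  have "(\<Sum>v\<in>V. c2 {v}) = 0"
    using simp_bd_vertices[OF V c] c0 s1 by (simp add: c2_def sum_subtractf)
  then have z2: "simp_bd V c2 = 0" using simp_bd_vertices[OF V c2f] by simp
  obtain e1 where e1: "e1 \<in> face_chains V ?\<Delta>1 (Suc (Suc 0))" "simp_bd V e1 = c1"
    using simp_bd_cone[OF V ab(3) _ c1f z1] by auto
  obtain e2 where e2: "e2 \<in> face_chains V ?\<Delta>2 (Suc (Suc 0))" "simp_bd V e2 = c2"
    using simp_bd_cone[OF V ab(1) _ c2f z2] by auto
  have two: "\<sigma> \<in> \<Delta>" if card2: "card \<sigma> = Suc (Suc 0)" and \<sigma>: "\<sigma> \<in> ?\<Delta>1 \<union> ?\<Delta>2" for \<sigma>
  proof -
    have eq: "\<sigma> = {x, w}" if "\<sigma> - {x} = {w}" for x w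
      using that card2 by (cases "x \<in> \<sigma>") auto
    have ne: "\<sigma> - {x} \<noteq> {}" for x
    proof
      assume "\<sigma> - {x} = {}"
      then have "card \<sigma> \<le> card {x}" by (intro card_mono) auto
      with card2 show False by simp
    qed
    from \<sigma> ne consider w where "w \<in> A" "w \<in> V" "\<sigma> - {a} = {w}" | w where "w \<notin> A" "w \<in> V" "\<sigma> - {b} = {w}"
      by auto
    then show ?thesis
    proof cases
      case 1
      then show ?thesis using eq[OF 1(3)] star_a by simp
    next
      case 2
      then show ?thesis using eq[OF 2(3)] star_b by simp
    qed
  qed
  have "e1 + e2 \<in> face_chains V \<Delta> (Suc (Suc 0))"
    unfolding face_chains_def
  proof (intro CollectI allI impI)
    fix \<sigma> assume "(e1 + e2) \<sigma> \<noteq> 0"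
    then have "e1 \<sigma> \<noteq> 0 \<or> e2 \<sigma> \<noteq> 0" by auto
    then show "\<sigma> \<subseteq> V \<and> card \<sigma> = Suc (Suc 0) \<and> \<sigma> \<in> \<Delta>"
      using e1(1) e2(1) two[of \<sigma>] by (auto simp: face_chains_def)
  qed
  moreover have "simp_bd V (e1 + e2) = c"
  proof -
    have "commuting_actions (\<lambda>(_::'v) x :: 'k. x)" by (simp add: commuting_actions_def additive_def)
    then show ?thesis by (simp add: additive_koszul_bd(1) e1(2) e2(2) c2_def)
  qed
  ultimately show "\<exists>e \<in> face_chains V \<Delta> (Suc (Suc 0)). simp_bd V e = c" by blast
qed

section \<open>Matchings of cycles\<close>

lemma mono_has_matching: "mono (has_matching E k)"
  by (auto simp: mono_def le_bool_def intro: has_matching_mono)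

lemma card_Union_matching:
  assumes "\<And>e. e \<in> E \<Longrightarrow> card e = 2" "matching E M"
  shows "card (\<Union>M) = 2 * card M"
proof -
  have e: "card e = 2" if "e \<in> M" for e using that assms by (auto simp: matching_def)
  then have "card (\<Union>M) = sum card M"
    using assms(2) by (intro card_Union_disjoint) (auto simp: matching_def intro: card_ge_0_finite)
  then show ?thesis using e by simp
qed

lemma has_matching_0: "has_matching E 0 U"
  unfolding has_matching_def by (intro exI[of _ "{}"]) (simp add: matching_def)

lemma has_matching_insert_edge:
  assumes "has_matching E k U" "e \<in> E" "e \<noteq> {}" "e \<inter> U = {}"
  shows "has_matching E (Suc k) (e \<union> U)"
proof -
  obtain M where M: "finite M" "matching E M" "card M = k" "\<Union>M \<subseteq> U"
    using assms(1) by (auto simp: has_matching_def)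
  have "e \<notin> M" using M(4) assms(3,4) by blast
  moreover have "matching E (insert e M)"
    using M(2,4) assms(2,4) unfolding matching_def pairwise_insert disjnt_def by blast
  ultimately show ?thesis
    using M unfolding has_matching_def by (intro exI[of _ "insert e M"]) auto
qed

lemma cycle_edge_Suc: "1 \<le> i \<Longrightarrow> i < n \<Longrightarrow> {i, Suc i} \<in> cycle_edges n"
  unfolding cycle_edges_def by auto

text \<open>An interval of \<open>2 * j\<close> consecutive vertices is matched in neighbouring
  pairs; the bound \<open>Suc n\<close> ensures that these edges stay below the wrap-around
  edge.\<close>

lemma has_matching_add_interval:
  assumes "has_matching (cycle_edges n) k U" "1 \<le> a" "a + 2 * j \<le> Suc n" "{a..<a + 2 * j} \<inter> U = {}"
  shows "has_matching (cycle_edges n) (k + j) ({a..<a + 2 * j} \<union> U)"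
  using assms(3,4)
proof (induction j)
  case 0
  then show ?case using assms(1) by simp
next
  case (Suc j)
  have "has_matching (cycle_edges n) (k + j) ({a..<a + 2 * j} \<union> U)"
  proof (rule Suc.IH)
    show "a + 2 * j \<le> Suc n" using Suc.prems(1) by simp
    have "{a..<a + 2 * j} \<subseteq> {a..<a + 2 * Suc j}" by auto
    then show "{a..<a + 2 * j} \<inter> U = {}" using Suc.prems(2) by blast
  qed
  moreover have "{a + 2 * j, Suc (a + 2 * j)} \<inter> ({a..<a + 2 * j} \<union> U) = {}"
  proof -
    have "{a + 2 * j, Suc (a + 2 * j)} \<subseteq> {a..<a + 2 * Suc j}"
      "{a + 2 * j, Suc (a + 2 * j)} \<inter> {a..<a + 2 * j} = {}" by auto
    then show ?thesis using Suc.prems(2) by blast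
  qed
  moreover have "{a + 2 * j, Suc (a + 2 * j)} \<in> cycle_edges n"
    using Suc.prems assms(2) by (intro cycle_edge_Suc) auto
  ultimately have "has_matching (cycle_edges n) (Suc (k + j)) ({a + 2 * j, Suc (a + 2 * j)} \<union> ({a..<a + 2 * j} \<union> U))"
    by (intro has_matching_insert_edge) auto
  moreover have "{a + 2 * j, Suc (a + 2 * j)} \<union> ({a..<a + 2 * j} \<union> U) = {a..<a + 2 * Suc j} \<union> U" by auto
  ultimately show ?case by simp
qed

lemma cycle_edges_cases:
  assumes "e \<in> cycle_edges n"
  obtains i where "1 \<le> i" "i < n" "e = {i, Suc i}" | "e = {1, n}"
  using assms unfolding cycle_edges_def by force

lemma cycle_edge: "n \<ge> 3 \<Longrightarrow> e \<in> cycle_edges n \<Longrightarrow> e \<subseteq> cycle_vertices n \<and> card e = 2"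
  using finite_simple_graph_cycle[of n] by (auto simp: finite_simple_graph_def)

lemma matching_number_cycle:
  assumes n: "n \<ge> 3"
  shows "matching_number (cycle_edges n) = n div 2"
  unfolding matching_number_def
proof (rule Max_eqI)
  have E: "cycle_edges n \<subseteq> Pow (cycle_vertices n)" using cycle_edge[OF n] by blast
  have V: "finite (cycle_vertices n)" "card (cycle_vertices n) = n" by (simp_all add: cycle_vertices_def)
  have "matching (cycle_edges n) M \<Longrightarrow> M \<in> Pow (Pow (cycle_vertices n))" for M
    using E by (auto simp: matching_def)
  then have "{card M |M. matching (cycle_edges n) M} \<subseteq> card ` Pow (Pow (cycle_vertices n))" by blast
  then show "finite {card M |M. matching (cycle_edges n) M}"
    by (rule finite_subset) (simp add: V)
  fix y assume "y \<in> {card M |M. matching (cycle_edges n) M}"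
  then obtain M where M: "matching (cycle_edges n) M" "y = card M" by blast
  have "2 * card M = card (\<Union>M)" using card_Union_matching[OF _ M(1)] cycle_edge[OF n] by metis
  also have "\<dots> \<le> n" using card_mono[OF V(1), of "\<Union>M"] E M(1) V(2) by (auto simp: matching_def)
  finally show "y \<le> n div 2" using M(2) by linarith
next
  have "has_matching (cycle_edges n) (0 + n div 2) ({1..<1 + 2 * (n div 2)} \<union> {})"
    using n by (intro has_matching_add_interval has_matching_0) auto
  then obtain M where "matching (cycle_edges n) M" "card M = n div 2" by (auto simp: has_matching_def)
  then show "n div 2 \<in> {card M |M. matching (cycle_edges n) M}" by (intro CollectI exI[of _ M]) simp
qed

lemma generated_in_degree_cycle:
  assumes n: "n \<ge> 3" and k: "k \<le> n div 2"
  shows "generated_in_degree (cycle_vertices n) (has_matching (cycle_edges n) k) (2 * k)"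
  unfolding generated_in_degree_def
proof (intro conjI allI impI)
  have "has_matching (cycle_edges n) (0 + k) ({1..<1 + 2 * k} \<union> {})"
    using k by (intro has_matching_add_interval has_matching_0) auto
  then show "\<exists>U\<subseteq>cycle_vertices n. has_matching (cycle_edges n) k U"
    using k by (intro exI[of _ "{1..<1 + 2 * k}"]) (auto simp: cycle_vertices_def)
  fix U assume "U \<subseteq> cycle_vertices n" "has_matching (cycle_edges n) k U"
  then obtain M where M: "finite M" "matching (cycle_edges n) M" "card M = k" "\<Union>M \<subseteq> U"
    by (auto simp: has_matching_def)
  have "card (\<Union>M) = 2 * k" using card_Union_matching[OF _ M(2)] cycle_edge[OF n] M(3) by metis
  moreover have "has_matching (cycle_edges n) k (\<Union>M)" using M unfolding has_matching_def by blast
  ultimately show "\<exists>U'\<subseteq>U. card U' = 2 * k \<and> has_matching (cycle_edges n) k U'" using M(4) by blast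
qed

text \<open>Exactly \<open>2 * k\<close> vertices leave none uncovered by \<open>k\<close> disjoint
  edges.\<close>

lemma perfect_matching_of_card:
  assumes n: "n \<ge> 3" and "has_matching (cycle_edges n) k U" "finite U" "card U = 2 * k"
  obtains M where "matching (cycle_edges n) M" "\<Union>M = U"
proof -
  obtain M where M: "matching (cycle_edges n) M" "card M = k" "\<Union>M \<subseteq> U"
    using assms(2) by (auto simp: has_matching_def)
  have "card (\<Union>M) = 2 * k" using card_Union_matching[OF _ M(1)] cycle_edge[OF n] M(2) by metis
  then have "\<Union>M = U" using card_subset_eq[OF assms(3) M(3)] assms(4) by simp
  with M(1) show thesis by (rule that)
qed

text \<open>A matching edge that meets the gap between two uncovered vertices stays inside it, so
  the gap has evenly many vertices. The wrap-around edge cannot meet it, since neither 1 nor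
  \<open>n\<close> lies strictly between \<open>a\<close> and \<open>b\<close>.\<close>

lemma even_gap:
  assumes n: "n \<ge> 3" and M: "matching (cycle_edges n) M" and ab: "1 \<le> a" "a < b" "b \<le> n"
    and "a \<notin> \<Union>M" "b \<notin> \<Union>M" "{a<..<b} \<subseteq> \<Union>M"
  shows "odd (b - a)"
proof -
  define M' where "M' = {e \<in> M. e \<inter> {a<..<b} \<noteq> {}}"
  have "e \<subseteq> {a<..<b}" if "e \<in> M'" for e
  proof -
    have e: "e \<in> cycle_edges n" "e \<inter> {a<..<b} \<noteq> {}" "a \<notin> e" "b \<notin> e"
      using that M assms(6,7) by (auto simp: M'_def matching_def)
    from e(1) show ?thesis
    proof (cases rule: cycle_edges_cases)
      case (1 i)
      then have "i \<noteq> a" "i \<noteq> b" "Suc i \<noteq> a" "Suc i \<noteq> b" "a < i \<and> i < b \<or> a < Suc i \<and> Suc i < b"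
        using e by auto
      then have "a < i" "Suc i < b" by linarith+
      then show ?thesis using 1 by auto
    next
      case 2
      then show ?thesis using e ab by auto
    qed
  qed
  moreover have "x \<in> \<Union>M'" if "x \<in> {a<..<b}" for x
    using assms(8) that unfolding M'_def by blast
  ultimately have "\<Union>M' = {a<..<b}" by blast
  moreover have "matching (cycle_edges n) M'"
    using M unfolding matching_def M'_def by (auto intro: pairwise_subset)
  ultimately have "card {a<..<b} = 2 * card M'"
    using card_Union_matching[of "cycle_edges n" M'] cycle_edge[OF n] by metis
  then have "even (b - Suc a)" by simp
  then show ?thesis using ab(2) by presburger
qed

section \<open>Exactness when n \<le> 2 k + 2\<close>

text \<open>From \<open>p + 2 * k < card B \<le> n \<le> 2 * k + 2\<close> only \<open>p = 0\<close>
  and \<open>p = 1\<close> are left. For \<open>p = 0\<close> a matching misses some vertex of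
  \<open>B\<close>; \<open>p = 1\<close> forces \<open>B\<close> to be the whole vertex set.\<close>

lemma removal_complex_exact_cycle:
  assumes n: "n \<ge> 3" and k: "k \<le> n div 2" "n \<le> 2 * k + 2"
    and B: "B \<subseteq> cycle_vertices n" "p + 2 * k < card B"
  shows "simp_exact TYPE('k::field) (cycle_vertices n) (removal_complex (has_matching (cycle_edges n) k) B) p"
    (is "simp_exact _ ?V ?\<Delta> p")
proof -
  have V: "finite ?V" "card ?V = n" by (simp_all add: cycle_vertices_def)
  have cB: "card B \<le> n" using card_mono[OF V(1) B(1)] V(2) by simp
  show ?thesis
  proof (cases p)
    case 0
    have "\<exists>v\<in>?V. {v} \<in> ?\<Delta>" if "{} \<in> ?\<Delta>"
    proof -
      obtain M where M: "finite M" "matching (cycle_edges n) M" "card M = k" "\<Union>M \<subseteq> B"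
        using \<open>{} \<in> ?\<Delta>\<close> by (auto simp: removal_complex_def has_matching_def)
      have "card (\<Union>M) = 2 * k" using card_Union_matching[OF _ M(2)] cycle_edge[OF n] M(3) by metis
      then have "\<Union>M \<noteq> B" using B(2) by auto
      then obtain v where v: "v \<in> B" "v \<notin> \<Union>M" using M(4) by blast
      then have "has_matching (cycle_edges n) k (B - {v})"
        using M unfolding has_matching_def by (intro exI[of _ M]) auto
      then show ?thesis using v B(1) by (auto simp: removal_complex_def)
    qed
    then show ?thesis unfolding 0 by (rule simp_exact_0[OF V(1)])
  next
    case (Suc p')
    then have p: "p = Suc 0" "n = 2 * k + 2" "card B = n" using k B(2) cB by linarith+
    then have BV: "B = ?V" using card_subset_eq[OF V(1) B(1)] V(2) by simp
    have edge: "{a, b} \<in> ?\<Delta>" if "1 \<le> a" "a < b" "b \<le> n" "odd a" "even b" for a b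
    proof -
      obtain i where i: "a = Suc (2 * i)" using \<open>odd a\<close> by (auto elim: oddE)
      obtain j where j: "b = 2 * j" using \<open>even b\<close> by (auto elim: evenE)
      have ij: "i < j" "j \<le> Suc k" using that i j p by linarith+
      let ?U1 = "{Suc a..<Suc a + 2 * (j - Suc i)}"
      let ?U0 = "{1..<1 + 2 * i}"
      let ?U2 = "{Suc b..<Suc b + 2 * (Suc k - j)}"
      have 0: "has_matching (cycle_edges n) (0 + i) (?U0 \<union> {})"
        using ij p by (intro has_matching_add_interval has_matching_0) auto
      have 1: "has_matching (cycle_edges n) (0 + i + (j - Suc i)) (?U1 \<union> (?U0 \<union> {}))"
        using ij p i by (intro has_matching_add_interval[OF 0]) auto
      have "has_matching (cycle_edges n) (0 + i + (j - Suc i) + (Suc k - j)) (?U2 \<union> (?U1 \<union> (?U0 \<union> {})))"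
        using ij p i j by (intro has_matching_add_interval[OF 1]) auto
      moreover have "0 + i + (j - Suc i) + (Suc k - j) = k" using ij by linarith
      moreover have "?U2 \<union> (?U1 \<union> (?U0 \<union> {})) \<subseteq> ?V - {a, b}"
        using ij p i j by (auto simp: cycle_vertices_def)
      ultimately have "has_matching (cycle_edges n) k (?V - {a, b})" using has_matching_mono by metis
      then show ?thesis using that unfolding BV by (auto simp: removal_complex_def cycle_vertices_def)
    qed
    show ?thesis
      unfolding p(1)
    \<comment> \<open>Vertex 1 lies below all even vertices and \<open>n\<close> above all odd ones,
      so the pairs covered by \<open>edge\<close> contain both stars.\<close>
    proof (rule simp_exact_1_two_stars[OF V(1), where a = 1 and b = n and A = "{v. even v}"])
      show "1 \<in> ?V" "n \<in> ?V" "n \<in> {v. even v}" "(1::nat) \<notin> {v. even v}" using n p by (auto simp: cycle_vertices_def)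
      fix w assume w: "w \<in> ?V"
      { assume "w \<notin> {v. even v}"
        moreover from this have "w \<noteq> n" using p by auto
        ultimately show "{n, w} \<in> ?\<Delta>"
          using edge[of w n] w p by (auto simp: cycle_vertices_def insert_commute) }
      { assume "w \<in> {v. even v}"
        moreover from this have "w \<noteq> 1" by auto
        ultimately show "{1, w} \<in> ?\<Delta>" using edge[of 1 w] w by (auto simp: cycle_vertices_def) }
    qed
  qed
qed

section \<open>Failure of exactness when n > 2 k + 2\<close>

lemma coboundary_pair:
  assumes "u < w"
  shows "coboundary f {u, w} = f {w} - f {u}"
proof -
  have "{x \<in> {w}. x < u} = {}" "{x \<in> {u}. x < w} = {u}" using assms by auto
  then have sg: "sgn_ins u {w} x = x" "sgn_ins w {u} x = - x" for x :: 'b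
    by (simp_all only: sgn_ins_def) simp_all
  have D: "{u, w} - {u} = {w}" "{u, w} - {w} = {u}" using assms by auto
  have "coboundary f {u, w} = sgn_ins u ({u, w} - {u}) (f ({u, w} - {u})) + sgn_ins w ({u, w} - {w}) (f ({u, w} - {w}))"
    unfolding coboundary_def using assms by simp
  then show ?thesis unfolding D sg by simp
qed

lemma coboundary_triple:
  assumes "a < b" "b < c"
  shows "coboundary f {a, b, c} = f {b, c} - f {a, c} + f {a, b}"
proof -
  have D: "{a, b, c} - {a} = {b, c}" "{a, b, c} - {b} = {a, c}" "{a, b, c} - {c} = {a, b}"
    using assms by auto
  have "{x \<in> {b, c}. x < a} = {}" "{x \<in> {a, c}. x < b} = {a}" "{x \<in> {a, b}. x < c} = {a, b}" "a \<noteq> b"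
    using assms by auto
  then have sg: "sgn_ins a {b, c} x = x" "sgn_ins b {a, c} x = - x" "sgn_ins c {a, b} x = x" for x :: 'b
    by (simp_all only: sgn_ins_def) simp_all
  have 3: "a \<noteq> c" "b \<noteq> c" "a \<noteq> b" using assms by auto
  have "coboundary f {a, b, c} = sgn_ins a ({a, b, c} - {a}) (f ({a, b, c} - {a})) +
      (sgn_ins b ({a, b, c} - {b}) (f ({a, b, c} - {b})) + sgn_ins c ({a, b, c} - {c}) (f ({a, b, c} - {c})))"
    unfolding coboundary_def using 3 by simp
  then show ?thesis unfolding D sg by simp
qed

text \<open>The vertices 3 and \<open>n\<close> are missing from \<open>B\<close>, which cuts
  \<open>{1, 2}\<close> off from the path. A two-element face leaves \<open>2 * k\<close> perfectly
  matched vertices, so 1 and 2 are matched with each other or both deleted. Hence the indicator of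
  these two vertices is a cocycle, while 1 and 4 lie in different components.\<close>

lemma removal_complex_not_exact_cycle_1:
  assumes n: "n \<ge> 3" and k: "1 \<le> k" "2 * k + 4 \<le> n"
  defines "B \<equiv> {1, 2} \<union> {4..<4 + 2 * k}"
  shows "B \<subseteq> cycle_vertices n" "card B = 2 * k + 2"
    "\<not> simp_exact TYPE('k::field) (cycle_vertices n) (removal_complex (has_matching (cycle_edges n) k) B) 1"
proof -
  let ?V = "cycle_vertices n" and ?E = "cycle_edges n"
  show BV: "B \<subseteq> ?V" using k by (auto simp: B_def cycle_vertices_def)
  have finB: "finite B" by (simp add: B_def)
  have "{1, 2} \<inter> {4..<4 + 2 * k} = {}" by auto
  then show cB: "card B = 2 * k + 2" unfolding B_def by (subst card_Un_disjoint) auto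
  define f :: "nat set \<Rightarrow> 'k" where "f = (\<lambda>\<sigma>. if \<sigma> = {1} \<or> \<sigma> = {2} then 1 else 0)"
  show "\<not> simp_exact TYPE('k) ?V (removal_complex (has_matching ?E k) B) 1"
  proof (rule not_simp_exact_if_cocycle[where f = f and T = "{1, 4}"])
    show "finite ?V" by (simp add: cycle_vertices_def)
    show "{1, 4} \<subseteq> ?V" using k by (auto simp: cycle_vertices_def)
    show "card {1, 4 :: nat} = Suc 1" by simp
    show "coboundary f {1, 4} \<noteq> 0" by (simp add: coboundary_pair f_def)
    fix v assume "v \<in> {1, 4 :: nat}"
    then have "{1, 4} - {v} = {4} \<and> v = 1 \<or> {1, 4} - {v} = {1} \<and> v = 4" by auto
    moreover have "has_matching ?E k (B - {1})"
    proof -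
      have "has_matching ?E (0 + k) ({4..<4 + 2 * k} \<union> {})"
        using k by (intro has_matching_add_interval has_matching_0) auto
      then have "has_matching ?E k {4..<4 + 2 * k}" by simp
      then show ?thesis by (rule has_matching_mono) (auto simp: B_def)
    qed
    moreover have "has_matching ?E k (B - {4})"
    proof -
      \<comment> \<open>Without 4 the path has \<open>2 * k - 1\<close> vertices and carries only
        \<open>k - 1\<close> disjoint edges; \<open>{1, 2}\<close> supplies the missing one.\<close>
      have 1: "has_matching ?E (Suc 0) ({1, Suc 1} \<union> {})"
        using n by (intro has_matching_insert_edge has_matching_0 cycle_edge_Suc) auto
      have "has_matching ?E (Suc 0 + (k - 1)) ({5..<5 + 2 * (k - 1)} \<union> ({1, Suc 1} \<union> {}))"
        using k by (intro has_matching_add_interval[OF 1]) auto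
      moreover have "Suc 0 + (k - 1) = k" using k by simp
      ultimately have "has_matching ?E k ({5..<5 + 2 * (k - 1)} \<union> ({1, Suc 1} \<union> {}))" by simp
      then show ?thesis by (rule has_matching_mono) (use k in \<open>auto simp: B_def\<close>)
    qed
    ultimately have "has_matching ?E k (B - ({1, 4} - {v}))" by (elim disjE conjE) simp_all
    moreover have "{1, 4} \<subseteq> B" using k by (auto simp: B_def)
    ultimately show "{1, 4} - {v} \<in> removal_complex (has_matching ?E k) B"
      unfolding removal_complex_def by blast
  next
    fix T assume T: "T \<in> removal_complex (has_matching ?E k) B" "card T = Suc 1"
    then obtain u w where uw: "T = {u, w}" "u < w"
      by (metis card_2_iff insert_commute linorder_neqE_nat numeral_2_eq_2 One_nat_def)
    have TB: "T \<subseteq> B" "has_matching ?E k (B - T)" using T(1) by (auto simp: removal_complex_def)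
    have cBT: "card (B - T) = 2 * k" using TB(1) T(2) cB finB by (simp add: card_Diff_subset finite_subset)
    obtain M where M: "matching ?E M" "\<Union>M = B - T"
      using perfect_matching_of_card[OF n TB(2) _ cBT] finB by blast
    have "1 \<in> T \<longleftrightarrow> 2 \<in> T"
    proof (rule ccontr)
      assume neq: "\<not> (1 \<in> T \<longleftrightarrow> 2 \<in> T)"
      then obtain x where x: "x \<in> {1, 2}" "x \<in> B - T" "{1, 2} - {x} \<subseteq> T" by (auto simp: B_def)
      then have "x \<in> \<Union>M" using M(2) by simp
      then obtain e where "e \<in> M" "x \<in> e" by blast
      then have e: "e \<in> ?E" "x \<in> e" "e \<subseteq> B - T" using M by (auto simp: matching_def)
      from e(1) show False
      proof (cases rule: cycle_edges_cases)
        case (1 i)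
        then have "i \<in> B" "Suc i \<in> B" "i \<notin> T" "Suc i \<notin> T" "x = i \<or> x = Suc i" using e by auto
        moreover have "3 \<notin> B" by (simp add: B_def)
        ultimately have "Suc i \<noteq> 3" by metis
        moreover have "x = 1 \<or> x = 2" using x(1) by simp
        ultimately have "i = 1" using \<open>x = i \<or> x = Suc i\<close> \<open>1 \<le> i\<close> by linarith
        then have "1 \<notin> T" "2 \<notin> T" using \<open>i \<notin> T\<close> \<open>Suc i \<notin> T\<close> by (simp_all add: numeral_2_eq_2)
        then show False using neq by simp
      next
        case 2
        then have "n \<in> B" using e by auto
        then show False using k(2) by (simp add: B_def)
      qed
    qed
    then have "u = 1 \<and> w = 2 \<or> u \<noteq> 1 \<and> u \<noteq> 2 \<and> w \<noteq> 1 \<and> w \<noteq> 2"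
      using uw by (elim iffE) (simp, linarith)
    then show "coboundary f T = 0" using uw by (auto simp: coboundary_pair f_def)
  qed
qed

lemma card_3_sorted:
  fixes T :: "nat set"
  assumes "card T = 3"
  obtains a b c where "T = {a, b, c}" "a < b" "b < c"
proof -
  have fin: "finite T" using assms by (intro card_ge_0_finite) simp
  define xs where "xs = sorted_list_of_set T"
  have "length xs = 3" using assms by (simp add: xs_def)
  then obtain a b c where "xs = [a, b, c]"
    by (auto simp: length_Suc_conv numeral_3_eq_3)
  then have l: "sorted_list_of_set T = [a, b, c]" by (simp add: xs_def)
  have "T = {a, b, c}" using set_sorted_list_of_set[OF fin] by (simp add: l)
  moreover have "a < b" "b < c"
    using sorted_sorted_list_of_set[of T] distinct_sorted_list_of_set[of T] by (auto simp: l)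
  ultimately show thesis by (rule that)
qed

text \<open>For \<open>n = 2 * k + 3\<close> the faces of size three are the triples cutting the cycle into three arcs
  with evenly many interior vertices, so that \<open>(b - a) div 2 + 1\<close> is additive on them.\<close>

lemma removal_complex_not_exact_cycle_2:
  assumes k: "1 \<le> k" and n: "n = 2 * k + 3"
  shows "\<not> simp_exact TYPE('k::field) (cycle_vertices n)
    (removal_complex (has_matching (cycle_edges n) k) (cycle_vertices n)) 2"
proof -
  let ?V = "cycle_vertices n" and ?E = "cycle_edges n"
  have n3: "n \<ge> 3" using n by simp
  have V: "finite ?V" "card ?V = n" by (simp_all add: cycle_vertices_def)
  \<comment> \<open>When the gaps \<open>b - a\<close> and \<open>c - b\<close> are odd, their
    rounded halves add up to one less than half of \<open>c - a\<close>. Adding 1 to every value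
    repairs exactly this.\<close>
  define f :: "nat set \<Rightarrow> 'k" where "f = (\<lambda>\<sigma>. of_nat ((Max \<sigma> - Min \<sigma>) div 2 + 1))"
  have f: "f {a, b} = of_nat ((b - a) div 2 + 1)" if "a < b" for a b
    using that by (simp add: f_def)
  show ?thesis
  \<comment> \<open>Deleting 1, 2 and 4 isolates vertex 3 and leaves only \<open>2 * k\<close>
    vertices, so this triple is not a face, although each of its pairs is.\<close>
  proof (rule not_simp_exact_if_cocycle[OF V(1), where f = f and T = "{1, 2, 4}"])
    show "{1, 2, 4} \<subseteq> ?V" using k n by (auto simp: cycle_vertices_def)
    show "card {1, 2, 4 :: nat} = Suc 2" by simp
    have "coboundary f {1, 2, 4} = f {2, 4} - f {1, 4} + f {1, 2}" by (rule coboundary_triple) auto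
    \<comment> \<open>The value is 2 - 2 + 1, nonzero in every characteristic.\<close>
    also have "\<dots> = 1" by (simp add: f)
    finally show "coboundary f {1, 2, 4} \<noteq> 0" by simp
    fix v assume "v \<in> {1, 2, 4 :: nat}"
    moreover have "{1, 2, 4} - {1} = {2, 4 :: nat}" "{1, 2, 4} - {2} = {1, 4 :: nat}" "{1, 2, 4} - {4} = {1, 2 :: nat}"
      by auto
    ultimately consider "{1, 2, 4} - {v} = {2, 4}" | "{1, 2, 4} - {v} = {1, 4}" | "{1, 2, 4} - {v} = {1, 2}"
      by blast
    then have "has_matching ?E k (?V - ({1, 2, 4} - {v}))"
    proof cases
      case 1
      \<comment> \<open>Deleting 2 and 4 isolates 3, so the path from 5 through \<open>n\<close> to
        1 must be matched perfectly, which uses the wrap-around edge.\<close>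
      have 0: "has_matching ?E (Suc 0) ({1, n} \<union> {})"
        by (intro has_matching_insert_edge has_matching_0) (auto simp: cycle_edges_def)
      have "has_matching ?E (Suc 0 + (k - 1)) ({5..<5 + 2 * (k - 1)} \<union> ({1, n} \<union> {}))"
        using k n by (intro has_matching_add_interval[OF 0]) auto
      moreover have "Suc 0 + (k - 1) = k" using k by simp
      ultimately have "has_matching ?E k ({5..<5 + 2 * (k - 1)} \<union> ({1, n} \<union> {}))" by simp
      then show ?thesis unfolding 1 by (rule has_matching_mono) (use k n in \<open>auto simp: cycle_vertices_def\<close>)
    next
      case 2
      have 0: "has_matching ?E (Suc 0) ({2, Suc 2} \<union> {})"
        using n by (intro has_matching_insert_edge has_matching_0 cycle_edge_Suc) auto
      have "has_matching ?E (Suc 0 + (k - 1)) ({5..<5 + 2 * (k - 1)} \<union> ({2, Suc 2} \<union> {}))"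
        using k n by (intro has_matching_add_interval[OF 0]) auto
      moreover have "Suc 0 + (k - 1) = k" using k by simp
      ultimately have "has_matching ?E k ({5..<5 + 2 * (k - 1)} \<union> ({2, Suc 2} \<union> {}))" by simp
      then show ?thesis unfolding 2 by (rule has_matching_mono) (use k n in \<open>auto simp: cycle_vertices_def\<close>)
    next
      case 3
      have "has_matching ?E (0 + k) ({3..<3 + 2 * k} \<union> {})"
        using n by (intro has_matching_add_interval has_matching_0) auto
      then have "has_matching ?E k {3..<3 + 2 * k}" by simp
      then show ?thesis unfolding 3 by (rule has_matching_mono) (use n in \<open>auto simp: cycle_vertices_def\<close>)
    qed
    moreover have "{1, 2, 4} - {v} \<subseteq> ?V" using k n by (auto simp: cycle_vertices_def)
    ultimately show "{1, 2, 4} - {v} \<in> removal_complex (has_matching ?E k) ?V"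
      by (simp add: removal_complex_def)
  next
    fix T assume T: "T \<in> removal_complex (has_matching ?E k) ?V" "T \<subseteq> ?V" "card T = Suc 2"
    obtain a b c where abc: "T = {a, b, c}" "a < b" "b < c" using card_3_sorted[of T] T(3) by auto
    have cT: "card (?V - T) = 2 * k"
      using T(2,3) V n by (simp add: card_Diff_subset finite_subset)
    have "has_matching ?E k (?V - T)" using T(1) by (simp add: removal_complex_def)
    then obtain M where M: "matching ?E M" "\<Union>M = ?V - T"
      by (rule perfect_matching_of_card[OF n3 _ _ cT]) (simp_all add: V)
    have r: "1 \<le> a" "c \<le> n" using T(2) abc by (auto simp: cycle_vertices_def)
    have o1: "odd (b - a)"
      using r abc by (intro even_gap[OF n3 M(1)]) (auto simp: M(2) cycle_vertices_def)
    have o2: "odd (c - b)"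
      using r abc by (intro even_gap[OF n3 M(1)]) (auto simp: M(2) cycle_vertices_def)
    obtain i j where "b - a = 2 * i + 1" "c - b = 2 * j + 1" using oddE[OF o1] oddE[OF o2] by metis
    moreover have "c - a = (c - b) + (b - a)" using abc(2,3) by simp
    ultimately have "b - a = 2 * i + 1" "c - b = 2 * j + 1" "c - a = 2 * (i + j + 1)" by simp_all
    then have "(c - b) div 2 + 1 + ((b - a) div 2 + 1) = (c - a) div 2 + 1" by simp
    then have "of_nat ((c - b) div 2 + 1) + of_nat ((b - a) div 2 + 1) = (of_nat ((c - a) div 2 + 1) :: 'k)"
      by (metis of_nat_add)
    then have "f {a, c} = f {b, c} + f {a, b}"
      using f[of b c] f[of a c] f[of a b] abc(2,3) by simp
    then show "coboundary f T = 0"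
      unfolding abc(1) coboundary_triple[OF abc(2,3)] by simp
  qed
qed

theorem corollary4p4:
  fixes n k :: nat
  assumes "n \<ge> 3"
    and "1 \<le> k" and "k \<le> matching_number (cycle_edges n)"
  shows "has_linear_resolution (cycle_vertices n)
           (squarefree_power (cycle_vertices n)
              (edge_ideal (cycle_vertices n) (cycle_edges n)) k :: (nat, 'k::field) mpoly set)
         \<longleftrightarrow>
         (odd n \<longrightarrow> k = matching_number (cycle_edges n)) \<and>
         (even n \<longrightarrow> k \<in> {matching_number (cycle_edges n), matching_number (cycle_edges n) - 1})"
proof -
  let ?V = "cycle_vertices n" and ?W = "has_matching (cycle_edges n) k"
  note \<nu> = matching_number_cycle[OF assms(1)]
  have k: "k \<le> n div 2" using assms(3) \<nu> by simp
  have V: "finite ?V" by (simp add: cycle_vertices_def)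
  have "has_linear_resolution ?V (mono_ideal (sf_monos ?V ?W) :: (nat, 'k) mpoly set) \<longleftrightarrow>
      (\<forall>p d. d > int (2 * k) \<longrightarrow> (\<forall>B\<subseteq>?V. int (card B) = int p + d \<longrightarrow>
        simp_exact TYPE('k) ?V (removal_complex ?W B) p))"
    unfolding has_linear_resolution_sf_iff[OF V mono_has_matching generated_in_degree_cycle[OF assms(1) k]]
      koszul_exact_sf_iff[OF V mono_has_matching] simp_exact_def ..
  \<comment> \<open>The degree \<open>d\<close> is determined by
    \<open>d = card B - p\<close>.\<close>
  also have "\<dots> \<longleftrightarrow> (\<forall>p. \<forall>B\<subseteq>?V. p + 2 * k < card B \<longrightarrow> simp_exact TYPE('k) ?V (removal_complex ?W B) p)"
    (is "?A \<longleftrightarrow> ?B")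
  proof
    assume A: ?A
    show ?B
    proof (intro allI impI)
      fix p B assume "B \<subseteq> ?V" "p + 2 * k < card B"
      then show "simp_exact TYPE('k) ?V (removal_complex ?W B) p"
        using A[rule_format, of "int (card B) - int p" B p] by simp
    qed
  next
    assume ?B
    then show ?A by auto
  qed
  also have "\<dots> \<longleftrightarrow> n \<le> 2 * k + 2"
  proof
    assume ex: ?B
    show "n \<le> 2 * k + 2"
    proof (rule ccontr)
      assume "\<not> n \<le> 2 * k + 2"
      then consider "n = 2 * k + 3" | "2 * k + 4 \<le> n" by linarith
      then show False
      proof cases
        case 1
        have "card ?V = n" by (simp add: cycle_vertices_def)
        moreover have "\<not> simp_exact TYPE('k) ?V (removal_complex ?W ?V) 2"
          by (rule removal_complex_not_exact_cycle_2[OF assms(2) 1])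
        ultimately show False using ex[rule_format, of ?V 2] 1 by simp
      next
        case 2
        let ?B = "{1, 2} \<union> {4..<4 + 2 * k}"
        note B = removal_complex_not_exact_cycle_1[OF assms(1,2) 2]
        have "\<not> simp_exact TYPE('k) ?V (removal_complex ?W ?B) 1" by (rule B(3))
        then show False using ex[rule_format, OF B(1), of 1] B(2) by simp
      qed
    qed
  next
    assume "n \<le> 2 * k + 2"
    then show ?B using removal_complex_exact_cycle[OF assms(1) k] by blast
  qed
  also have "\<dots> \<longleftrightarrow> (odd n \<longrightarrow> k = n div 2) \<and> (even n \<longrightarrow> k \<in> {n div 2, n div 2 - 1})"
  proof (cases "even n")
    case True
    then obtain m where "n = 2 * m" by (rule evenE)
    then show ?thesis using k assms(1) by auto
  next
    case False
    then obtain m where "n = 2 * m + 1" by (rule oddE)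
    then show ?thesis using k assms(1) by auto
  qed
  finally show ?thesis
    unfolding \<nu> squarefree_power_eq[OF finite_simple_graph_cycle[OF assms(1)]] .
qed

end
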